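(* Let $(a_n)_{n\ge1}$ satisfy $a_n-\log n-(k-1)\log\log n\to\infty$ and $a_n=o(n^{1/3})$ as $n\to\infty$, and let $b_n=na_n^{k-1}e^{-a_n}$. Then, as $n\to\infty$, $$b_n^{-1}\,\mathbb{P}(L^{\mathsf{B}}_{k,n}\in\cdot)\to\xi_k\quad\text{in }\mathcal{M}_0,$$ where $$\xi_k(\cdot)=\frac{1}{(k-1)!}\int_E\mathbf{1}\{\delta_{(x,u)}\in\cdot\}\,e^{-u}\,dx\,du .$$
   Context: Fix integers $d\ge1$, $k\ge1$. The unit cube $[0,1]^d$ is equipped with the toroidal metric $\mathsf{dist}(x,y)=\min_{z\in\mathbb{Z}^d}\|x-y+z\|$ ($\|\cdot\|$ Euclidean), so it is viewed as a flat torus; $B_r(x)=\{y\in[0,1]^d:\mathsf{dist}(x,y)\le r\}$. $\theta_d$ is the volume of the unit ball of $\mathbb{R}^d$. For a point measure $\omega$ on $[0,1]^d$ and $x\in[0,1]^d$, $R_k(x,\omega)=\inf\{r>0:\omega(B_r(x)\setminus\{x\})\ge k\}$. $\mathcal{B}_n=\{X_1,\dots,X_n\}$ is a binomial point process: $X_1,X_2,\dots$ are i.i.d. uniform on $[0,1]^d$. $E=[0,1]^d\times(-\infty,\infty]$, and $M_p(E)$ is the space of point measures on $E$ with the vague topology, metrized by the vague metric. Define $L^{\mathsf{B}}_{k,n}\in M_p(E)$ by $L^{\mathsf{B}}_{k,n}=\sum_{X\in\mathcal{B}_n}\delta_{(X,\,n\theta_dR_k(X,\mathcal{B}_n)^d-a_n)}$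 for $n>k$, and $L^{\mathsf{B}}_{k,n}=\emptyset$ (the null measure) for $n\le k$. $\mathcal{M}_0$-topology: the origin of $M_p(E)$ is the null measure $\emptyset$, and $B_{\emptyset,r}$ is the open ball of radius $r$ around $\emptyset$ in the vague metric. $\mathcal{M}_0=\mathcal{M}_0(M_p(E))$ is the set of Borel measures on $M_p(E)$ whose restriction to $M_p(E)\setminus B_{\emptyset,r}$ is finite for every $r>0$. $\mathcal{C}_0$ is the set of bounded continuous real functions on $M_p(E)$ vanishing in a neighborhood of $\emptyset$. For $\xi_n,\xi\in\mathcal{M}_0$, $\xi_n\to\xi$ in $\mathcal{M}_0$ means $\int g\,d\xi_n\to\int g\,d\xi$ for all $g\in\mathcal{C}_0$. In the integral defining $\xi_k$, $dx\,du$ is Lebesgue measure (giving no mass to $u=\infty$). *)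

theory Defs
  imports "HOL-Probability.Probability" "HOL-Library.Landau_Symbols"
begin

section \<open>The unit cube as a flat torus\<close>

definition unit_cube :: "(real ^ 'd::finite) set" where
  "unit_cube = {x. \<forall>i. 0 \<le> x $ i \<and> x $ i \<le> 1}"

text \<open>The infimum over the integer lattice is attained, so it is the minimum.\<close>

definition torus_dist :: "real ^ 'd::finite \<Rightarrow> real ^ 'd \<Rightarrow> real" where
  "torus_dist x y = (INF z\<in>{z. \<forall>i. z $ i \<in> \<int>}. norm (x - y + z))"

definition torus_cball :: "real ^ 'd::finite \<Rightarrow> real \<Rightarrow> (real ^ 'd) set" where
  "torus_cball x r = {y \<in> unit_cube. torus_dist x y \<le> r}"

text \<open>
  The radius is an extended real, so that the infimum of the empty set is \<open>\<infinity>\<close>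
  (there may be fewer than \<open>k\<close> points of \<open>\<omega>\<close> different from \<open>x\<close>).
\<close>

definition knn_radius :: "nat \<Rightarrow> real ^ 'd::finite \<Rightarrow> (real ^ 'd) measure \<Rightarrow> ereal" where
  "knn_radius k x \<omega> =
     Inf {ereal r | r. 0 < r \<and> emeasure \<omega> (torus_cball x r - {x}) \<ge> of_nat k}"


section \<open>Point measures and the vague topology\<close>

text \<open>\<open>dirac_sum N I x\<close> is the sum over \<open>i \<in> I\<close> of the unit masses at \<open>x i\<close>,
  as a measure on the measurable space \<open>N\<close>; repeated points are counted with multiplicity.\<close>

definition dirac_sum :: "'a measure \<Rightarrow> 'i set \<Rightarrow> ('i \<Rightarrow> 'a) \<Rightarrow> 'a measure" where
  "dirac_sum N I x = distr (count_space I) N x"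

text \<open>
  The state space \<open>[0,1]^d \<times> (-\<infinity>,\<infinity>]\<close> has the subspace topology of \<open>(real ^ 'd) \<times> ereal\<close>; its
  compact subsets are the closed subsets of the sets \<open>[0,1]^d \<times> [c,\<infinity>]\<close>. Opposite faces
  of the cube are thus not glued in the vague topology (the toroidal distance would only be a
  pseudometric on the cube). Since every torus-continuous function on the cube is continuous,
  gluing them would only give fewer test functions and a weaker statement.
\<close>

definition E_set :: "((real ^ 'd::finite) \<times> ereal) set" where
  "E_set = unit_cube \<times> {-\<infinity><..}"

definition E_borel :: "((real ^ 'd::finite) \<times> ereal) measure" where
  "E_borel = restrict_space borel E_set"

definition point_measures :: "((real ^ 'd::finite) \<times> ereal) measure set" where
  "point_measures =
     {\<mu>. (\<exists>(I :: nat set) x. x \<in> I \<rightarrow> E_set \<and> \<mu> = dirac_sum E_borel I x) \<and>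
         (\<forall>K. compact K \<and> K \<subseteq> E_set \<longrightarrow> emeasure \<mu> K < \<infinity>)}"

definition CK_plus :: "((real ^ 'd::finite) \<times> ereal \<Rightarrow> real) set" where
  "CK_plus =
     {f. continuous_on E_set f \<and> (\<forall>p\<in>E_set. 0 \<le> f p) \<and>
         (\<exists>K. compact K \<and> K \<subseteq> E_set \<and> (\<forall>p\<in>E_set - K. f p = 0))}"

definition vague_topology :: "((real ^ 'd::finite) \<times> ereal) measure topology" where
  "vague_topology = topology_generated_by
     {{\<mu> \<in> point_measures. (\<integral>p. f p \<partial>\<mu>) \<in> U} | f U. f \<in> CK_plus \<and> open U}"

definition vague_borel :: "((real ^ 'd::finite) \<times> ereal) measure measure" where
  "vague_borel = sigma point_measures {U. openin vague_topology U}"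

text \<open>
  The usual vague metric is built from a non-canonical sequence of functions in \<open>CK_plus\<close>.
  We allow every metric inducing the vague topology, which is metrizable because the state
  space is locally compact, second countable and Hausdorff.
\<close>

definition vague_metric ::
  "(((real ^ 'd::finite) \<times> ereal) measure \<Rightarrow> ((real ^ 'd) \<times> ereal) measure \<Rightarrow> real) \<Rightarrow> bool" where
  "vague_metric \<rho> \<longleftrightarrow>
     Metric_space point_measures \<rho> \<and> Metric_space.mtopology point_measures \<rho> = vague_topology"


section \<open>Convergence in \<open>M\<^sub>0\<close>\<close>

definition M0_measures ::
  "(((real ^ 'd::finite) \<times> ereal) measure \<Rightarrow> ((real ^ 'd) \<times> ereal) measure \<Rightarrow> real) \<Rightarrow>
   ((real ^ 'd) \<times> ereal) measure measure set" where
  "M0_measures \<rho> =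
     {\<xi>. sets \<xi> = sets vague_borel \<and>
         (\<forall>r>0. emeasure \<xi>
            (point_measures - Metric_space.mball point_measures \<rho> (null_measure E_borel) r) < \<infinity>)}"

definition C0_functions :: "(((real ^ 'd::finite) \<times> ereal) measure \<Rightarrow> real) set" where
  "C0_functions =
     {g. continuous_map vague_topology euclideanreal g \<and> bounded (g ` point_measures) \<and>
         (\<exists>U. openin vague_topology U \<and> null_measure E_borel \<in> U \<and> (\<forall>\<mu>\<in>U. g \<mu> = 0))}"

definition M0_converges ::
  "(((real ^ 'd::finite) \<times> ereal) measure \<Rightarrow> ((real ^ 'd) \<times> ereal) measure \<Rightarrow> real) \<Rightarrow>
   (nat \<Rightarrow> ((real ^ 'd) \<times> ereal) measure measure) \<Rightarrow>
   ((real ^ 'd) \<times> ereal) measure measure \<Rightarrow> bool" where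
  "M0_converges \<rho> \<xi>s \<xi> \<longleftrightarrow>
     (\<forall>n. \<xi>s n \<in> M0_measures \<rho>) \<and> \<xi> \<in> M0_measures \<rho> \<and>
     (\<forall>g\<in>C0_functions. (\<lambda>n. \<integral>\<mu>. g \<mu> \<partial>\<xi>s n) \<longlonglongrightarrow> (\<integral>\<mu>. g \<mu> \<partial>\<xi>))"


section \<open>The \<open>k\<close>-nearest neighbour process and its limit\<close>

text \<open>In the next two definitions \<open>x 1, x 2, \<dots>\<close> is a realization of the sample.\<close>

definition binomial_process :: "(nat \<Rightarrow> real ^ 'd::finite) \<Rightarrow> nat \<Rightarrow> (real ^ 'd) measure" where
  "binomial_process x n = dirac_sum (restrict_space borel unit_cube) {1..n} x"

definition L_process ::
  "nat \<Rightarrow> (nat \<Rightarrow> real) \<Rightarrow> (nat \<Rightarrow> real ^ 'd::finite) \<Rightarrow> nat \<Rightarrow> ((real ^ 'd) \<times> ereal) measure" where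
  "L_process k a x n =
     (if n > k then
        dirac_sum E_borel {1..n}
          (\<lambda>i. (x i, ereal (real n * measure lborel (ball (0 :: real ^ 'd) 1)) *
                       knn_radius k (x i) (binomial_process x n) ^ CARD('d) - ereal (a n)))
      else null_measure E_borel)"

definition xi_limit :: "nat \<Rightarrow> ((real ^ 'd::finite) \<times> ereal) measure measure" where
  "xi_limit k =
     scale_measure (ennreal (1 / fact (k - 1)))
       (distr
          (density (restrict_space lborel (unit_cube \<times> UNIV)) (\<lambda>(x, u :: real). ennreal (exp (- u))))
          vague_borel
          (\<lambda>(x, u). return E_borel (x, ereal u)))"

end

theory Submission
  imports Defs "HOL-Real_Asymp.Real_Asymp"
begin

text \<open>
  Call \<open>n \<theta> R\<^sub>k(X\<^sub>i)^d - a\<^sub>n\<close> the score of the sample point \<open>X\<^sub>i\<close>. A test function \<open>g\<close> that vanishes near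
  the null measure vanishes on every configuration whose scores all lie below some level \<open>c\<close>,
  because vague neighbourhoods of the null measure are blind to what happens near score \<open>-\<infinity>\<close>.
  So \<open>g\<close> is only felt on the event that some score exceeds \<open>c\<close>, whose probability is of order
  \<open>b\<^sub>n\<close>. On that event, outside an exceptional set of probability \<open>o(b\<^sub>n)\<close>, exactly one score exceeds
  even a much lower level \<open>c'\<close>; then \<open>g\<close> of the whole configuration is close to \<open>g\<close> of the single Dirac mass at
  that point. The theorem thus reduces to the convergence of the intensity measure of the points
  \<open>(X\<^sub>i, score)\<close>, divided by \<open>b\<^sub>n\<close>, to \<open>e\<^sup>-\<^sup>u dx du / (k - 1)!\<close>.

  First moment. Given \<open>X\<^sub>i = x\<close>, the score exceeds \<open>s\<close> iff fewer than \<open>k\<close> of the other \<open>n - 1\<close> points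
  fall into a torus ball around \<open>x\<close> of volume \<open>(a\<^sub>n + s) / n\<close>. This is a binomial probability that
  does not depend on \<open>x\<close> (\<open>integral_one_point\<close>), and \<open>n\<close> times it is asymptotic to
  \<open>b\<^sub>n e\<^sup>-\<^sup>s / (k - 1)!\<close> (\<open>one_point_asymp\<close>).

  Second moment. The expected number of pairs of exceedances is \<open>o(b\<^sub>n)\<close>. Let \<open>r\<close> be the radius of
  the balls. Two points closer than \<open>\<epsilon> r\<close> count towards each other, so each has at most
  \<open>k - 2\<close> further neighbours; such pairs contribute at most a constant times \<open>\<epsilon>^d b\<^sub>n\<close>. At distance between
  \<open>\<epsilon> r\<close> and \<open>2 r\<close> the union of the two balls exceeds one ball by a fixed fraction \<open>\<delta>\<close>, and having
  few points in the union costs, up to powers of \<open>a\<^sub>n\<close>, an extra factor \<open>exp (- \<delta> a\<^sub>n)\<close>. Beyond \<open>2 r\<close> the balls are disjoint and the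
  contribution is of order \<open>b\<^sub>n\<^sup>2\<close>. See \<open>measure_two_points_le\<close> and \<open>pair_bound_asymp\<close>.

  Topology. A point with score in \<open>[c, \<infinity>]\<close> ranges over a compact set, since \<open>\<infinity>\<close> belongs to the state
  space. This makes the approximation of \<open>g\<close> by its value at a single Dirac mass uniform
  (\<open>C0_single_point_approx\<close>), although \<open>g\<close> itself is merely continuous. The same compactness allows
  to pass from tail probabilities to continuous test functions by step functions: in the
  coordinate \<open>v = e\<^sup>-\<^sup>u\<close> the scores in \<open>[c, \<infinity>]\<close> fill the compact interval \<open>[0, e\<^sup>-\<^sup>c]\<close>, and
  \<open>e\<^sup>-\<^sup>u du\<close> becomes Lebesgue measure.
\<close>


section \<open>The flat torus\<close>

definition int_lattice :: "(real ^ 'd::finite) set" where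
  "int_lattice = {z. \<forall>i. z $ i \<in> \<int>}"

lemma int_lattice_zero: "0 \<in> int_lattice"
  and int_lattice_add: "z \<in> int_lattice \<Longrightarrow> w \<in> int_lattice \<Longrightarrow> z + w \<in> int_lattice"
  and int_lattice_uminus: "z \<in> int_lattice \<Longrightarrow> - z \<in> int_lattice"
  by (auto simp: int_lattice_def)

lemma countable_int_lattice: "countable (int_lattice :: (real ^ 'd::finite) set)"
proof -
  have "int_lattice \<subseteq> range (\<lambda>f :: 'd \<Rightarrow> int. \<chi> i. real_of_int (f i))"
  proof
    fix z :: "real ^ 'd" assume "z \<in> int_lattice"
    then have "z = (\<chi> i. real_of_int \<lfloor>z $ i\<rfloor>)"
      by (auto simp: int_lattice_def vec_eq_iff elim!: Ints_cases)
    then show "z \<in> range (\<lambda>f :: 'd \<Rightarrow> int. \<chi> i. real_of_int (f i))"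
      by (rule range_eqI[where x = "\<lambda>i. \<lfloor>z $ i\<rfloor>"])
  qed
  then show ?thesis
    by (rule countable_subset) simp
qed

lemma closed_int_lattice: "closed (int_lattice :: (real ^ 'd::finite) set)"
proof -
  have "closed {z :: real ^ 'd. z $ i \<in> \<int>}" for i
  proof -
    have "closed ((\<lambda>z :: real ^ 'd. z $ i) -` \<int>)"
      by (intro closed_vimage closed_Ints continuous_intros)
    then show ?thesis by (simp add: vimage_def)
  qed
  then show ?thesis
    unfolding int_lattice_def by (intro closed_Collect_all)
qed

lemma int_lattice_norm_ge_1:
  assumes "z \<in> int_lattice" "z \<noteq> 0"
  shows "norm z \<ge> 1"
proof -
  obtain i where i: "z $ i \<noteq> 0"
    using assms(2) by (auto simp: vec_eq_iff)
  obtain m where m: "z $ i = of_int m"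
    using assms(1) by (auto simp: int_lattice_def elim: Ints_cases)
  have "1 \<le> \<bar>z $ i\<bar>"
    using i m by (simp flip: of_int_abs)
  also have "\<dots> \<le> norm z"
    by (rule component_le_norm_cart)
  finally show ?thesis .
qed

text \<open>
  The torus distance is the distance of the difference to the integer lattice. This makes it
  continuous and, as the lattice is closed, turns the infimum into a minimum.
\<close>

lemma torus_dist_infdist: "torus_dist x y = infdist (y - x) int_lattice"
proof -
  have "norm (x - y + z) = dist (y - x) z" for z
    by (simp add: dist_norm norm_minus_commute algebra_simps)
  then show ?thesis
    using int_lattice_zero unfolding torus_dist_def int_lattice_def[symmetric]
    by (subst infdist_notempty) auto
qed

lemma torus_dist_attained:
  obtains z where "z \<in> int_lattice" "torus_dist x y = norm (y + z - x)"
proof -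
  obtain z where z: "z \<in> int_lattice" "infdist (y - x) int_lattice = dist (y - x) z"
    using infdist_attains_inf[OF closed_int_lattice, of "y - x"] int_lattice_zero by blast
  show ?thesis
    by (rule that[of "- z"]) (use z in \<open>auto simp: torus_dist_infdist int_lattice_uminus dist_norm algebra_simps\<close>)
qed

lemma torus_dist_le_norm:
  assumes "z \<in> int_lattice"
  shows "torus_dist x y \<le> norm (y + z - x)"
  using infdist_le[OF int_lattice_uminus[OF assms], of "y - x"]
  by (simp add: torus_dist_infdist dist_norm algebra_simps)

lemma torus_dist_le_iff:
  "torus_dist x y \<le> r \<longleftrightarrow> (\<exists>z\<in>int_lattice. y + z \<in> cball x r)"
proof
  assume "torus_dist x y \<le> r"
  then show "\<exists>z\<in>int_lattice. y + z \<in> cball x r"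
    by (metis dist_commute dist_norm mem_cball torus_dist_attained)
next
  assume "\<exists>z\<in>int_lattice. y + z \<in> cball x r"
  then show "torus_dist x y \<le> r"
    by (metis dist_commute dist_norm mem_cball order_trans torus_dist_le_norm)
qed

lemma torus_dist_triangle: "torus_dist x y \<le> torus_dist x v + torus_dist v y"
proof -
  obtain z where z: "z \<in> int_lattice" "torus_dist x v = norm (v + z - x)"
    by (rule torus_dist_attained)
  obtain z' where z': "z' \<in> int_lattice" "torus_dist v y = norm (y + z' - v)"
    by (rule torus_dist_attained)
  have "torus_dist x y \<le> norm (y + (z + z') - x)"
    using z z' by (intro torus_dist_le_norm int_lattice_add)
  also have "\<dots> = norm ((v + z - x) + (y + z' - v))"
    by (simp add: algebra_simps)
  also have "\<dots> \<le> norm (v + z - x) + norm (y + z' - v)"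
    by (rule norm_triangle_ineq)
  finally show ?thesis using z z' by simp
qed

lemma torus_dist_commute: "torus_dist x y = torus_dist y x"
proof -
  have "torus_dist y x \<le> torus_dist x y" for x y :: "real ^ 'd"
  proof -
    obtain z where z: "z \<in> int_lattice" "torus_dist x y = norm (y + z - x)"
      by (rule torus_dist_attained)
    have "torus_dist y x \<le> norm (x + (- z) - y)"
      using z by (intro torus_dist_le_norm int_lattice_uminus)
    also have "\<dots> = norm (y + z - x)"
      by (metis add.commute diff_diff_eq2 norm_minus_commute uminus_add_conv_diff)
    finally show ?thesis using z by simp
  qed
  then show ?thesis by (meson antisym)
qed

lemma measurable_torus_dist [measurable]:
  "(\<lambda>p. torus_dist (fst p) (snd p)) \<in> borel_measurable (borel \<Otimes>\<^sub>M borel)"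
  unfolding torus_dist_infdist borel_prod
  by (intro borel_measurable_continuous_onI continuous_intros)

lemma measurable_torus_dist2 [measurable (raw)]:
  assumes [measurable]: "f \<in> borel_measurable M" "g \<in> borel_measurable M"
  shows "(\<lambda>w. torus_dist (f w) (g w)) \<in> borel_measurable M"
  using measurable_compose[OF measurable_Pair[OF assms] measurable_torus_dist] by simp

lemma unit_cube_cbox: "unit_cube = cbox 0 (\<chi> i. 1)"
  by (auto simp: unit_cube_def mem_box_cart)

lemma compact_unit_cube: "compact unit_cube"
  by (simp add: unit_cube_cbox)

lemma sets_unit_cube [measurable]: "unit_cube \<in> sets borel"
  by (simp add: unit_cube_cbox)

lemma emeasure_unit_cube: "emeasure lborel unit_cube = 1"
proof -
  have "(\<Prod>b\<in>Basis. ((\<chi> i. 1) - 0 :: real ^ 'd) \<bullet> b) = 1"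
    by (intro prod.neutral) (auto simp: Basis_vec_def inner_axis)
  then show ?thesis
    unfolding unit_cube_cbox
    by (subst emeasure_lborel_cbox) (auto simp: Basis_vec_def inner_axis)
qed

definition cube_law :: "(real ^ 'd::finite) measure" where
  "cube_law = uniform_measure lborel unit_cube"

lemma sets_cube_law [simp, measurable_cong]: "sets cube_law = sets borel"
  and space_cube_law [simp]: "space cube_law = UNIV"
  by (auto simp: cube_law_def)

lemma prob_space_cube_law: "prob_space cube_law"
  unfolding cube_law_def by (rule prob_space_uniform_measure) (auto simp: emeasure_unit_cube)

lemma emeasure_cube_law:
  "A \<in> sets borel \<Longrightarrow> emeasure cube_law A = emeasure lborel (unit_cube \<inter> A)"
  by (simp add: cube_law_def emeasure_unit_cube divide_ennreal_def)

text \<open>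
  Cut \<open>A\<close> along the translates of the half-open unit cube. Moving the pieces back into the cube
  produces the periodization of \<open>A\<close>, and the pieces do not overlap because no two points
  of \<open>A\<close> differ by a lattice vector. This transfers Euclidean volumes to the torus.
\<close>

lemma emeasure_lborel_periodization:
  fixes A :: "(real ^ 'd::finite) set"
  assumes [measurable]: "A \<in> sets borel"
    and inj: "\<And>v w z. v \<in> A \<Longrightarrow> w \<in> A \<Longrightarrow> v - w \<in> int_lattice \<Longrightarrow> v = w"
  shows "emeasure lborel {y \<in> unit_cube. \<exists>z\<in>int_lattice. y + z \<in> A} = emeasure lborel A"
proof -
  define Q :: "(real ^ 'd) set" where "Q = {x. \<forall>i. 0 \<le> x $ i \<and> x $ i < 1}"
  have [measurable]: "Q \<in> sets borel"
    unfolding Q_def by measurable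
  let ?L = "int_lattice :: (real ^ 'd) set"
  have cnt: "countable ?L" by (rule countable_int_lattice)
  let ?B = "box 0 (\<chi> i. 1) :: (real ^ 'd) set"
  have "emeasure lborel (unit_cube - ?B) = emeasure lborel (unit_cube :: (real ^ 'd) set) - emeasure lborel ?B"
    unfolding unit_cube_cbox
    by (rule emeasure_Diff) (auto simp: box_subset_cbox emeasure_lborel_box_eq)
  also have "emeasure lborel ?B = emeasure lborel (unit_cube :: (real ^ 'd) set)"
    by (simp add: unit_cube_cbox emeasure_lborel_box_eq emeasure_lborel_cbox_eq)
  finally have null: "unit_cube - ?B \<in> null_sets lborel"
    by (auto simp: null_sets_def emeasure_unit_cube)
  have Bsub: "?B \<subseteq> Q" and Qsub: "Q \<subseteq> unit_cube"
    by (auto simp: Q_def mem_box_cart unit_cube_def less_imp_le)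
  have PB: "{y. \<exists>z\<in>?L. y + z \<in> A} \<in> sets borel"
  proof -
    have "{y. \<exists>z\<in>?L. y + z \<in> A} = (\<Union>z\<in>?L. (\<lambda>y. y + z) -` A)"
      by auto
    moreover have "(\<lambda>y. y + z) -` A \<in> sets borel" for z
      by (rule measurable_sets_borel[OF _ assms(1)]) simp
    ultimately show ?thesis
      using cnt by (auto intro!: sets.countable_UN'')
  qed
  have "emeasure lborel {y \<in> unit_cube. \<exists>z\<in>?L. y + z \<in> A} =
        emeasure lborel (unit_cube \<inter> {y. \<exists>z\<in>?L. y + z \<in> A})"
    by (simp add: Collect_conj_eq)
  also have "\<dots> = emeasure lborel (Q \<inter> {y. \<exists>z\<in>?L. y + z \<in> A})"
  proof (rule emeasure_eq_AE)
    show "AE x in lborel. (x \<in> unit_cube \<inter> {y. \<exists>z\<in>?L. y + z \<in> A}) =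
                          (x \<in> Q \<inter> {y. \<exists>z\<in>?L. y + z \<in> A})"
      using AE_not_in[OF null] by eventually_elim (use Bsub Qsub in auto)
  qed (use PB in auto)
  also have "Q \<inter> {y. \<exists>z\<in>?L. y + z \<in> A} = (\<Union>z\<in>?L. {y. y \<in> Q \<and> y + z \<in> A})"
    by auto
  also have "emeasure lborel \<dots> = (\<integral>\<^sup>+z. emeasure lborel {y. y \<in> Q \<and> y + z \<in> A} \<partial>count_space ?L)"
  proof (rule emeasure_UN_countable[OF _ cnt])
    show "disjoint_family_on (\<lambda>z. {y. y \<in> Q \<and> y + z \<in> A}) ?L"
      unfolding disjoint_family_on_def
    proof safe
      fix z w y :: "real ^ 'd"
      assume *: "z \<in> ?L" "w \<in> ?L" "z \<noteq> w" "y + z \<in> A" "y + w \<in> A"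
      have "(y + z) - (y + w) \<in> ?L"
        using int_lattice_add[OF *(1) int_lattice_uminus[OF *(2)]] by simp
      from inj[OF *(4) *(5) this] *(3) show "y \<in> {}" by simp
    qed
  qed auto
  also have "\<dots> = (\<integral>\<^sup>+z. emeasure lborel {w. w \<in> A \<and> w - z \<in> Q} \<partial>count_space ?L)"
  proof (rule nn_integral_cong)
    fix z :: "real ^ 'd"
    have "emeasure lborel {w. w \<in> A \<and> w - z \<in> Q} =
          emeasure (distr lborel borel ((+) z)) {w. w \<in> A \<and> w - z \<in> Q}"
      by (simp add: lborel_distr_plus)
    also have "\<dots> = emeasure lborel {y. y \<in> Q \<and> y + z \<in> A}"
      by (subst emeasure_distr) (auto intro!: arg_cong[where f = "emeasure lborel"] simp: add.commute)
    finally show "emeasure lborel {y. y \<in> Q \<and> y + z \<in> A} = emeasure lborel {w. w \<in> A \<and> w - z \<in> Q}"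
      by simp
  qed
  also have "\<dots> = emeasure lborel (\<Union>z\<in>?L. {w. w \<in> A \<and> w - z \<in> Q})"
  proof (rule emeasure_UN_countable[OF _ cnt, symmetric])
    show "disjoint_family_on (\<lambda>z. {w. w \<in> A \<and> w - z \<in> Q}) ?L"
      unfolding disjoint_family_on_def
    proof safe
      fix z w y :: "real ^ 'd"
      assume *: "z \<in> ?L" "w \<in> ?L" "z \<noteq> w" "y - z \<in> Q" "y - w \<in> Q"
      obtain i where i: "z $ i \<noteq> w $ i"
        using *(3) by (auto simp: vec_eq_iff)
      obtain m l where ml: "z $ i = of_int m" "w $ i = of_int l"
        using *(1,2) unfolding int_lattice_def by (metis Ints_cases mem_Collect_eq)
      have "0 \<le> y $ i - of_int m" "y $ i - of_int m < 1" "0 \<le> y $ i - of_int l" "y $ i - of_int l < 1"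
        using *(4,5) ml by (auto simp: Q_def dest!: spec[of _ i])
      then have "m = l" by linarith
      then show "y \<in> {}" using i ml by simp
    qed
  qed auto
  also have "(\<Union>z\<in>?L. {w. w \<in> A \<and> w - z \<in> Q}) = A"
  proof -
    have "w - (\<chi> i. of_int \<lfloor>w $ i\<rfloor>) \<in> Q" "(\<chi> i. of_int \<lfloor>w $ i\<rfloor>) \<in> ?L" for w :: "real ^ 'd"
      by (auto simp: Q_def int_lattice_def) (metis diff_less_eq real_of_int_floor_add_one_gt add.commute)
    then show ?thesis by blast
  qed
  finally show ?thesis .
qed

definition unit_ball_volume :: "'d::finite itself \<Rightarrow> real" where
  "unit_ball_volume _ = measure lborel (ball (0 :: real ^ 'd) 1)"

lemma unit_ball_volume_pos: "unit_ball_volume TYPE('d::finite) > 0"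
  unfolding unit_ball_volume_def
  using content_ball_pos[of 1 "0 :: real ^ 'd"] by simp

lemma measure_lborel_cball:
  fixes x :: "real ^ 'd::finite"
  assumes "r \<ge> 0"
  shows "measure lborel (cball x r) = unit_ball_volume TYPE('d) * r ^ CARD('d)"
  using content_ball_conv_unit_ball[OF assms, of x]
  by (simp add: content_cball_conv_ball unit_ball_volume_def mult.commute)

lemma small_set_lattice_inj:
  assumes "v \<in> cball c s" "w \<in> cball c s" "s < 1 / 2" "v - w \<in> int_lattice"
  shows "v = w"
proof (rule ccontr)
  assume "v \<noteq> w"
  then have "1 \<le> norm (v - w)"
    by (intro int_lattice_norm_ge_1 assms) auto
  moreover have "norm (v - w) \<le> s + s"
    using dist_triangle2[of v w c] assms(1,2) by (simp add: dist_norm norm_minus_commute)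
  ultimately show False using assms(3) by simp
qed

lemma emeasure_cball_eq_measure:
  "emeasure lborel (cball c s) = ennreal (measure lborel (cball (c::'a::euclidean_space) s))"
  using emeasure_lborel_cball_finite[of c s] by (intro emeasure_eq_ennreal_measure) auto

lemma measure_torus_ball:
  fixes x :: "real ^ 'd::finite"
  assumes "0 \<le> r" "r < 1 / 2"
  shows "measure cube_law {y. torus_dist x y \<le> r} = unit_ball_volume TYPE('d) * r ^ CARD('d)"
proof -
  have "emeasure cube_law {y. torus_dist x y \<le> r} = emeasure lborel (unit_cube \<inter> {y. torus_dist x y \<le> r})"
    by (rule emeasure_cube_law) measurable
  also have "unit_cube \<inter> {y. torus_dist x y \<le> r} = {y \<in> unit_cube. \<exists>z\<in>int_lattice. y + z \<in> cball x r}"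
    by (auto simp: torus_dist_le_iff)
  also have "emeasure lborel \<dots> = emeasure lborel (cball x r)"
  proof (rule emeasure_lborel_periodization)
    show "v = w" if "v \<in> cball x r" "w \<in> cball x r" "v - w \<in> int_lattice" for v w
      using small_set_lattice_inj[OF that(1,2) assms(2) that(3)] .
  qed simp
  finally have "emeasure cube_law {y. torus_dist x y \<le> r} = emeasure lborel (cball x r)" .
  then have "measure cube_law {y. torus_dist x y \<le> r} = measure lborel (cball x r)"
    by (simp add: measure_def)
  then show ?thesis
    using measure_lborel_cball[OF assms(1)] by metis
qed

text \<open>
  Push the centre \<open>y\<close> away from \<open>x\<close> almost to the boundary of its ball: the small ball of radius
  \<open>\<epsilon> r / 4\<close> there lies inside the ball around \<open>y\<close> and outside the one around \<open>x\<close>. The bound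
  \<open>r < 1 / 4\<close> prevents it from meeting a lattice translate of the ball around \<open>x\<close>.
\<close>

lemma measure_torus_crescent_ge:
  fixes x y :: "real ^ 'd::finite"
  assumes \<epsilon>: "0 < \<epsilon>" "\<epsilon> \<le> 1" and r: "0 < r" "r < 1 / 4"
    and far: "\<epsilon> * r \<le> torus_dist x y" and close: "torus_dist x y \<le> 2 * r"
  shows "measure cube_law {v. torus_dist y v \<le> r \<and> r < torus_dist x v}
           \<ge> (\<epsilon> / 4) ^ CARD('d) * (unit_ball_volume TYPE('d) * r ^ CARD('d))"
proof -
  obtain z0 where z0: "z0 \<in> int_lattice" "torus_dist x y = norm (y + z0 - x)"
    by (rule torus_dist_attained)
  define \<tau> where "\<tau> = norm (y + z0 - x)"
  have \<tau>12: "\<epsilon> * r \<le> \<tau>" "\<tau> \<le> 2 * r"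
    using far close z0 by (auto simp: \<tau>_def)
  have "0 < \<epsilon> * r" using \<epsilon> r by simp
  note \<tau> = \<tau>12 order.strict_trans2[OF this \<tau>12(1)]
  \<comment> \<open>\<open>c\<close> is the centre of the small ball, in the direction \<open>e\<close> from \<open>x\<close> to the lattice translate of \<open>y\<close> nearest to it.\<close>
  define s where "s = \<epsilon> * r / 4"
  have s: "0 < s" "s \<le> r / 4" using \<epsilon> r by (auto simp: s_def mult_le_cancel_right1)
  define e where "e = (y + z0 - x) /\<^sub>R \<tau>"
  have e: "norm e = 1" "\<tau> *\<^sub>R e = y + z0 - x" using \<tau> by (auto simp: e_def \<tau>_def[symmetric])
  define c where "c = y + z0 + (r - s) *\<^sub>R e"
  have cx: "c - x = (\<tau> + r - s) *\<^sub>R e"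
    using e by (simp add: c_def algebra_simps)
  have dcx: "dist c x = \<tau> + r - s"
    unfolding dist_norm cx using e \<tau> s r by simp
  have dcy: "dist c (y + z0) = r - s"
    unfolding dist_norm c_def using e s r by simp
  have sub: "{v \<in> unit_cube. \<exists>z\<in>int_lattice. v + z \<in> cball c s} \<subseteq>
             unit_cube \<inter> {v. torus_dist y v \<le> r \<and> r < torus_dist x v}"
  proof safe
    fix v z assume z: "z \<in> int_lattice" and v: "v + z \<in> cball c s"
    have "torus_dist y v \<le> norm (v + (z + - z0) - y)"
      by (intro torus_dist_le_norm int_lattice_add int_lattice_uminus z z0)
    also have "\<dots> = dist (v + z) (y + z0)"
      by (simp add: dist_norm algebra_simps)
    also have "\<dots> \<le> dist (v + z) c + dist c (y + z0)"
      by (rule dist_triangle)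
    also have "\<dots> \<le> r" using v dcy by (simp add: dist_commute)
    finally show "torus_dist y v \<le> r" .
    have vx: "\<tau> + r - 2 * s \<le> dist (v + z) x" "dist (v + z) x \<le> \<tau> + r"
      using dist_triangle[of c x "v + z"] dist_triangle[of "v + z" x c] dcx v
      by (auto simp: dist_commute)
    obtain z1 where z1: "z1 \<in> int_lattice" "torus_dist x v = norm (v + z1 - x)"
      by (rule torus_dist_attained)
    show "r < torus_dist x v"
    proof (cases "z1 = z")
      case True
      have "2 * s < \<tau>" using \<tau> \<epsilon> r s by (auto simp: s_def)
      then show ?thesis using z1 vx True by (simp add: dist_norm)
    next
      case False
      have "1 \<le> norm (z1 + - z)"
        using False by (intro int_lattice_norm_ge_1 int_lattice_add int_lattice_uminus z z1) auto
      also have "\<dots> = norm ((v + z1 - x) - (v + z - x))" by simp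
      also have "\<dots> \<le> norm (v + z1 - x) + norm (v + z - x)" by (rule norm_triangle_ineq4)
      finally show ?thesis using z1 vx \<tau> r by (simp add: dist_norm)
    qed
  qed
  have [measurable]: "{v. torus_dist y v \<le> r \<and> r < torus_dist x v} \<in> sets borel"
    by measurable
  have "emeasure lborel (cball c s) = emeasure lborel {v \<in> unit_cube. \<exists>z\<in>int_lattice. v + z \<in> cball c s}"
  proof (rule emeasure_lborel_periodization[symmetric])
    show "v = w" if "v \<in> cball c s" "w \<in> cball c s" "v - w \<in> int_lattice" for v w
      by (rule small_set_lattice_inj[OF that(1,2) _ that(3)]) (use s r in simp)
  qed simp
  also have "\<dots> \<le> emeasure lborel (unit_cube \<inter> {v. torus_dist y v \<le> r \<and> r < torus_dist x v})"
    by (rule emeasure_mono[OF sub]) auto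
  also have "\<dots> = emeasure cube_law {v. torus_dist y v \<le> r \<and> r < torus_dist x v}"
    by (rule emeasure_cube_law[symmetric]) measurable
  finally have "measure lborel (cball c s) \<le> measure cube_law {v. torus_dist y v \<le> r \<and> r < torus_dist x v}"
    unfolding emeasure_cball_eq_measure
    by (simp add: finite_measure.emeasure_eq_measure[OF prob_space.finite_measure[OF prob_space_cube_law]])
  moreover have "measure lborel (cball c s) =
      (\<epsilon> / 4) ^ CARD('d) * (unit_ball_volume TYPE('d) * r ^ CARD('d))"
    using measure_lborel_cball[of s c] s
    by (simp add: s_def power_mult_distrib power_divide field_simps)
  ultimately show ?thesis by simp
qed

section \<open>Nearest neighbour counts of uniform samples\<close>

text \<open>
  The probability that a binomial variable with parameters \<open>m\<close> and \<open>q\<close> is less than \<open>K\<close>.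
\<close>

definition binom_lower :: "nat \<Rightarrow> real \<Rightarrow> nat \<Rightarrow> real" where
  "binom_lower m q K = (\<Sum>t<K. real (m choose t) * q ^ t * (1 - q) ^ (m - t))"

lemma binom_lower_nonneg: "0 \<le> q \<Longrightarrow> q \<le> 1 \<Longrightarrow> 0 \<le> binom_lower m q K"
  unfolding binom_lower_def by (intro sum_nonneg) auto

text \<open>
  The event is the disjoint union, over the sets \<open>T\<close> of fewer than \<open>K\<close> indices, of the boxes in which
  precisely the coordinates in \<open>T\<close> lie in \<open>A\<close>.
\<close>

lemma measure_PiM_card_less:
  fixes J :: "'i set"
  assumes "prob_space N" and A: "A \<in> sets N" and J: "finite J"
  shows "measure (\<Pi>\<^sub>M j\<in>J. N) {y \<in> space (\<Pi>\<^sub>M j\<in>J. N). card {j\<in>J. y j \<in> A} < K} =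
         binom_lower (card J) (measure N A) K"
proof -
  interpret N: prob_space N by fact
  interpret P: finite_product_prob_space "\<lambda>_::'i. N" J by unfold_locales fact
  define q where "q = measure N A"
  define Box where "Box = (\<lambda>T. \<Pi>\<^sub>E j\<in>J. if j \<in> T then A else space N - A)"
  define \<T> where "\<T> = {T. T \<subseteq> J \<and> card T < K}"
  have fin: "finite \<T>"
    by (rule finite_subset[of _ "Pow J"]) (auto simp: \<T>_def J)
  have "{y \<in> space (\<Pi>\<^sub>M j\<in>J. N). card {j\<in>J. y j \<in> A} < K} = (\<Union>T\<in>\<T>. Box T)"
  proof (intro equalityI subsetI)
    fix y assume "y \<in> {y \<in> space (\<Pi>\<^sub>M j\<in>J. N). card {j\<in>J. y j \<in> A} < K}"
    then have "{j\<in>J. y j \<in> A} \<in> \<T>" "y \<in> Box {j\<in>J. y j \<in> A}"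
      by (auto simp: \<T>_def Box_def space_PiM PiE_iff)
    then show "y \<in> (\<Union>T\<in>\<T>. Box T)" by blast
  next
    fix y assume "y \<in> (\<Union>T\<in>\<T>. Box T)"
    then obtain T where T: "T \<in> \<T>" "y \<in> Box T" by blast
    have mem: "y j \<in> (if j \<in> T then A else space N - A)" if "j \<in> J" for j
      using PiE_mem[OF T(2)[unfolded Box_def] that] .
    have "{j\<in>J. y j \<in> A} = T"
    proof -
      have "y j \<in> A \<longleftrightarrow> j \<in> T" if "j \<in> J" for j
        using mem[OF that] by (auto split: if_splits)
      then show ?thesis using T(1) by (auto simp: \<T>_def)
    qed
    moreover have "y \<in> space (\<Pi>\<^sub>M j\<in>J. N)"
      using T(2) sets.sets_into_space[OF A] unfolding Box_def space_PiM PiE_iff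
      by (auto split: if_splits)
    ultimately show "y \<in> {y \<in> space (\<Pi>\<^sub>M j\<in>J. N). card {j\<in>J. y j \<in> A} < K}"
      using T(1) by (simp add: \<T>_def)
  qed
  also have "P.prob (\<Union>T\<in>\<T>. Box T) = (\<Sum>T\<in>\<T>. P.prob (Box T))"
  proof (rule P.finite_measure_finite_Union[OF fin])
    show "Box ` \<T> \<subseteq> P.events"
      unfolding Box_def using A by (auto intro!: sets_PiM_I_finite J)
    show "disjoint_family_on Box \<T>"
      unfolding disjoint_family_on_def
    proof (intro ballI impI equalityI subsetI)
      fix S T y assume ST: "S \<in> \<T>" "T \<in> \<T>" "S \<noteq> T" and y: "y \<in> Box S \<inter> Box T"
      obtain j where j: "j \<in> J" "(j \<in> S) \<noteq> (j \<in> T)" using ST by (auto simp: \<T>_def)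
      then show "y \<in> {}"
        using y by (auto simp: Box_def PiE_iff dest!: bspec[of J _ j] split: if_splits)
    qed simp
  qed
  also have "\<dots> = (\<Sum>T\<in>\<T>. q ^ card T * (1 - q) ^ (card J - card T))"
  proof (rule sum.cong[OF refl])
    fix T assume T: "T \<in> \<T>"
    have "P.prob (Box T) = (\<Prod>j\<in>J. measure N (if j \<in> T then A else space N - A))"
      unfolding Box_def using A by (intro P.prob_times) auto
    also have "\<dots> = (\<Prod>j\<in>J. if j \<in> T then q else 1 - q)"
      using A by (intro prod.cong) (auto simp: q_def N.prob_compl)
    also have "\<dots> = q ^ card (J \<inter> T) * (1 - q) ^ card (J - T)"
      using J by (simp add: prod.If_cases Diff_eq Int_def)
    also have "J \<inter> T = T" using T by (auto simp: \<T>_def)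
    also have "card (J - T) = card J - card T"
      using T J by (intro card_Diff_subset) (auto simp: \<T>_def intro: finite_subset)
    finally show "P.prob (Box T) = q ^ card T * (1 - q) ^ (card J - card T)" .
  qed
  also have "\<dots> = (\<Sum>t<K. \<Sum>T\<in>{T \<in> \<T>. card T = t}. q ^ card T * (1 - q) ^ (card J - card T))"
    by (rule sum.group[symmetric]) (use fin in \<open>auto simp: \<T>_def\<close>)
  also have "\<dots> = (\<Sum>t<K. real (card J choose t) * q ^ t * (1 - q) ^ (card J - t))"
  proof (rule sum.cong[OF refl])
    fix t assume "t \<in> {..<K}"
    then have "{T \<in> \<T>. card T = t} = {T. T \<subseteq> J \<and> card T = t}" by (auto simp: \<T>_def)
    then show "(\<Sum>T\<in>{T \<in> \<T>. card T = t}. q ^ card T * (1 - q) ^ (card J - card T)) =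
        real (card J choose t) * q ^ t * (1 - q) ^ (card J - t)"
      by (simp add: n_subsets[OF J])
  qed
  finally show ?thesis by (simp add: binom_lower_def q_def)
qed

text \<open>
  A point of the configuration that coincides with the centre is not counted. If the centre is
  itself one of the points, its own index therefore never contributes.
\<close>

definition nbr_count :: "'i set \<Rightarrow> real ^ 'd::finite \<Rightarrow> ('i \<Rightarrow> real ^ 'd) \<Rightarrow> real \<Rightarrow> nat" where
  "nbr_count J x y r = card {j \<in> J. y j \<noteq> x \<and> torus_dist x (y j) \<le> r}"

definition sample_knn :: "nat \<Rightarrow> 'i set \<Rightarrow> real ^ 'd::finite \<Rightarrow> ('i \<Rightarrow> real ^ 'd) \<Rightarrow> ereal" where
  "sample_knn k J x y = Inf {ereal r | r. 0 < r \<and> k \<le> nbr_count J x y r}"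

lemma nbr_count_mono: "finite J \<Longrightarrow> r \<le> s \<Longrightarrow> nbr_count J x y r \<le> nbr_count J x y s"
  unfolding nbr_count_def by (intro card_mono) auto

lemma knn_radius_binomial_process:
  assumes "\<And>i. i \<in> {1..n} \<Longrightarrow> x i \<in> unit_cube"
  shows "knn_radius k c (binomial_process x n) = sample_knn k {1..n} c x"
proof -
  have "emeasure (binomial_process x n) (torus_cball c r - {c}) = of_nat (nbr_count {1..n} c x r)" for r
  proof -
    have "emeasure (binomial_process x n) (torus_cball c r - {c}) =
          of_nat (card {i \<in> {1..n}. x i \<in> torus_cball c r - {c}})"
    proof -
      have m: "torus_cball c r - {c} = unit_cube \<inter> {y. torus_dist c y \<le> r \<and> y \<noteq> c}"
        by (auto simp: torus_cball_def)
      have "torus_cball c r - {c} \<in> sets (restrict_space borel unit_cube)"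
        unfolding m by (subst sets_restrict_space_iff) auto
      then have "emeasure (distr (count_space {1..n}) (restrict_space borel unit_cube) x) (torus_cball c r - {c})
        = emeasure (count_space {1..n}) (x -` (torus_cball c r - {c}) \<inter> {1..n})"
        using assms by (subst emeasure_distr) (auto simp: space_restrict_space)
      also have "\<dots> = of_nat (card {i \<in> {1..n}. x i \<in> torus_cball c r - {c}})"
        by (subst emeasure_count_space_finite)
          (auto intro!: arg_cong[where f = card])
      finally show ?thesis by (simp add: binomial_process_def dirac_sum_def)
    qed
    also have "{i \<in> {1..n}. x i \<in> torus_cball c r - {c}} = {i \<in> {1..n}. x i \<noteq> c \<and> torus_dist c (x i) \<le> r}"
      using assms by (auto simp: torus_cball_def)
    finally show ?thesis by (simp add: nbr_count_def)
  qed
  then show ?thesis by (simp add: knn_radius_def sample_knn_def)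
qed

lemma sample_knn_nonneg: "0 \<le> sample_knn k J x y"
  unfolding sample_knn_def by (rule Inf_greatest) auto

text \<open>
  A finite configuration has finitely many distances to \<open>x\<close>, so its neighbour count stays constant
  on a small interval to the right of \<open>r\<close>; hence the strict inequality.
\<close>

lemma less_sample_knn_iff:
  assumes J: "finite J" and r: "0 < r"
  shows "ereal r < sample_knn k J x y \<longleftrightarrow> nbr_count J x y r < k"
proof
  assume "ereal r < sample_knn k J x y"
  moreover have "sample_knn k J x y \<le> ereal r" if "k \<le> nbr_count J x y r"
    unfolding sample_knn_def by (rule Inf_lower) (use that r in auto)
  ultimately show "nbr_count J x y r < k" by (meson not_less)
next
  assume cnt: "nbr_count J x y r < k"
  \<comment> \<open>The distances exceeding \<open>r\<close>; the extra element \<open>r + 1\<close> keeps the set nonempty.\<close>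
  define D where "D = insert (r + 1) ((\<lambda>j. torus_dist x (y j)) ` {j \<in> J. r < torus_dist x (y j)})"
  have D: "finite D" "D \<noteq> {}" "\<And>d. d \<in> D \<Longrightarrow> r < d" using J by (auto simp: D_def)
  have "ereal (Min D) \<le> sample_knn k J x y"
    unfolding sample_knn_def
  proof (rule Inf_greatest, clarify)
    fix s assume s: "0 < s" "k \<le> nbr_count J x y s"
    show "ereal (Min D) \<le> ereal s"
    proof (rule ccontr)
      assume "\<not> ereal (Min D) \<le> ereal s"
      then have less: "s < d" if "d \<in> D" for d
        using Min_le[OF D(1) that] by simp
      have "torus_dist x (y j) \<le> r" if "j \<in> J" "torus_dist x (y j) \<le> s" for j
      proof (rule ccontr)
        assume "\<not> torus_dist x (y j) \<le> r"
        then have "torus_dist x (y j) \<in> D" using that(1) by (auto simp: D_def)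
        from less[OF this] that(2) show False by simp
      qed
      then have "nbr_count J x y s \<le> nbr_count J x y r"
        unfolding nbr_count_def using J by (intro card_mono) auto
      then show False using s cnt by simp
    qed
  qed
  moreover have "r < Min D" using D by simp
  ultimately show "ereal r < sample_knn k J x y" by (meson ereal_less(3) less_ereal.simps(1) less_le_trans)
qed

lemma measurable_nbr_count:
  assumes J: "finite J" and [measurable]: "c \<in> borel_measurable M" "\<And>j. j \<in> J \<Longrightarrow> (\<lambda>w. y w j) \<in> borel_measurable M"
  shows "(\<lambda>w. nbr_count J (c w) (y w) r) \<in> measurable M (count_space UNIV)"
proof -
  have "(\<lambda>w. real (nbr_count J (c w) (y w) r)) =
        (\<lambda>w. \<Sum>j\<in>J. if y w j \<noteq> c w \<and> torus_dist (c w) (y w j) \<le> r then 1 else 0)"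
    using J by (auto simp: nbr_count_def sum.If_cases Int_def)
  moreover have "\<dots> \<in> borel_measurable M" by measurable
  ultimately have [measurable]: "(\<lambda>w. real (nbr_count J (c w) (y w) r)) \<in> borel_measurable M" by simp
  have "(\<lambda>w. nat \<lfloor>real (nbr_count J (c w) (y w) r)\<rfloor>) \<in> measurable M (count_space UNIV)"
    by measurable
  then show ?thesis by simp
qed

text \<open>
  The neighbour count is monotone in the radius, so rational radii decide whether the infimum lies
  below a given level.
\<close>

lemma measurable_sample_knn:
  assumes J: "finite J" and [measurable]: "c \<in> borel_measurable M" "\<And>j. j \<in> J \<Longrightarrow> (\<lambda>w. y w j) \<in> borel_measurable M"
  shows "(\<lambda>w. sample_knn k J (c w) (y w)) \<in> borel_measurable M"
proof (rule borel_measurableI_less)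
  fix t :: ereal
  note [measurable] = measurable_nbr_count[OF J assms(2,3)]
  have iff: "sample_knn k J (c w) (y w) < t \<longleftrightarrow>
      (\<exists>q\<in>\<rat>. 0 < q \<and> ereal q < t \<and> k \<le> nbr_count J (c w) (y w) q)" for w
  proof
    assume "sample_knn k J (c w) (y w) < t"
    then obtain r where r: "0 < r" "ereal r < t" "k \<le> nbr_count J (c w) (y w) r"
      unfolding sample_knn_def by (auto simp: Inf_less_iff)
    obtain q where q: "q \<in> \<rat>" "r < q" "ereal q < t"
    proof (cases t)
      case (real t')
      then show ?thesis using Rats_dense_in_real[of r t'] r that by auto
    next
      case PInf
      then show ?thesis using Rats_dense_in_real[of r "r + 1"] that by auto
    qed (use r in auto)
    then show "\<exists>q\<in>\<rat>. 0 < q \<and> ereal q < t \<and> k \<le> nbr_count J (c w) (y w) q"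
      using r nbr_count_mono[OF J, of r q "c w" "y w"] by (intro bexI[of _ q]) auto
  next
    assume "\<exists>q\<in>\<rat>. 0 < q \<and> ereal q < t \<and> k \<le> nbr_count J (c w) (y w) q"
    then show "sample_knn k J (c w) (y w) < t"
      unfolding sample_knn_def Inf_less_iff by blast
  qed
  have "{w \<in> space M. sample_knn k J (c w) (y w) < t} =
        (\<Union>q\<in>{q\<in>\<rat>. 0 < q \<and> ereal q < t}. {w \<in> space M. k \<le> nbr_count J (c w) (y w) q})"
    by (auto simp: iff)
  also have "\<dots> \<in> sets M"
    by (intro sets.countable_UN'' countable_subset[OF _ countable_rat]) auto
  finally show "{w \<in> space M. sample_knn k J (c w) (y w) < t} \<in> sets M" .
qed

lemma score_greater_iff:
  fixes R :: ereal and v :: real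
  assumes v: "0 < v" and r: "0 < r" and eq: "v * r ^ D = a + s" and D: "0 < D" and R: "0 \<le> R"
  shows "ereal s < ereal v * R ^ D - ereal a \<longleftrightarrow> ereal r < R"
proof (cases R)
  case (real R')
  have "s < v * R' ^ D - a \<longleftrightarrow> v * r ^ D < v * R' ^ D" using eq by auto
  also have "\<dots> \<longleftrightarrow> r ^ D < R' ^ D" using v by simp
  also have "\<dots> \<longleftrightarrow> r < R'"
  proof -
    have "R' ^ D \<le> r ^ D \<longleftrightarrow> R' \<le> r"
      using r D real R by (intro power_mono_iff) auto
    then show ?thesis by linarith
  qed
  finally show ?thesis using real by simp
next
  case PInf
  then show ?thesis using v D by simp
qed (use R in auto)

lemma measure_cube_law_null: "finite F \<Longrightarrow> F \<in> null_sets cube_law"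
proof -
  assume "finite F"
  then have "emeasure lborel F = 0" "F \<in> sets borel"
    using null_setsD1[OF countable_imp_null_set_lborel[OF countable_finite]]
    by (auto simp: finite_imp_closed)
  then have "emeasure lborel (unit_cube \<inter> F) = 0"
    by (metis Int_lower2 emeasure_mono le_zero_eq sets_lborel)
  with \<open>F \<in> sets borel\<close> show ?thesis
    by (simp add: null_sets_def emeasure_cube_law)
qed

lemma measure_cube_law_Diff_finite:
  assumes "finite F" "A \<in> sets borel"
  shows "measure cube_law (A - F) = measure cube_law A"
  using assms measure_cube_law_null[OF assms(1)] by (intro measure_Diff_null_set) auto

abbreviation cube_product :: "'i set \<Rightarrow> ('i \<Rightarrow> real ^ 'd::finite) measure" where
  "cube_product J \<equiv> (\<Pi>\<^sub>M j\<in>J. cube_law)"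

lemma measurable_cube_product_component:
  "j \<in> J \<Longrightarrow> (\<lambda>y. y j) \<in> borel_measurable (cube_product J)"
  using measurable_component_singleton[of j J "\<lambda>_. cube_law"] by (simp cong: measurable_cong_sets)

lemma measure_nbr_count_less:
  fixes x :: "real ^ 'd::finite"
  assumes J: "finite J" and r: "0 \<le> r" "r < 1 / 2"
  shows "measure (cube_product J) {y \<in> space (cube_product J). nbr_count J x y r < K} =
         binom_lower (card J) (unit_ball_volume TYPE('d) * r ^ CARD('d)) K"
proof -
  have [measurable]: "{v. torus_dist x v \<le> r} \<in> sets borel" by measurable
  have A: "{v. v \<noteq> x \<and> torus_dist x v \<le> r} = {v. torus_dist x v \<le> r} - {x}" by auto
  have "measure cube_law {v. v \<noteq> x \<and> torus_dist x v \<le> r} = unit_ball_volume TYPE('d) * r ^ CARD('d)"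
    unfolding A by (subst measure_cube_law_Diff_finite) (auto simp: measure_torus_ball[OF r])
  then show ?thesis
    using measure_PiM_card_less[OF prob_space_cube_law _ J, of "{v. v \<noteq> x \<and> torus_dist x v \<le> r}" K]
    by (simp add: nbr_count_def)
qed

text \<open>
  The configuration is split into the point with index \<open>i\<close> and the independent remaining ones. The
  conditional probability given the former does not depend on its position, which is why the
  expectation is a product.
\<close>

lemma integral_one_point:
  fixes \<phi> :: "real ^ 'd::finite \<Rightarrow> real" and I :: "'i set"
  assumes I: "finite I" "i \<in> I" and r: "0 \<le> r" "r < 1 / 2"
    and [measurable]: "\<phi> \<in> borel_measurable borel" and bdd: "\<And>x. \<bar>\<phi> x\<bar> \<le> B"
  shows "(\<integral>y. \<phi> (y i) * indicator {y. nbr_count I (y i) y r < k} y \<partial>cube_product I) =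
         (\<integral>x. \<phi> x \<partial>cube_law) * binom_lower (card I - 1) (unit_ball_volume TYPE('d) * r ^ CARD('d)) k"
proof -
  define J where "J = I - {i}"
  have J: "finite J" "insert i J = I" "i \<notin> J" "card J = card I - 1" using I by (auto simp: J_def)
  let ?C = "cube_law :: (real ^ 'd) measure" and ?P = "cube_product :: 'i set \<Rightarrow> ('i \<Rightarrow> real ^ 'd) measure"
  interpret C: prob_space ?C by (rule prob_space_cube_law)
  interpret P: prob_space "?P J" by (intro prob_space_PiM prob_space_cube_law)
  interpret PI: prob_space "?P I" by (intro prob_space_PiM prob_space_cube_law)
  interpret CP: pair_prob_space ?C "?P J" ..
  define f where "f = (\<lambda>y :: 'i \<Rightarrow> real ^ 'd. \<phi> (y i) * indicator {y. nbr_count I (y i) y r < k} y)"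
  have fI: "f \<in> borel_measurable (?P I)"
  proof -
    have [measurable]: "(\<lambda>y. y i) \<in> borel_measurable (?P I)" by (rule measurable_cube_product_component[OF I(2)])
    have [measurable]: "(\<lambda>y. nbr_count I (y i) y r) \<in> measurable (?P I) (count_space UNIV)"
      using I by (intro measurable_nbr_count measurable_cube_product_component)
    have "f = (\<lambda>y. \<phi> (y i) * (if nbr_count I (y i) y r < k then 1 else 0))"
      by (auto simp: f_def)
    also have "\<dots> \<in> borel_measurable (?P I)" by measurable
    finally show ?thesis .
  qed
  have upd: "(\<lambda>(x, y). y(i := x)) \<in> measurable (?C \<Otimes>\<^sub>M ?P J) (?P I)"
    using measurable_add_dim[of i J "\<lambda>_. ?C"] J(2)
    using measurable_compose[OF measurable_pair_swap' measurable_add_dim[of i J "\<lambda>_. ?C"]]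
    by (simp add: case_prod_unfold)
  have eq: "f (y(i := x)) = \<phi> x * indicator {y. nbr_count J x y r < k} y" for x y
  proof -
    have "nbr_count I x (y(i := x)) r = nbr_count J x y r"
      unfolding nbr_count_def J_def by (rule arg_cong[where f = card]) auto
    then show ?thesis by (simp add: f_def indicator_def)
  qed
  have "(\<integral>y. f y \<partial>?P I) = (\<integral>y. f y \<partial>distr (?C \<Otimes>\<^sub>M ?P J) (?P I) (\<lambda>(x, y). y(i := x)))"
    using distr_pair_PiM_eq_PiM[of J "\<lambda>_. ?C" i] C.prob_space_axioms J(2) by simp
  also have "\<dots> = (\<integral>p. f ((\<lambda>(x, y). y(i := x)) p) \<partial>(?C \<Otimes>\<^sub>M ?P J))"
    by (rule integral_distr[OF upd fI])
  also have "\<dots> = (\<integral>x. \<integral>y. f (y(i := x)) \<partial>?P J \<partial>?C)"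
  proof -
    have "integrable (?C \<Otimes>\<^sub>M ?P J) (\<lambda>p. f ((\<lambda>(x, y). y(i := x)) p))"
    proof (rule CP.P.integrable_const_bound[where B = B])
      show "AE p in ?C \<Otimes>\<^sub>M ?P J. norm (f ((\<lambda>(x, y). y(i := x)) p)) \<le> B"
        using bdd order_trans[OF abs_ge_zero bdd] by (auto simp: eq indicator_def)
      show "(\<lambda>p. f ((\<lambda>(x, y). y(i := x)) p)) \<in> borel_measurable (?C \<Otimes>\<^sub>M ?P J)"
        by (rule measurable_compose[OF upd fI])
    qed
    from CP.integral_fst'[OF this] show ?thesis by (simp add: case_prod_unfold)
  qed
  also have "\<dots> = (\<integral>x. \<phi> x * binom_lower (card J) (unit_ball_volume TYPE('d) * r ^ CARD('d)) k \<partial>?C)"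
  proof (rule Bochner_Integration.integral_cong[OF refl])
    fix x :: "real ^ 'd"
    have [measurable]: "(\<lambda>y. nbr_count J x y r) \<in> measurable (?P J) (count_space UNIV)"
      using J by (intro measurable_nbr_count measurable_cube_product_component) auto
    have "(\<integral>y. indicator {y. nbr_count J x y r < k} y \<partial>?P J) =
          (\<integral>y. indicator {y \<in> space (?P J). nbr_count J x y r < k} y \<partial>?P J)"
      by (rule Bochner_Integration.integral_cong) (auto simp: indicator_def)
    also have "\<dots> = binom_lower (card J) (unit_ball_volume TYPE('d) * r ^ CARD('d)) k"
      using J by (subst Bochner_Integration.integral_indicator) (auto simp: measure_nbr_count_less[OF J(1) r] less_top[symmetric])
    finally show "(\<integral>y. f (y(i := x)) \<partial>?P J) =
        \<phi> x * binom_lower (card J) (unit_ball_volume TYPE('d) * r ^ CARD('d)) k"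
      by (simp add: eq)
  qed
  finally show ?thesis by (simp add: f_def J)
qed

lemma sets_PiM_card_less:
  assumes "finite J" and [measurable]: "T \<in> sets N"
  shows "{w \<in> space (\<Pi>\<^sub>M j\<in>J. N). card {l \<in> J. w l \<in> T} < K} \<in> sets (\<Pi>\<^sub>M j\<in>J. N)"
proof -
  let ?P = "\<Pi>\<^sub>M j\<in>J. N"
  have "(\<lambda>w. \<Sum>l\<in>J. indicator T (w l) :: real) \<in> borel_measurable ?P"
    by (intro borel_measurable_sum measurable_compose[OF measurable_component_singleton borel_measurable_indicator]) auto
  moreover have "(\<Sum>l\<in>J. indicator T (w l)) = real (card {l \<in> J. w l \<in> T})" for w
    using assms(1) by (simp add: indicator_def sum.If_cases Int_def)
  ultimately have "(\<lambda>w. real (card {l \<in> J. w l \<in> T})) \<in> borel_measurable ?P"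
    by simp
  from borel_measurable_less[OF this borel_measurable_const[of "real K"]]
  show ?thesis by simp
qed

text \<open>
  The three summands belong to pairs at distance at most \<open>\<epsilon> r\<close>, at most \<open>2 r\<close>, and more. For close
  pairs only the ball around the first point is used, but the second point already occupies one of the
  at most \<open>k - 1\<close> places there. For the others both counts together are at most \<open>2 k - 2\<close>,
  and the number of points in the union of the balls is bounded by this sum.
\<close>

lemma measure_two_points_le:
  fixes I :: "'i set" and \<epsilon> r :: real
  defines "p \<equiv> unit_ball_volume TYPE('d::finite) * r ^ CARD('d)"
  assumes I: "finite I" "i \<in> I" "j \<in> I" "i \<noteq> j" and k: "1 \<le> k" and \<epsilon>: "0 < \<epsilon>" "\<epsilon> \<le> 1"
    and r: "0 < r" "r < 1 / 4"
    and B: "\<And>q. (1 + (\<epsilon> / 4) ^ CARD('d)) * p \<le> q \<Longrightarrow> q \<le> 2 * p \<Longrightarrow>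
              binom_lower (card I - 2) q (2 * k - 1) \<le> B"
  shows "measure (cube_product I :: ('i \<Rightarrow> real ^ 'd) measure)
           {y \<in> space (cube_product I). nbr_count I (y i) y r < k \<and> nbr_count I (y j) y r < k}
         \<le> \<epsilon> ^ CARD('d) * p * binom_lower (card I - 2) p (k - 1) + 2 ^ CARD('d) * p * B
            + binom_lower (card I - 2) (2 * p) (2 * k - 1)"
proof -
  define J where "J = I - {i, j}"
  have J: "finite J" "insert i (insert j J) = I" "i \<notin> insert j J" "j \<notin> J" "card J = card I - 2"
    using I by (auto simp: J_def card_Diff_subset)
  let ?C = "cube_law :: (real ^ 'd) measure" and ?P = "cube_product :: 'i set \<Rightarrow> ('i \<Rightarrow> real ^ 'd) measure"
  let ?d = "CARD('d)"
  interpret C: prob_space ?C by (rule prob_space_cube_law)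
  interpret P: prob_space "?P J" by (intro prob_space_PiM prob_space_cube_law)
  interpret PI: prob_space "?P I" by (intro prob_space_PiM prob_space_cube_law)
  interpret PS: product_sigma_finite "\<lambda>_::'i. ?C" by unfold_locales
  define S where "S = {y \<in> space (?P I). nbr_count I (y i) y r < k \<and> nbr_count I (y j) y r < k}"
  have cnt_m: "(\<lambda>y. nbr_count I (y l) y r) \<in> measurable (?P I) (count_space UNIV)" if "l \<in> I" for l
    using I that by (intro measurable_nbr_count measurable_cube_product_component) auto
  note [measurable] = cnt_m[OF I(2)] cnt_m[OF I(3)]
  have S[measurable]: "S \<in> sets (?P I)"
    unfolding S_def by measurable
  define A where "A = binom_lower (card I - 2) p (k - 1)"
  define C where "C = binom_lower (card I - 2) (2 * p) (2 * k - 1)"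
  have vol: "measure ?C {v. torus_dist x v \<le> s} = unit_ball_volume TYPE('d) * s ^ ?d" if "0 \<le> s" "s < 1 / 2" for s x
    using that by (rule measure_torus_ball)
  have p: "0 < p" using unit_ball_volume_pos[where 'd = 'd] r by (simp add: p_def)
  have pair: "(\<integral>\<^sup>+w. indicator S (w(j := z, i := x)) \<partial>?P J) \<le>
      ennreal A * indicator {v. torus_dist x v \<le> \<epsilon> * r} z +
      ennreal B * indicator {v. torus_dist x v \<le> 2 * r} z + ennreal C" if "z \<noteq> x" for x z
  proof -
    have I_cnt: "nbr_count I x (w(j := z, i := x)) r =
        nbr_count J x w r + (if torus_dist x z \<le> r then 1 else 0)" for w
    proof -
      have "{l \<in> I. (w(j := z, i := x)) l \<noteq> x \<and> torus_dist x ((w(j := z, i := x)) l) \<le> r} =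
        {l \<in> J. w l \<noteq> x \<and> torus_dist x (w l) \<le> r} \<union> (if torus_dist x z \<le> r then {j} else {})"
        using that J by auto
      then show ?thesis using J by (auto simp: nbr_count_def)
    qed
    have J_cnt: "nbr_count J z w r \<le> nbr_count I z (w(j := z, i := x)) r" for w
      unfolding nbr_count_def using J I by (intro card_mono) auto
    have bound: "(\<integral>\<^sup>+w. indicator S (w(j := z, i := x)) \<partial>?P J) \<le> ennreal (measure (?P J) {w \<in> space (?P J). Q w})"
      if "\<And>w. nbr_count I x (w(j := z, i := x)) r < k \<Longrightarrow> nbr_count I z (w(j := z, i := x)) r < k \<Longrightarrow> Q w"
        "{w \<in> space (?P J). Q w} \<in> sets (?P J)" for Q
    proof -
      have "(\<integral>\<^sup>+w. indicator S (w(j := z, i := x)) \<partial>?P J) \<le> (\<integral>\<^sup>+w. indicator {w \<in> space (?P J). Q w} w \<partial>?P J)"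
        using that(1) I(4) by (intro nn_integral_mono) (auto simp: S_def indicator_def)
      also have "\<dots> = ennreal (measure (?P J) {w \<in> space (?P J). Q w})"
        using that(2) by (simp add: P.emeasure_eq_measure)
      finally show ?thesis .
    qed
    define Bx where "Bx = {v. torus_dist x v \<le> r}"
    define Bz where "Bz = {v. torus_dist z v \<le> r}"
    have [measurable]: "Bx \<in> sets borel" "Bz \<in> sets borel" unfolding Bx_def Bz_def by measurable
    have mB: "measure ?C Bx = p" "measure ?C Bz = p"
      using r by (auto simp: Bx_def Bz_def p_def vol)
    define T where "T = Bx \<union> Bz - {x, z}"
    have T_sets: "T \<in> sets borel"
      unfolding T_def by (intro sets.Diff sets.Un) auto
    have mT: "measure ?C T = measure ?C (Bx \<union> Bz)"
      unfolding T_def by (rule measure_cube_law_Diff_finite) auto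
    have union_bound: "(\<integral>\<^sup>+w. indicator S (w(j := z, i := x)) \<partial>?P J) \<le>
       ennreal (binom_lower (card I - 2) (measure ?C (Bx \<union> Bz)) (2 * k - 1))"
    proof -
      have "(\<integral>\<^sup>+w. indicator S (w(j := z, i := x)) \<partial>?P J) \<le>
         ennreal (measure (?P J) {w \<in> space (?P J). card {l \<in> J. w l \<in> T} < 2 * k - 1})"
      proof (rule bound)
        fix w assume w: "nbr_count I x (w(j := z, i := x)) r < k" "nbr_count I z (w(j := z, i := x)) r < k"
        have "card {l \<in> J. w l \<in> T} \<le> card ({l \<in> J. w l \<noteq> x \<and> torus_dist x (w l) \<le> r} \<union>
          {l \<in> J. w l \<noteq> z \<and> torus_dist z (w l) \<le> r})"
          using J by (intro card_mono) (auto simp: T_def Bx_def Bz_def)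
        also have "\<dots> \<le> nbr_count J x w r + nbr_count J z w r"
          unfolding nbr_count_def by (rule card_Un_le)
        also have "\<dots> < 2 * k - 1" using w I_cnt[of w] J_cnt[of w] k by (auto split: if_splits)
        finally show "card {l \<in> J. w l \<in> T} < 2 * k - 1" .
      next
        show "{w \<in> space (?P J). card {l \<in> J. w l \<in> T} < 2 * k - 1} \<in> sets (?P J)"
          by (rule sets_PiM_card_less[OF J(1)]) (simp add: T_sets)
      qed
      also have "measure (?P J) {w \<in> space (?P J). card {l \<in> J. w l \<in> T} < 2 * k - 1} =
          binom_lower (card I - 2) (measure ?C (Bx \<union> Bz)) (2 * k - 1)"
        using measure_PiM_card_less[OF C.prob_space_axioms _ J(1), of T "2 * k - 1"]
        by (simp add: T_sets mT J(5))
      finally show ?thesis .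
    qed
    consider "torus_dist x z \<le> \<epsilon> * r" | "\<epsilon> * r < torus_dist x z" "torus_dist x z \<le> 2 * r" | "2 * r < torus_dist x z"
      by linarith
    then show ?thesis
    proof cases
      case 1
      have "\<epsilon> * r \<le> r" using \<epsilon> r by simp
      then have "torus_dist x z \<le> r" using 1 by simp
      have "(\<integral>\<^sup>+w. indicator S (w(j := z, i := x)) \<partial>?P J) \<le>
         ennreal (measure (?P J) {w \<in> space (?P J). nbr_count J x w r < k - 1})"
      proof (rule bound)
        show "{w \<in> space (?P J). nbr_count J x w r < k - 1} \<in> sets (?P J)"
        proof -
          have "(\<lambda>w. nbr_count J x w r) \<in> measurable (?P J) (count_space UNIV)"
            using J by (intro measurable_nbr_count measurable_cube_product_component) auto
          from measurable_sets[OF this, of "{..<k - 1}"] show ?thesis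
            by (simp add: vimage_def Int_def conj_commute)
        qed
      qed (use I_cnt \<open>torus_dist x z \<le> r\<close> in auto)
      also have "\<dots> = ennreal A"
        using J r by (subst measure_nbr_count_less) (simp_all add: A_def p_def)
      finally show ?thesis using 1 by (simp add: add_increasing2)
    next
      case 2
      have sub: "Bx \<union> {v. torus_dist z v \<le> r \<and> r < torus_dist x v} = Bx \<union> Bz"
        by (auto simp: Bx_def Bz_def)
      have "measure ?C (Bx \<union> Bz) = p + measure ?C {v. torus_dist z v \<le> r \<and> r < torus_dist x v}"
        unfolding sub[symmetric] mB(1)[symmetric] by (rule C.finite_measure_Union) (auto simp: Bx_def)
      moreover have "measure ?C {v. torus_dist z v \<le> r \<and> r < torus_dist x v} \<ge> (\<epsilon> / 4) ^ ?d * p"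
        unfolding p_def by (rule measure_torus_crescent_ge) (use 2 \<epsilon> r in auto)
      moreover have "measure ?C (Bx \<union> Bz) \<le> p + p"
        using measure_Un_le[of Bx ?C Bz] mB by simp
      ultimately have "binom_lower (card I - 2) (measure ?C (Bx \<union> Bz)) (2 * k - 1) \<le> B"
        by (intro B) (auto simp: algebra_simps)
      then have "(\<integral>\<^sup>+w. indicator S (w(j := z, i := x)) \<partial>?P J) \<le> ennreal B"
        by (rule order_trans[OF union_bound ennreal_leI])
      then show ?thesis
        using 2 by (simp add: add_increasing2)
    next
      case 3
      have "Bx \<inter> Bz = {}"
      proof (intro equals0I, elim IntE)
        fix v assume "v \<in> Bx" "v \<in> Bz"
        then show False
          using torus_dist_triangle[of x z v] torus_dist_commute[of v z] 3
          by (simp add: Bx_def Bz_def)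
      qed
      then have "measure ?C (Bx \<union> Bz) = 2 * p"
        using mB by (subst C.finite_measure_Union) auto
      then show ?thesis using union_bound by (auto simp: C_def add_increasing)
    qed
  qed
  have eps_vol: "(\<integral>\<^sup>+z. indicator {v. torus_dist x v \<le> \<epsilon> * r} z \<partial>?C) = ennreal (\<epsilon> ^ ?d * p)" for x
  proof -
    have "\<epsilon> * r \<le> r" using \<epsilon> r by simp
    have "(\<integral>\<^sup>+z. indicator {v. torus_dist x v \<le> \<epsilon> * r} z \<partial>?C) = emeasure ?C {v. torus_dist x v \<le> \<epsilon> * r}"
      by (rule nn_integral_indicator) measurable
    also have "\<dots> = ennreal (\<epsilon> ^ ?d * p)"
    proof -
      have "r < 1 / 2" using r by simp
      with \<open>\<epsilon> * r \<le> r\<close> have "\<epsilon> * r < 1 / 2" by linarith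
      moreover have "0 \<le> \<epsilon> * r" using \<epsilon> r by simp
      ultimately show ?thesis
        using vol[of "\<epsilon> * r"]
        by (simp add: C.emeasure_eq_measure p_def power_mult_distrib mult_ac del: less_divide_eq_numeral1)
    qed
    finally show ?thesis .
  qed
  have two_vol: "(\<integral>\<^sup>+z. indicator {v. torus_dist x v \<le> 2 * r} z \<partial>?C) = ennreal (2 ^ ?d * p)" for x
  proof -
    have "(\<integral>\<^sup>+z. indicator {v. torus_dist x v \<le> 2 * r} z \<partial>?C) = emeasure ?C {v. torus_dist x v \<le> 2 * r}"
      by (rule nn_integral_indicator) measurable
    also have "\<dots> = ennreal (2 ^ ?d * p)"
    proof -
      have "0 \<le> 2 * r" "2 * r < 1 / 2" using r by simp_all
      from vol[OF this] show ?thesis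
        by (simp add: C.emeasure_eq_measure p_def power_mult_distrib mult_ac)
    qed
    finally show ?thesis .
  qed
  have q2: "0 \<le> p \<and> 2 * p \<le> 1"
  proof -
    have "2 * r ^ ?d \<le> (2 * r) ^ ?d"
      using r by (simp add: power_mult_distrib self_le_power)
    then have "2 * p \<le> unit_ball_volume TYPE('d) * (2 * r) ^ ?d"
      using unit_ball_volume_pos[where 'd = 'd] by (simp add: p_def)
    also have "\<dots> = measure ?C {v. torus_dist 0 v \<le> 2 * r}" using r by (simp add: vol)
    also have "\<dots> \<le> 1" by (rule C.prob_le_1)
    finally show ?thesis using p by simp
  qed
  have nonneg: "0 \<le> A" "0 \<le> C" "0 \<le> B"
  proof -
    show "0 \<le> A" "0 \<le> C" unfolding A_def C_def using q2 by (auto intro!: binom_lower_nonneg)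
    have "\<epsilon> / 4 \<le> 1" using \<epsilon> by simp
    then have "(\<epsilon> / 4) ^ ?d \<le> 1" using \<epsilon> by (intro power_le_one) auto
    then have "binom_lower (card I - 2) (2 * p) (2 * k - 1) \<le> B"
      using p by (intro B) auto
    then show "0 \<le> B" using \<open>0 \<le> C\<close> by (simp add: C_def)
  qed
  have "emeasure (?P I) S = (\<integral>\<^sup>+y. indicator S y \<partial>?P (insert i (insert j J)))"
    using J by simp
  also have "\<dots> = (\<integral>\<^sup>+x. \<integral>\<^sup>+y. indicator S (y(i := x)) \<partial>?P (insert j J) \<partial>?C)"
    by (rule PS.product_nn_integral_insert_rev) (use J in auto)
  also have "\<dots> = (\<integral>\<^sup>+x. \<integral>\<^sup>+z. \<integral>\<^sup>+w. indicator S (w(j := z, i := x)) \<partial>?P J \<partial>?C \<partial>?C)"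
  proof (rule nn_integral_cong)
    fix x :: "real ^ 'd"
    have "(\<lambda>y. y(i := x)) \<in> measurable (?P (insert j J)) (?P I)"
      using measurable_compose[OF _ measurable_add_dim[of i "insert j J" "\<lambda>_. ?C"], of "\<lambda>y. (y, x)" "?P (insert j J)"] J
      by simp
    then have "(\<lambda>y. indicator S (y(i := x)) :: ennreal) \<in> borel_measurable (?P (insert j J))"
      by measurable
    then show "(\<integral>\<^sup>+y. indicator S (y(i := x)) \<partial>?P (insert j J)) =
        (\<integral>\<^sup>+z. \<integral>\<^sup>+w. indicator S (w(j := z, i := x)) \<partial>?P J \<partial>?C)"
      by (rule PS.product_nn_integral_insert_rev[OF J(1) J(4)])
  qed
  also have "\<dots> \<le> (\<integral>\<^sup>+x. \<integral>\<^sup>+z. ennreal A * indicator {v. torus_dist x v \<le> \<epsilon> * r} z +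
      ennreal B * indicator {v. torus_dist x v \<le> 2 * r} z + ennreal C \<partial>?C \<partial>?C)"
  proof (rule nn_integral_mono, rule nn_integral_mono_AE)
    fix x :: "real ^ 'd"
    have "AE z in ?C. z \<notin> {x}" by (rule AE_not_in) (simp add: measure_cube_law_null)
    then show "AE z in ?C. (\<integral>\<^sup>+w. indicator S (w(j := z, i := x)) \<partial>?P J) \<le>
      ennreal A * indicator {v. torus_dist x v \<le> \<epsilon> * r} z +
      ennreal B * indicator {v. torus_dist x v \<le> 2 * r} z + ennreal C"
      by eventually_elim (rule pair, simp)
  qed
  also have "\<dots> = (\<integral>\<^sup>+x. ennreal (A * (\<epsilon> ^ ?d * p) + B * (2 ^ ?d * p) + C) \<partial>?C)"
  proof (rule nn_integral_cong)
    fix x :: "real ^ 'd"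
    have "(\<integral>\<^sup>+z. ennreal A * indicator {v. torus_dist x v \<le> \<epsilon> * r} z +
      ennreal B * indicator {v. torus_dist x v \<le> 2 * r} z + ennreal C \<partial>?C) =
      ennreal A * ennreal (\<epsilon> ^ ?d * p) + ennreal B * ennreal (2 ^ ?d * p) + ennreal C"
      by (subst nn_integral_add, measurable, subst nn_integral_add, measurable,
          subst nn_integral_cmult, measurable, subst nn_integral_cmult, measurable)
        (simp add: eps_vol two_vol C.emeasure_space_1[simplified])
    also have "\<dots> = ennreal (A * (\<epsilon> ^ ?d * p) + B * (2 ^ ?d * p) + C)"
      using nonneg p \<epsilon> by (simp add: ennreal_mult'' ennreal_plus)
    finally show "(\<integral>\<^sup>+z. ennreal A * indicator {v. torus_dist x v \<le> \<epsilon> * r} z +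
      ennreal B * indicator {v. torus_dist x v \<le> 2 * r} z + ennreal C \<partial>?C) =
      ennreal (A * (\<epsilon> ^ ?d * p) + B * (2 ^ ?d * p) + C)" .
  qed
  also have "\<dots> = ennreal (A * (\<epsilon> ^ ?d * p) + B * (2 ^ ?d * p) + C)"
    by (simp add: C.emeasure_space_1[simplified])
  finally have "ennreal (measure (?P I) S) \<le> ennreal (A * (\<epsilon> ^ ?d * p) + B * (2 ^ ?d * p) + C)"
    by (simp add: PI.emeasure_eq_measure)
  then have "measure (?P I) S \<le> A * (\<epsilon> ^ ?d * p) + B * (2 ^ ?d * p) + C"
    using nonneg p \<epsilon> by (subst (asm) ennreal_le_iff) auto
  then show ?thesis
    by (simp add: S_def A_def C_def algebra_simps)
qed

section \<open>Asymptotics of the binomial probabilities\<close>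

text \<open>
  Termwise from \<open>m choose t \<le> m ^ t\<close> and \<open>1 - q \<le> exp (- q)\<close>.
\<close>

lemma binom_lower_le:
  assumes q: "0 \<le> q" "q \<le> 1" and N: "real m * q \<le> N" "1 \<le> N"
  shows "binom_lower m q K \<le> real K * N ^ (K - 1) * exp (q * real K - q * real m)"
proof -
  have "binom_lower m q K \<le> (\<Sum>t<K. N ^ (K - 1) * exp (q * real K - q * real m))"
    unfolding binom_lower_def
  proof (rule sum_mono)
    fix t assume t: "t \<in> {..<K}"
    show "real (m choose t) * q ^ t * (1 - q) ^ (m - t) \<le> N ^ (K - 1) * exp (q * real K - q * real m)"
    proof (cases "t \<le> m")
      case True
      have "real (m choose t) * q ^ t \<le> real m ^ t * q ^ t"
      proof (rule mult_right_mono)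
        have "(m choose t) * 1 \<le> (m choose t) * fact t" by (intro mult_left_mono) auto
        also have "\<dots> \<le> m ^ t" by (rule binomial_fact_pow)
        finally show "real (m choose t) \<le> real m ^ t"
          by (metis mult.right_neutral of_nat_le_iff of_nat_power)
      qed (use q in auto)
      also have "\<dots> = (real m * q) ^ t" by (simp add: power_mult_distrib)
      also have "\<dots> \<le> N ^ t" using N q by (intro power_mono) auto
      also have "\<dots> \<le> N ^ (K - 1)" using N t by (intro power_increasing) auto
      finally have 1: "real (m choose t) * q ^ t \<le> N ^ (K - 1)" .
      have "(1 - q) ^ (m - t) \<le> exp (- q) ^ (m - t)"
        using q exp_ge_add_one_self[of "- q"] by (intro power_mono) auto
      also have "\<dots> = exp (- q * real (m - t))"
        by (simp add: exp_of_nat_mult[symmetric] mult.commute)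
      also have "\<dots> \<le> exp (q * real K - q * real m)"
      proof -
        have "q * (real m - real K) \<le> q * real (m - t)"
          using q t True by (intro mult_left_mono) auto
        then show ?thesis by (simp add: algebra_simps)
      qed
      finally have 2: "(1 - q) ^ (m - t) \<le> exp (q * real K - q * real m)" .
      show ?thesis
        using 1 2 q N by (intro mult_mono) auto
    next
      case False
      then show ?thesis using N by (simp add: binomial_eq_0)
    qed
  qed
  then show ?thesis by simp
qed

locale threshold_sequence =
  fixes a b :: "nat \<Rightarrow> real" and k :: nat
  assumes k: "k \<ge> 1"
    and a_large: "filterlim (\<lambda>n. a n - ln (real n) - (real k - 1) * ln (ln (real n))) at_top sequentially"
    and a_small: "a \<in> o(\<lambda>n. real n powr (1 / 3))"
    and b_eq: "\<And>n. b n = real n * a n ^ (k - 1) * exp (- a n)"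
begin

lemma a_at_top: "filterlim a at_top sequentially"
proof (rule filterlim_at_top_mono[OF a_large])
  have "eventually (\<lambda>n. 0 \<le> ln (real n)) sequentially" by real_asymp
  moreover have "eventually (\<lambda>n. 0 \<le> ln (ln (real n))) sequentially" by real_asymp
  ultimately show "eventually (\<lambda>n. a n - ln (real n) - (real k - 1) * ln (ln (real n)) \<le> a n) sequentially"
  proof eventually_elim
    case (elim n)
    then have "0 \<le> (real k - 1) * ln (ln (real n))" using k by simp
    then show ?case using elim by linarith
  qed
qed

lemma a_square_over_n: "(\<lambda>n. (a n)\<^sup>2 / real n) \<longlonglongrightarrow> 0"
proof -
  have "(\<lambda>n. a n / real n powr (1 / 3)) \<longlonglongrightarrow> 0"
    by (rule smalloD_tendsto[OF a_small])
  moreover have "(\<lambda>n. real n powr (- (1 / 3))) \<longlonglongrightarrow> 0" by real_asymp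
  ultimately have "(\<lambda>n. (a n / real n powr (1 / 3))\<^sup>2 * real n powr (- (1 / 3))) \<longlonglongrightarrow> 0\<^sup>2 * 0"
    by (intro tendsto_intros)
  moreover have "eventually (\<lambda>n. (a n / real n powr (1 / 3))\<^sup>2 * real n powr (- (1 / 3)) = (a n)\<^sup>2 / real n) sequentially"
    using eventually_gt_at_top[of 0]
  proof eventually_elim
    case (elim n)
    have "(real n powr (1 / 3))\<^sup>2 = real n powr (2 / 3)"
      using elim by (simp add: power2_eq_square flip: powr_add)
    moreover have "real n powr (- (1 / 3)) * real n = real n powr (2 / 3)"
      using elim by (simp add: powr_mult_base mult.commute)
    moreover have "real n powr (2 / 3) > 0" using elim by simp
    ultimately show ?case using elim by (simp add: power_divide field_simps)
  qed
  ultimately show ?thesis by (simp add: filterlim_cong)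
qed

lemma a_over_n: "(\<lambda>n. a n / real n) \<longlonglongrightarrow> 0"
proof (rule tendsto_sandwich[OF _ _ tendsto_const a_square_over_n])
  have "eventually (\<lambda>n. 1 \<le> a n) sequentially"
    using a_at_top by (simp add: filterlim_at_top)
  then show "eventually (\<lambda>n. 0 \<le> a n / real n) sequentially"
    "eventually (\<lambda>n. a n / real n \<le> (a n)\<^sup>2 / real n) sequentially"
    by (eventually_elim, simp add: power2_eq_square divide_right_mono)+
qed

lemma shift_over_n: "(\<lambda>n. (a n + s) / real n) \<longlonglongrightarrow> 0"
proof -
  have "(\<lambda>n. a n / real n + s / real n) \<longlonglongrightarrow> 0 + 0"
    by (intro tendsto_add a_over_n) real_asymp
  then show ?thesis by (simp add: add_divide_distrib)
qed

lemma shift_square_over_n: "(\<lambda>n. (a n + s)\<^sup>2 / real n) \<longlonglongrightarrow> 0"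
proof -
  have "(\<lambda>n. (a n)\<^sup>2 / real n + 2 * s * (a n / real n) + s\<^sup>2 / real n) \<longlonglongrightarrow> 0 + 2 * s * 0 + 0"
    by (intro tendsto_add tendsto_mult tendsto_const a_over_n a_square_over_n) real_asymp
  then show ?thesis by (simp add: power2_sum add_divide_distrib mult_ac add_ac)
qed

lemma shift_ratio: "(\<lambda>n. (a n + s) / a n) \<longlonglongrightarrow> 1"
proof -
  have "(\<lambda>n. s / a n) \<longlonglongrightarrow> 0"
    using a_at_top by (intro real_tendsto_divide_at_top[OF tendsto_const])
  then have "(\<lambda>n. 1 + s / a n) \<longlonglongrightarrow> 1 + 0" by (intro tendsto_intros)
  moreover have "eventually (\<lambda>n. 1 + s / a n = (a n + s) / a n) sequentially"
  proof -
    have "eventually (\<lambda>n. 1 \<le> a n) sequentially"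
      using a_at_top by (simp add: filterlim_at_top)
    then show ?thesis by eventually_elim (simp add: field_simps)
  qed
  ultimately show ?thesis by (simp add: filterlim_cong)
qed

lemma eventually_b_pos: "eventually (\<lambda>n. 0 < b n) sequentially"
proof -
  have "eventually (\<lambda>n. 1 \<le> a n) sequentially"
    using a_at_top by (simp add: filterlim_at_top)
  then show ?thesis
    using eventually_gt_at_top[of 0] by eventually_elim (simp add: b_eq)
qed

text \<open>
  With \<open>w = a - ln n - (k - 1) ln ln n\<close> one has \<open>b = (a / ln n) ^ (k - 1) * exp (- w)\<close>, and the ratio
  \<open>a / ln n\<close> is at most \<open>k + w\<close>; the exponential wins as \<open>w\<close> tends to infinity.
\<close>

lemma b_tendsto_0: "b \<longlonglongrightarrow> 0"
proof -
  define w where "w = (\<lambda>n. a n - ln (real n) - (real k - 1) * ln (ln (real n)))"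
  have w: "filterlim w at_top sequentially" using a_large by (simp add: w_def)
  have "filterlim (\<lambda>n. real k + w n) at_top sequentially"
    by (rule filterlim_tendsto_add_at_top[OF tendsto_const w])
  then have "(\<lambda>n. (real k + w n) ^ (k - 1) / exp (real k + w n)) \<longlonglongrightarrow> 0"
    by (rule filterlim_compose[OF tendsto_power_div_exp_0])
  then have lim: "(\<lambda>n. exp (real k) * ((real k + w n) ^ (k - 1) / exp (real k + w n))) \<longlonglongrightarrow> 0"
    by (rule tendsto_mult_right_zero)
  show ?thesis
  proof (rule tendsto_sandwich[OF _ _ tendsto_const lim])
    show "eventually (\<lambda>n. 0 \<le> b n) sequentially"
      using eventually_b_pos by eventually_elim simp
    have "eventually (\<lambda>n. 0 \<le> w n) sequentially" "eventually (\<lambda>n. 1 \<le> a n) sequentially"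
      using w a_at_top by (simp_all add: filterlim_at_top)
    moreover have "eventually (\<lambda>n. 1 \<le> ln (real n)) sequentially" by real_asymp
    ultimately show "eventually (\<lambda>n. b n \<le> exp (real k) * ((real k + w n) ^ (k - 1) / exp (real k + w n))) sequentially"
      using eventually_gt_at_top[of 0]
    proof eventually_elim
      case (elim n)
      define L where "L = ln (real n)"
      have L: "1 \<le> L" "exp L = real n" using elim by (auto simp: L_def)
      have "a n = L + (real k - 1) * ln L + w n" by (simp add: w_def L_def)
      also have "\<dots> \<le> L + (real k - 1) * L + w n * L"
        using ln_le_minus_one[of L] L elim k
        by (intro add_mono mult_left_mono) (auto simp: mult_le_cancel_left1)
      also have "\<dots> = (real k + w n) * L" by (simp add: algebra_simps)
      finally have aL: "a n \<le> (real k + w n) * L" .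
      have "real n * exp (- a n) = exp L * exp (- (L + (real k - 1) * ln L + w n))"
        using L by (simp add: w_def L_def)
      also have "\<dots> = exp (- ((real k - 1) * ln L)) * exp (- w n)"
        by (simp flip: exp_add)
      also have "exp (- ((real k - 1) * ln L)) = 1 / L ^ (k - 1)"
      proof -
        have "(real k - 1) * ln L = real (k - 1) * ln L" using k by simp
        also have "exp \<dots> = L ^ (k - 1)"
          using L by (simp add: exp_of_nat_mult)
        finally show ?thesis by (simp add: exp_minus divide_inverse)
      qed
      finally have nL: "real n * exp (- a n) = 1 / L ^ (k - 1) * exp (- w n)" .
      have "b n = a n ^ (k - 1) * (real n * exp (- a n))"
        by (simp add: b_eq)
      also have "\<dots> = a n ^ (k - 1) / L ^ (k - 1) * exp (- w n)"
        unfolding nL by simp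
      also have "\<dots> \<le> ((real k + w n) * L) ^ (k - 1) / L ^ (k - 1) * exp (- w n)"
        using aL L elim by (intro mult_right_mono divide_right_mono power_mono) auto
      also have "\<dots> = (real k + w n) ^ (k - 1) * exp (- w n)"
        using L by (simp add: power_mult_distrib)
      also have "\<dots> = exp (real k) * ((real k + w n) ^ (k - 1) / exp (real k + w n))"
        by (simp add: exp_add exp_minus field_simps)
      finally show ?case .
    qed
  qed
qed

lemma binom_coeff_asymp:
  "(\<lambda>n. real ((n - 1) choose t) * ((a n + s) / real n) ^ t / a n ^ t) \<longlonglongrightarrow> 1 / fact t"
proof -
  have fac: "(\<lambda>n. (real (n - 1) - real i) * ((a n + s) / real n) / a n) \<longlonglongrightarrow> 1" for i
  proof -
    have "(\<lambda>n. (real (n - 1) - real i) / real n) \<longlonglongrightarrow> 1"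
    proof -
      have "(\<lambda>n. (real n - 1 - real i) / real n) \<longlonglongrightarrow> 1" by real_asymp
      moreover have "eventually (\<lambda>n. (real n - 1 - real i) / real n = (real (n - 1) - real i) / real n) sequentially"
        using eventually_gt_at_top[of 0] by eventually_elim (auto simp: of_nat_diff)
      ultimately show ?thesis by (simp add: filterlim_cong)
    qed
    from tendsto_mult[OF this shift_ratio[of s]] show ?thesis by (simp add: mult_ac)
  qed
  have "(\<lambda>n. (\<Prod>i=0..<t. (real (n - 1) - real i) * ((a n + s) / real n) / a n) / fact t) \<longlonglongrightarrow> (\<Prod>i=0..<t. 1) / fact t"
    by (intro tendsto_divide tendsto_prod fac tendsto_const) auto
  moreover have "(\<Prod>i=0..<t. (real (n - 1) - real i) * ((a n + s) / real n) / a n) / fact t =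
      real ((n - 1) choose t) * ((a n + s) / real n) ^ t / a n ^ t" for n
  proof -
    have "real ((n - 1) choose t) = (\<Prod>i=0..<t. real (n - 1) - real i) / fact t"
      by (simp add: binomial_gbinomial gbinomial_prod_rev)
    then show ?thesis
      by (simp add: prod.distrib prod_dividef power_divide power_mult_distrib)
  qed
  ultimately show ?thesis by simp
qed

text \<open>
  The quadratic error in \<open>ln (1 - q) \<approx> - q\<close> is harmless because \<open>n q\<^sup>2\<close> tends to \<open>0\<close>.
\<close>

lemma void_prob_asymp:
  "(\<lambda>n. (1 - (a n + s) / real n) ^ (n - 1 - t) * exp (a n)) \<longlonglongrightarrow> exp (- s)"
proof -
  define q where "q = (\<lambda>n. (a n + s) / real n)"
  define e where "e = (\<lambda>n. real (n - 1 - t) * (ln (1 - q n) + q n))"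
  have q0: "q \<longlonglongrightarrow> 0" unfolding q_def by (rule shift_over_n)
  have qpos: "eventually (\<lambda>n. 0 \<le> q n) sequentially"
  proof -
    have "eventually (\<lambda>n. - s \<le> a n) sequentially"
      using a_at_top by (simp add: filterlim_at_top)
    then show ?thesis by eventually_elim (simp add: q_def)
  qed
  have qhalf: "eventually (\<lambda>n. q n < 1 / 2) sequentially"
    using q0 by (rule order_tendstoD) simp
  have lim: "(\<lambda>n. 2 * ((a n + s)\<^sup>2 / real n)) \<longlonglongrightarrow> 0"
    by (rule tendsto_mult_right_zero[OF shift_square_over_n])
  have e0: "e \<longlonglongrightarrow> 0"
  proof (rule Lim_null_comparison[OF _ lim])
    show "eventually (\<lambda>n. norm (e n) \<le> 2 * ((a n + s)\<^sup>2 / real n)) sequentially"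
      using qpos qhalf eventually_gt_at_top[of 0]
    proof eventually_elim
      case (elim n)
      have "\<bar>ln (1 + (- q n)) - (- q n)\<bar> \<le> 2 * (- q n)\<^sup>2"
        using elim by (intro abs_ln_one_plus_x_minus_x_bound_nonpos) auto
      then have "norm (e n) \<le> real (n - 1 - t) * (2 * (q n)\<^sup>2)"
        by (auto simp: e_def abs_mult intro!: mult_left_mono)
      also have "\<dots> \<le> real n * (2 * (q n)\<^sup>2)" by (intro mult_right_mono) auto
      also have "\<dots> = 2 * ((a n + s)\<^sup>2 / real n)"
        using elim by (simp add: q_def power_divide power2_eq_square)
      finally show ?case .
    qed
  qed
  have "(\<lambda>n. exp (- s + real (1 + t) * q n + e n)) \<longlonglongrightarrow> exp (- s + real (1 + t) * 0 + 0)"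
    by (intro tendsto_intros q0 e0)
  moreover have "eventually (\<lambda>n. exp (- s + real (1 + t) * q n + e n) = (1 - (a n + s) / real n) ^ (n - 1 - t) * exp (a n)) sequentially"
    using qhalf eventually_gt_at_top[of "t + 1"]
  proof eventually_elim
    case (elim n)
    have "0 < 1 - q n" using elim by simp
    then have "(1 - q n) ^ (n - 1 - t) = exp (real (n - 1 - t) * ln (1 - q n))"
      by (simp only: exp_of_nat_mult exp_ln)
    then have "(1 - (a n + s) / real n) ^ (n - 1 - t) = exp (real (n - 1 - t) * ln (1 - q n))"
      by (simp only: q_def)
    then have "(1 - (a n + s) / real n) ^ (n - 1 - t) * exp (a n) = exp (real (n - 1 - t) * ln (1 - q n) + a n)"
      by (simp add: exp_add)
    also have "real (n - 1 - t) * ln (1 - q n) + a n = - s + real (1 + t) * q n + e n"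
    proof -
      have "real n * q n = a n + s" using elim by (simp add: q_def)
      moreover have "real (n - 1 - t) = real n - real (1 + t)" using elim by simp
      ultimately show ?thesis unfolding e_def by (simp only:) (simp add: algebra_simps)
    qed
    finally show ?case by simp
  qed
  ultimately show ?thesis by (simp add: filterlim_cong)
qed

text \<open>
  Only the term with \<open>t = k - 1\<close> of the binomial sum survives the normalization; the others are
  smaller by a positive power of \<open>a n\<close>.
\<close>

lemma one_point_asymp:
  "(\<lambda>n. real n * binom_lower (n - 1) ((a n + s) / real n) k / b n) \<longlonglongrightarrow> exp (- s) / fact (k - 1)"
proof -
  define q where "q = (\<lambda>n. (a n + s) / real n)"
  define G where "G = (\<lambda>n t. (real ((n - 1) choose t) * q n ^ t / a n ^ t) * inverse (a n ^ (k - 1 - t)) *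
    ((1 - q n) ^ (n - 1 - t) * exp (a n)))"
  have "(\<lambda>n. \<Sum>t<k. G n t) \<longlonglongrightarrow> (\<Sum>t<k. 1 / fact t * (if t = k - 1 then 1 else 0) * exp (- s))"
  proof (intro tendsto_sum)
    fix t assume t: "t \<in> {..<k}"
    have "(\<lambda>n. inverse (a n ^ (k - 1 - t))) \<longlonglongrightarrow> (if t = k - 1 then 1 else 0)"
    proof (cases "t = k - 1")
      case False
      then have "0 < k - 1 - t" using t by auto
      then have "filterlim (\<lambda>n. a n ^ (k - 1 - t)) at_top sequentially"
        by (intro filterlim_pow_at_top a_at_top)
      then show ?thesis
        using False tendsto_inverse_0_at_top by auto
    qed simp
    then show "(\<lambda>n. G n t) \<longlonglongrightarrow> 1 / fact t * (if t = k - 1 then 1 else 0) * exp (- s)"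
      unfolding G_def q_def by (intro tendsto_mult binom_coeff_asymp void_prob_asymp)
  qed
  also have "(\<Sum>t<k. 1 / fact t * (if t = k - 1 then 1 else 0) * exp (- s)) = exp (- s) / fact (k - 1)"
  proof -
    have "(\<Sum>t<k. 1 / fact t * (if t = k - 1 then 1 else 0) * exp (- s)) =
        (\<Sum>t<k. if t = k - 1 then exp (- s) / fact t else 0 :: real)"
      by (intro sum.cong) auto
    also have "\<dots> = exp (- s) / fact (k - 1)" using k by (subst sum.delta) auto
    finally show ?thesis .
  qed
  finally have lim: "(\<lambda>n. \<Sum>t<k. G n t) \<longlonglongrightarrow> exp (- s) / fact (k - 1)" .
  have "eventually (\<lambda>n. 1 \<le> a n) sequentially"
    using a_at_top by (simp add: filterlim_at_top)
  then have "eventually (\<lambda>n. (\<Sum>t<k. G n t) = real n * binom_lower (n - 1) ((a n + s) / real n) k / b n) sequentially"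
    using eventually_gt_at_top[of 0]
  proof eventually_elim
    case (elim n)
    have "real n * binom_lower (n - 1) (q n) k / b n =
        (\<Sum>t<k. real n * (real ((n - 1) choose t) * q n ^ t * (1 - q n) ^ (n - 1 - t)) / b n)"
      unfolding binom_lower_def by (simp add: sum_distrib_left sum_divide_distrib)
    also have "\<dots> = (\<Sum>t<k. G n t)"
    proof (rule sum.cong[OF refl])
      fix t assume "t \<in> {..<k}"
      then have "a n ^ (k - 1) = a n ^ t * a n ^ (k - 1 - t)" by (simp flip: power_add)
      then show "real n * (real ((n - 1) choose t) * q n ^ t * (1 - q n) ^ (n - 1 - t)) / b n = G n t"
        using elim by (simp add: G_def b_eq exp_minus field_simps)
    qed
    finally show ?case by (simp add: q_def)
  qed
  then show ?thesis using lim by (simp add: filterlim_cong)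
qed

text \<open>
  Dominates the probability that two overlapping balls, whose union exceeds one ball by the
  fraction \<open>\<delta>\<close>, together contain at most \<open>2 k - 2\<close> points.
\<close>

definition middle_bound :: "real \<Rightarrow> real \<Rightarrow> nat \<Rightarrow> real" where
  "middle_bound s \<delta> n =
     real (2 * k - 1) * (2 * (a n + s)) ^ (2 * k - 2) * exp (real (2 * k + 1) - (1 + \<delta>) * (a n + s))"

text \<open>
  The bound of \<open>measure_two_points_le\<close>, multiplied by the number \<open>n\<^sup>2\<close> of pairs. Here \<open>e\<close> and \<open>D\<close>
  stand for the volume factors \<open>\<epsilon> ^ d\<close> and \<open>2 ^ d\<close>: the ratio to \<open>b n\<close> is
  asymptotically proportional to \<open>e\<close>, which is at our disposal.
\<close>

lemma pair_bound_asymp: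
  fixes s \<delta> e D :: real
  assumes \<delta>: "0 < \<delta>" and e: "0 \<le> e" and D: "0 \<le> D"
  defines "P \<equiv> \<lambda>n. (a n + s) / real n"
  shows "eventually (\<lambda>n. \<forall>q. (1 + \<delta>) * P n \<le> q \<longrightarrow> q \<le> 2 * P n \<longrightarrow>
            binom_lower (n - 2) q (2 * k - 1) \<le> middle_bound s \<delta> n) sequentially" (is ?mid)
    and "\<exists>U. U \<longlonglongrightarrow> e * (real (k - 1) * exp (- s)) \<and>
          eventually (\<lambda>n. (real n)\<^sup>2 * (e * P n * binom_lower (n - 2) (P n) (k - 1) + D * P n * middle_bound s \<delta> n
            + binom_lower (n - 2) (2 * P n) (2 * k - 1)) \<le> U n * b n) sequentially" (is ?sum)
proof -
  define y where "y = (\<lambda>n. a n + s)"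
  have y_top: "filterlim y at_top sequentially"
    unfolding y_def using filterlim_tendsto_add_at_top[OF tendsto_const a_at_top, of s] by (simp add: add.commute)
  have P0: "P \<longlonglongrightarrow> 0" unfolding P_def by (rule shift_over_n)
  have ev: "eventually (\<lambda>n. 1 \<le> y n \<and> 1 \<le> a n \<and> 2 * P n \<le> 1 \<and> 2 < n) sequentially"
  proof (intro eventually_conj)
    show "eventually (\<lambda>n. 1 \<le> y n) sequentially" "eventually (\<lambda>n. 1 \<le> a n) sequentially"
      using y_top a_at_top by (simp_all add: filterlim_at_top)
    have "eventually (\<lambda>n. P n < 1 / 2) sequentially"
      using P0 by (rule order_tendstoD) simp
    then show "eventually (\<lambda>n. 2 * P n \<le> 1) sequentially" by eventually_elim simp
  qed (rule eventually_gt_at_top)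
  have nP: "real n * P n = y n" if "2 < n" for n using that by (simp add: P_def y_def)
  have crude: "binom_lower (n - 2) q K \<le> real K * N ^ (K - 1) * exp (q * real (K + 2) - real n * q)"
    if "0 \<le> q" "q \<le> 1" "real n * q \<le> N" "1 \<le> N" "2 < n" for n q K N
  proof -
    have "real (n - 2) * q \<le> real n * q" using that by (intro mult_right_mono) auto
    then have "binom_lower (n - 2) q K \<le> real K * N ^ (K - 1) * exp (q * real K - q * real (n - 2))"
      using that by (intro binom_lower_le) auto
    also have "q * real K - q * real (n - 2) = q * real (K + 2) - real n * q"
      using that by (simp add: of_nat_diff algebra_simps)
    finally show ?thesis .
  qed
  show ?mid
    using ev
  proof eventually_elim
    case (elim n)
    show ?case
    proof (intro allI impI)
      fix q assume q: "(1 + \<delta>) * P n \<le> q" "q \<le> 2 * P n"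
      have "0 < P n" using elim by (simp add: P_def y_def)
      then have q01: "0 \<le> q" "q \<le> 1" using q elim \<delta> mult_pos_pos[of "1 + \<delta>" "P n"] by linarith+
      have "real n * q \<le> real n * (2 * P n)" using q by (intro mult_left_mono) auto
      then have nq: "real n * q \<le> 2 * y n" using nP[of n] elim by linarith
      have "real n * ((1 + \<delta>) * P n) \<le> real n * q" using q by (intro mult_left_mono) auto
      then have "(1 + \<delta>) * (real n * P n) \<le> real n * q" by (simp only: mult_ac)
      then have nq': "(1 + \<delta>) * y n \<le> real n * q" using nP[of n] elim by simp
      have "binom_lower (n - 2) q (2 * k - 1) \<le>
          real (2 * k - 1) * (2 * y n) ^ (2 * k - 1 - 1) * exp (q * real (2 * k - 1 + 2) - real n * q)"
        by (rule crude) (use q01 nq elim in auto)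
      also have "\<dots> \<le> real (2 * k - 1) * (2 * y n) ^ (2 * k - 1 - 1) * exp (real (2 * k + 1) - (1 + \<delta>) * y n)"
      proof (intro mult_left_mono)
        have "q * real (2 * k - 1 + 2) \<le> 1 * real (2 * k + 1)"
          using q01 k by (intro mult_mono) auto
        then show "exp (q * real (2 * k - 1 + 2) - real n * q) \<le> exp (real (2 * k + 1) - (1 + \<delta>) * y n)"
          using nq' by simp
      qed (use elim in auto)
      also have "2 * k - 1 - 1 = 2 * k - 2" by simp
      finally show "binom_lower (n - 2) q (2 * k - 1) \<le> middle_bound s \<delta> n"
        by (simp add: middle_bound_def y_def)
    qed
  qed
  \<comment> \<open>The contributions of close, overlapping and distant pairs, each divided by \<open>b n\<close>.\<close>
  define U1 where "U1 = (\<lambda>n. e * (real (k - 1) * ((a n + s) / a n) ^ (k - 1) * exp (P n * real (k + 1)) * exp (- s)))"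
  define U2 where "U2 = (\<lambda>n. D * real (2 * k - 1) * 2 ^ (2 * k - 2) * exp (real (2 * k + 1)) * exp (- s) *
    (y n ^ (2 * k - 1) * exp (- (\<delta> * y n))) * inverse (a n ^ (k - 1)))"
  define U3 where "U3 = (\<lambda>n. real (2 * k - 1) * 2 ^ (2 * k - 2) * exp (2 * P n * real (2 * k + 1)) * exp (- (2 * s)) *
    ((a n + s) / a n) ^ (2 * k - 2) * b n)"
  have "U1 \<longlonglongrightarrow> e * (real (k - 1) * 1 ^ (k - 1) * exp (0 * real (k + 1)) * exp (- s))"
    unfolding U1_def by (intro tendsto_intros shift_ratio P0)
  moreover have "U2 \<longlonglongrightarrow> 0"
  proof -
    have "(\<lambda>n. y n ^ (2 * k - 1) * exp (- (\<delta> * y n))) \<longlonglongrightarrow> 0"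
    proof -
      have "filterlim (\<lambda>n. \<delta> * y n) at_top sequentially"
        by (rule filterlim_tendsto_pos_mult_at_top[OF tendsto_const \<delta> y_top])
      then have "(\<lambda>n. (\<delta> * y n) ^ (2 * k - 1) / exp (\<delta> * y n)) \<longlonglongrightarrow> 0"
        by (rule filterlim_compose[OF tendsto_power_div_exp_0])
      then have "(\<lambda>n. inverse (\<delta> ^ (2 * k - 1)) * ((\<delta> * y n) ^ (2 * k - 1) / exp (\<delta> * y n))) \<longlonglongrightarrow> 0"
        by (rule tendsto_mult_right_zero)
      then show ?thesis using \<delta> by (simp add: power_mult_distrib exp_minus field_simps)
    qed
    then have T: "(\<lambda>n. D * real (2 * k - 1) * 2 ^ (2 * k - 2) * exp (real (2 * k + 1)) * exp (- s) *
      (y n ^ (2 * k - 1) * exp (- (\<delta> * y n)))) \<longlonglongrightarrow> 0"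
      by (rule tendsto_mult_right_zero)
    show ?thesis
    proof (rule Lim_null_comparison[OF _ tendsto_norm_zero[OF T]])
      show "eventually (\<lambda>n. norm (U2 n) \<le> norm (D * real (2 * k - 1) * 2 ^ (2 * k - 2) * exp (real (2 * k + 1)) * exp (- s) *
      (y n ^ (2 * k - 1) * exp (- (\<delta> * y n))))) sequentially"
        using ev
      proof eventually_elim
        case (elim n)
        have "1 \<le> a n ^ (k - 1)" using elim by (simp add: one_le_power)
        then have "norm (inverse (a n ^ (k - 1))) \<le> 1"
          by (simp add: inverse_le_1_iff)
        then show ?case unfolding U2_def norm_mult[of _ "inverse _"] by (intro mult_left_le) auto
      qed
    qed
  qed
  moreover have "U3 \<longlonglongrightarrow> real (2 * k - 1) * 2 ^ (2 * k - 2) * exp (2 * 0 * real (2 * k + 1)) * exp (- (2 * s)) *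
    1 ^ (2 * k - 2) * 0"
    unfolding U3_def by (intro tendsto_intros shift_ratio P0 b_tendsto_0)
  ultimately have "(\<lambda>n. U1 n + U2 n + U3 n) \<longlonglongrightarrow> e * (real (k - 1) * 1 ^ (k - 1) * exp (0 * real (k + 1)) * exp (- s)) + 0 + 0"
    by (intro tendsto_add) simp_all
  moreover have "eventually (\<lambda>n. (real n)\<^sup>2 * (e * P n * binom_lower (n - 2) (P n) (k - 1) + D * P n * middle_bound s \<delta> n
            + binom_lower (n - 2) (2 * P n) (2 * k - 1)) \<le> (U1 n + U2 n + U3 n) * b n) sequentially"
    using ev
  proof eventually_elim
    case (elim n)
    have P: "0 < P n" using elim by (simp add: P_def y_def)
    have an: "0 < a n" "0 < y n" "0 < real n" using elim by auto
    note nP = nP[of n]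
    have y: "y n = a n + s" by (simp add: y_def)
    have "(real n)\<^sup>2 * (e * P n * binom_lower (n - 2) (P n) (k - 1)) \<le>
        (real n)\<^sup>2 * (e * P n * (real (k - 1) * y n ^ (k - 1 - 1) * exp (P n * real (k - 1 + 2) - real n * P n)))"
      using elim P nP e by (intro mult_left_mono crude) auto
    also have "\<dots> = real n * e * real (k - 1) * (y n * y n ^ (k - 1 - 1)) * exp (P n * real (k + 1) - y n)"
      using nP elim k by (simp add: power2_eq_square mult_ac)
    also have "\<dots> = real n * e * real (k - 1) * y n ^ (k - 1) * exp (P n * real (k + 1) - y n)"
      by (cases "k - 1") auto
    also have "\<dots> = U1 n * b n"
      unfolding U1_def b_eq y using an by (simp add: power_divide exp_diff exp_add exp_minus field_simps)
    finally have 1: "(real n)\<^sup>2 * (e * P n * binom_lower (n - 2) (P n) (k - 1)) \<le> U1 n * b n" .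
    have "(real n)\<^sup>2 * (D * P n * middle_bound s \<delta> n) =
       real n * D * real (2 * k - 1) * 2 ^ (2 * k - 2) * (y n * y n ^ (2 * k - 2)) * exp (real (2 * k + 1) - (1 + \<delta>) * y n)"
      using nP elim by (simp add: middle_bound_def y[symmetric] power2_eq_square mult_ac power_mult_distrib)
    also have "y n * y n ^ (2 * k - 2) = y n ^ (2 * k - 1)"
    proof -
      have "2 * k - 1 = Suc (2 * k - 2)" using k by simp
      then show ?thesis by (simp only: power_Suc)
    qed
    also have "real n * D * real (2 * k - 1) * 2 ^ (2 * k - 2) * y n ^ (2 * k - 1) * exp (real (2 * k + 1) - (1 + \<delta>) * y n)
      = U2 n * b n"
    proof -
      have "exp (real (2 * k + 1) - (1 + \<delta>) * y n) = exp (real (2 * k + 1)) * exp (- s) * exp (- (\<delta> * y n)) * exp (- a n)"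
        by (simp add: y algebra_simps flip: exp_add)
      then show ?thesis
        unfolding U2_def b_eq using an by (simp add: field_simps)
    qed
    finally have 2: "(real n)\<^sup>2 * (D * P n * middle_bound s \<delta> n) = U2 n * b n" .
    have "(real n)\<^sup>2 * binom_lower (n - 2) (2 * P n) (2 * k - 1) \<le>
       (real n)\<^sup>2 * (real (2 * k - 1) * (2 * y n) ^ (2 * k - 1 - 1) * exp (2 * P n * real (2 * k - 1 + 2) - real n * (2 * P n)))"
      using elim P nP by (intro mult_left_mono crude) auto
    also have "\<dots> = (real n)\<^sup>2 * (real (2 * k - 1) * (2 * y n) ^ (2 * k - 2) * exp (2 * P n * real (2 * k + 1) - 2 * y n))"
    proof -
      have "2 * k - 1 - 1 = 2 * k - 2" "2 * k - 1 + 2 = 2 * k + 1" using k by auto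
      then show ?thesis using nP elim by (simp add: mult_ac)
    qed
    also have "\<dots> = U3 n * b n"
    proof -
      have "exp (2 * P n * real (2 * k + 1) - 2 * y n) = exp (2 * P n * real (2 * k + 1)) * exp (- (2 * s)) * (exp (- a n) * exp (- a n))"
        by (simp add: y algebra_simps flip: exp_add)
      moreover have "a n ^ (2 * k - 2) = a n ^ (k - 1) * a n ^ (k - 1)"
      proof -
        have "2 * k - 2 = (k - 1) + (k - 1)" using k by simp
        then show ?thesis by (simp only: power_add)
      qed
      ultimately show ?thesis
        unfolding U3_def b_eq y power_mult_distrib
        using an by (simp add: power_divide power2_eq_square field_simps)
    qed
    finally have 3: "(real n)\<^sup>2 * binom_lower (n - 2) (2 * P n) (2 * k - 1) \<le> U3 n * b n" .
    show ?case using 1 2 3 by (simp add: distrib_left distrib_right)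
  qed
  ultimately show ?sum by (intro exI[of _ "\<lambda>n. U1 n + U2 n + U3 n"]) simp
qed

end

section \<open>The vague topology near finite configurations\<close>

text \<open>
  Compact sets avoid scores near \<open>-\<infinity>\<close>, so vague neighbourhoods cannot see points of low score.
\<close>

lemma compact_subset_E_bounded_below:
  assumes "compact K" "K \<subseteq> E_set"
  obtains c :: real where "\<And>p. p \<in> K \<Longrightarrow> ereal c < snd p"
proof (cases "K = {}")
  case False
  have "compact (snd ` K)"
    using assms(1) by (rule compact_continuous_image[rotated]) (intro continuous_intros)
  then obtain m where m: "m \<in> snd ` K" "\<And>u. u \<in> snd ` K \<Longrightarrow> m \<le> u"
    using compact_attains_inf[of "snd ` K"] False by auto
  have "-\<infinity> < m"
    using m(1) assms(2) by (auto simp: E_set_def)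
  then obtain c where "ereal c < m"
    using ereal_dense2[of "-\<infinity>" m] by auto
  have "ereal c < snd p" if "p \<in> K" for p
    using \<open>ereal c < m\<close> m(2)[of "snd p"] that by (auto intro: less_le_trans)
  then show ?thesis by (rule that)
qed (use that in auto)

lemma space_E_borel [simp]: "space E_borel = E_set"
  by (simp add: E_borel_def space_restrict_space)

lemma sets_E_set [measurable]: "(E_set :: ((real ^ 'd::finite) \<times> ereal) set) \<in> sets borel"
proof -
  have "(unit_cube :: (real ^ 'd) set) \<times> {-\<infinity> :: ereal <..} \<in> sets (borel \<Otimes>\<^sub>M borel)"
    by (intro pair_measureI) (auto intro: sets_unit_cube)
  then show ?thesis unfolding borel_prod E_set_def .
qed

lemma sets_E_borel_iff: "A \<in> sets E_borel \<longleftrightarrow> A \<in> sets borel \<and> A \<subseteq> E_set"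
  unfolding E_borel_def using sets_E_set by (auto simp: sets_restrict_space_iff)

lemma CK_plus_measurable: "f \<in> CK_plus \<Longrightarrow> f \<in> borel_measurable E_borel"
  unfolding E_borel_def CK_plus_def by (auto intro: borel_measurable_continuous_on_restrict)

lemma sets_dirac_sum [simp, measurable_cong]: "sets (dirac_sum N I x) = sets N"
  and space_dirac_sum [simp]: "space (dirac_sum N I x) = space N"
  by (auto simp: dirac_sum_def)

lemma emeasure_dirac_sum:
  assumes "finite I" "x \<in> I \<rightarrow> space N" "A \<in> sets N"
  shows "emeasure (dirac_sum N I x) A = of_nat (card {i \<in> I. x i \<in> A})"
proof -
  have "emeasure (dirac_sum N I x) A = emeasure (count_space I) (x -` A \<inter> I)"
    unfolding dirac_sum_def using assms by (subst emeasure_distr) auto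
  also have "\<dots> = of_nat (card {i \<in> I. x i \<in> A})"
    using assms(1) by (subst emeasure_count_space_finite)
      (auto intro!: arg_cong[where f = card] finite_subset[OF _ assms(1)])
  finally show ?thesis .
qed

lemma integral_dirac_sum:
  fixes f :: "'a \<Rightarrow> real"
  assumes "finite I" "x \<in> I \<rightarrow> space N" "f \<in> borel_measurable N"
  shows "(\<integral>p. f p \<partial>dirac_sum N I x) = (\<Sum>i\<in>I. f (x i))"
  unfolding dirac_sum_def using assms
  by (subst integral_distr) (auto simp: lebesgue_integral_count_space_finite)

lemma dirac_sum_in_point_measures:
  fixes I :: "nat set"
  assumes "finite I" "y \<in> I \<rightarrow> E_set"
  shows "dirac_sum E_borel I y \<in> point_measures"
proof -
  have "emeasure (dirac_sum E_borel I y) K < \<infinity>" if "compact K" "K \<subseteq> E_set" for K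
    using assms that by (subst emeasure_dirac_sum) (auto simp: sets_E_borel_iff compact_imp_closed
      ennreal_of_nat_eq_real_of_nat)
  then show ?thesis
    unfolding point_measures_def using assms by blast
qed

lemma return_eq_dirac_sum:
  fixes i :: nat
  assumes "y i \<in> E_set"
  shows "return E_borel (y i) = dirac_sum E_borel {i} y"
proof (rule measure_eqI)
  fix A assume "A \<in> sets (return E_borel (y i))"
  then have A: "A \<in> sets E_borel" by simp
  have "{j \<in> {i}. y j \<in> A} = (if y i \<in> A then {i} else {})" by auto
  then show "emeasure (return E_borel (y i)) A = emeasure (dirac_sum E_borel {i} y) A"
    using assms A by (subst emeasure_dirac_sum) (simp_all add: indicator_def)
qed simp

lemma null_measure_eq_dirac_sum: "null_measure E_borel = dirac_sum E_borel ({} :: nat set) y"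
  by (rule measure_eqI) (simp_all add: emeasure_dirac_sum)

lemma topspace_vague_topology: "topspace vague_topology = point_measures"
proof
  show "topspace vague_topology \<subseteq> point_measures"
    by (auto simp: vague_topology_def topology_generated_by_topspace)
  have "(\<lambda>_. 0) \<in> CK_plus"
    unfolding CK_plus_def by (auto intro!: exI[of _ "{}"])
  then have "{\<mu> \<in> point_measures. (\<integral>p. (\<lambda>_. 0 :: real) p \<partial>\<mu>) \<in> UNIV} \<subseteq> topspace vague_topology"
    unfolding vague_topology_def topology_generated_by_topspace
    by (intro Union_upper CollectI exI[of _ "\<lambda>_. 0"] exI[of _ UNIV]) auto
  then show "point_measures \<subseteq> topspace vague_topology" by simp
qed

lemma openin_vague_subset: "{U. openin vague_topology U} \<subseteq> Pow point_measures"
  using openin_subset[of vague_topology] by (auto simp: topspace_vague_topology)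

lemma sets_vague_borel: "sets vague_borel = sigma_sets point_measures {U. openin vague_topology U}"
  unfolding vague_borel_def by (rule sets_measure_of) (rule openin_vague_subset)

lemma space_vague_borel [simp]: "space vague_borel = point_measures"
  unfolding vague_borel_def by (rule space_measure_of) (rule openin_vague_subset)

lemma open_in_vague_borel: "openin vague_topology U \<Longrightarrow> U \<in> sets vague_borel"
  by (auto simp: sets_vague_borel)

lemma measurable_vague_borelI:
  assumes "\<And>w. w \<in> space M \<Longrightarrow> L w \<in> point_measures"
    and "\<And>U. openin vague_topology U \<Longrightarrow> {w \<in> space M. L w \<in> U} \<in> sets M"
  shows "L \<in> measurable M vague_borel"
  unfolding vague_borel_def
proof (rule measurable_measure_of)
  show "{U. openin vague_topology U} \<subseteq> Pow point_measures"
    by (rule openin_vague_subset)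
  show "L -` U \<inter> space M \<in> sets M" if "U \<in> {U. openin vague_topology U}" for U
    using assms(2)[of U] that by (simp add: vimage_def Int_def conj_commute)
qed (use assms(1) in auto)

text \<open>
  \<open>(J, y)\<close> consists of points close to prescribed ones, the \<open>i\<close>-th of them lying in \<open>W i\<close> at the index \<open>e i\<close>,
  together with any finite number of further points of score at most \<open>c\<close>. The injection \<open>e\<close> is
  needed because the index at which an exceedance occurs is random.
\<close>

definition perturbation ::
  "nat set \<Rightarrow> (nat \<Rightarrow> ((real ^ 'd::finite) \<times> ereal) set) \<Rightarrow> real \<Rightarrow> nat set \<Rightarrow> (nat \<Rightarrow> (real ^ 'd) \<times> ereal) \<Rightarrow> bool" where
  "perturbation I W c J y \<longleftrightarrow> finite J \<and> y \<in> J \<rightarrow> E_set \<and>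
     (\<exists>e. inj_on e I \<and> e ` I \<subseteq> J \<and> (\<forall>i\<in>I. y (e i) \<in> W i) \<and> (\<forall>j\<in>J - e ` I. snd (y j) \<le> ereal c))"

lemma perturbation_mono:
  assumes "perturbation I W c J y" "c \<le> c'" "\<And>i. i \<in> I \<Longrightarrow> W i \<subseteq> W' i"
  shows "perturbation I W' c' J y"
proof -
  obtain e where e: "finite J" "y \<in> J \<rightarrow> E_set" "inj_on e I" "e ` I \<subseteq> J" "\<And>i. i \<in> I \<Longrightarrow> y (e i) \<in> W i"
    "\<And>j. j \<in> J - e ` I \<Longrightarrow> snd (y j) \<le> ereal c"
    using assms(1) unfolding perturbation_def by blast
  have "snd (y j) \<le> ereal c'" if "j \<in> J - e ` I" for j
    using e(6)[OF that] assms(2) by (meson ereal_less_eq(3) order_trans)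
  moreover have "y (e i) \<in> W' i" if "i \<in> I" for i
    using e(5)[OF that] assms(3)[OF that] by blast
  ultimately show ?thesis
    unfolding perturbation_def using e(1-4) by blast
qed

lemma perturbation_single:
  assumes "finite J" "y \<in> J \<rightarrow> E_set" "i \<in> J" "y i \<in> W 0" "\<And>j. j \<in> J - {i} \<Longrightarrow> snd (y j) \<le> ereal c"
  shows "perturbation {0} W c J y"
  unfolding perturbation_def using assms by (intro conjI exI[of _ "\<lambda>_. i"]) auto

text \<open>
  By induction over the generation of the topology. For a subbasic set, the test function vanishes on
  the points of low score and is continuous at the finitely many others.
\<close>

lemma vague_nbhd_dirac_sum:
  fixes I :: "nat set" and U :: "((real ^ 'd::finite) \<times> ereal) measure set"
  assumes "openin vague_topology U" "finite I" "y0 \<in> I \<rightarrow> E_set" "dirac_sum E_borel I y0 \<in> U"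
  shows "\<exists>c W. (\<forall>i\<in>I. open (W i) \<and> y0 i \<in> W i) \<and>
           (\<forall>J y. perturbation I W c J y \<longrightarrow> dirac_sum E_borel J y \<in> U)"
proof -
  let ?B = "{{\<mu> \<in> point_measures. (\<integral>p. f p \<partial>\<mu>) \<in> V} | f V. f \<in> CK_plus \<and> open V}
              :: ((real ^ 'd) \<times> ereal) measure set set"
  have "generate_topology_on ?B U"
    using assms(1) by (simp add: vague_topology_def openin_topology_generated_by_iff)
  then show ?thesis
    using assms(4)
  proof induction
    case Empty
    then show ?case by simp
  next
    case (Int U V)
    obtain c W where U: "\<forall>i\<in>I. open (W i) \<and> y0 i \<in> W i"
      "\<And>J y. perturbation I W c J y \<Longrightarrow> dirac_sum E_borel J y \<in> U"
      using Int.IH(1) Int.prems by auto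
    obtain c' W' where V: "\<forall>i\<in>I. open (W' i) \<and> y0 i \<in> W' i"
      "\<And>J y. perturbation I W' c' J y \<Longrightarrow> dirac_sum E_borel J y \<in> V"
      using Int.IH(2) Int.prems by auto
    have "dirac_sum E_borel J y \<in> U \<inter> V" if "perturbation I (\<lambda>i. W i \<inter> W' i) (min c c') J y" for J y
      using perturbation_mono[OF that, of c W] perturbation_mono[OF that, of c' W'] U(2) V(2) by simp
    then show ?case
      using U(1) V(1) by (intro exI[of _ "min c c'"] exI[of _ "\<lambda>i. W i \<inter> W' i"]) auto
  next
    case (UN K)
    then obtain V where V: "V \<in> K" "dirac_sum E_borel I y0 \<in> V" by auto
    from UN.IH[OF this] obtain c W where "\<forall>i\<in>I. open (W i) \<and> y0 i \<in> W i"
      "\<forall>J y. perturbation I W c J y \<longrightarrow> dirac_sum E_borel J y \<in> V" by auto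
    then show ?case
      using V(1) by (intro exI[of _ c] exI[of _ W]) auto
  next
    case (Basis U)
    then obtain f V where f: "f \<in> CK_plus" and V: "open V"
      and U: "U = {\<mu> \<in> point_measures. (\<integral>p. f p \<partial>\<mu>) \<in> V}" by auto
    obtain K where K: "compact K" "K \<subseteq> E_set" "\<And>p. p \<in> E_set - K \<Longrightarrow> f p = 0"
      using f unfolding CK_plus_def by auto
    obtain c where c: "\<And>p. p \<in> K \<Longrightarrow> ereal c < snd p"
      using compact_subset_E_bounded_below[OF K(1,2)] by auto
    note fm = CK_plus_measurable[OF f]
    have "(\<Sum>i\<in>I. f (y0 i)) \<in> V"
      using Basis.prems assms(2,3) fm by (simp add: U integral_dirac_sum)
    then obtain \<delta> where \<delta>: "\<delta> > 0" "ball (\<Sum>i\<in>I. f (y0 i)) \<delta> \<subseteq> V"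
      using V open_contains_ball by blast
    define \<eta> where "\<eta> = \<delta> / (real (card I) + 1)"
    have \<eta>: "\<eta> > 0" using \<delta> by (simp add: \<eta>_def)
    have "\<exists>W. open W \<and> y0 i \<in> W \<and> (\<forall>p\<in>E_set. p \<in> W \<longrightarrow> f p \<in> ball (f (y0 i)) \<eta>)" if "i \<in> I" for i
    proof -
      have "y0 i \<in> E_set" using assms(3) that by auto
      moreover have "continuous_on E_set f" using f by (simp add: CK_plus_def)
      ultimately show ?thesis
        using \<eta> unfolding continuous_on_topological by (meson centre_in_ball open_ball)
    qed
    then have "\<exists>W. \<forall>i\<in>I. open (W i) \<and> y0 i \<in> W i \<and> (\<forall>p\<in>E_set. p \<in> W i \<longrightarrow> f p \<in> ball (f (y0 i)) \<eta>)"
      by (intro bchoice) auto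
    then obtain W where W: "\<forall>i\<in>I. open (W i) \<and> y0 i \<in> W i"
      "\<And>i p. i \<in> I \<Longrightarrow> p \<in> W i \<Longrightarrow> p \<in> E_set \<Longrightarrow> dist (f (y0 i)) (f p) < \<eta>"
      by auto
    have "dirac_sum E_borel J y \<in> U" if "perturbation I W c J y" for J y
    proof -
      obtain e where e: "finite J" "y \<in> J \<rightarrow> E_set" "inj_on e I" "e ` I \<subseteq> J" "\<And>i. i \<in> I \<Longrightarrow> y (e i) \<in> W i"
        "\<And>j. j \<in> J - e ` I \<Longrightarrow> snd (y j) \<le> ereal c"
        using \<open>perturbation I W c J y\<close> unfolding perturbation_def by auto
      have "f (y j) = 0" if "j \<in> J - e ` I" for j
      proof (rule K(3))
        show "y j \<in> E_set - K"
          using e(2,6) that c[of "y j"] by (auto simp: not_less[symmetric])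
      qed
      then have "(\<Sum>j\<in>J. f (y j)) = (\<Sum>j\<in>e ` I. f (y j))"
        using e(1,4) by (intro sum.mono_neutral_right) auto
      also have "\<dots> = (\<Sum>i\<in>I. f (y (e i)))"
        using e(3) by (simp add: sum.reindex)
      finally have *: "(\<integral>p. f p \<partial>dirac_sum E_borel J y) = (\<Sum>i\<in>I. f (y (e i)))"
        using e(1,2) fm by (subst integral_dirac_sum) auto
      have "dist (\<Sum>i\<in>I. f (y0 i)) (\<Sum>i\<in>I. f (y (e i))) = \<bar>\<Sum>i\<in>I. f (y0 i) - f (y (e i))\<bar>"
        by (simp add: dist_real_def sum_subtractf)
      also have "\<dots> \<le> (\<Sum>i\<in>I. \<bar>f (y0 i) - f (y (e i))\<bar>)" by (rule sum_abs)
      also have "\<dots> \<le> (\<Sum>i\<in>I. \<eta>)"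
      proof (rule sum_mono)
        fix i assume "i \<in> I"
        then have "dist (f (y0 i)) (f (y (e i))) < \<eta>"
          using e(2,4,5) by (intro W(2)) auto
        then show "\<bar>f (y0 i) - f (y (e i))\<bar> \<le> \<eta>" by (simp add: dist_real_def)
      qed
      also have "\<dots> < \<delta>"
        using \<delta> by (simp add: \<eta>_def field_simps)
      finally have "(\<integral>p. f p \<partial>dirac_sum E_borel J y) \<in> V"
        using \<delta>(2) * by (auto simp: subset_eq)
      then show "dirac_sum E_borel J y \<in> U"
        unfolding U using dirac_sum_in_point_measures[OF e(1,2)] by simp
    qed
    then show ?case
      using W(1) by (intro exI[of _ c] exI[of _ W]) simp
  qed
qed

lemma vague_nbhd_null:
  fixes U :: "((real ^ 'd::finite) \<times> ereal) measure set"
  assumes "openin vague_topology U" "null_measure E_borel \<in> U"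
  shows "\<exists>c :: real. \<forall>J y. finite (J :: nat set) \<longrightarrow> y \<in> J \<rightarrow> E_set \<longrightarrow>
    (\<forall>j\<in>J. snd (y j) \<le> ereal c) \<longrightarrow> dirac_sum E_borel J y \<in> U"
proof -
  have "dirac_sum E_borel ({} :: nat set) (\<lambda>_. undefined) \<in> U"
    using assms(2) unfolding null_measure_eq_dirac_sum[of "\<lambda>_. undefined"] .
  from vague_nbhd_dirac_sum[OF assms(1) _ _ this]
  obtain c and W :: "nat \<Rightarrow> ((real ^ 'd) \<times> ereal) set"
    where "\<forall>J y. perturbation {} W c J y \<longrightarrow> dirac_sum E_borel J y \<in> U" by auto
  then have W: "\<And>J y. perturbation {} W c J y \<Longrightarrow> dirac_sum E_borel J y \<in> U" by simp
  show ?thesis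
    by (intro exI[of _ c] allI impI W) (simp add: perturbation_def)
qed

lemma vague_nbhd_single:
  fixes U :: "((real ^ 'd::finite) \<times> ereal) measure set"
  assumes "openin vague_topology U" "p \<in> E_set" "return E_borel p \<in> U"
  obtains c :: real and W where "open W" "p \<in> W"
    "\<And>J y i. finite (J :: nat set) \<Longrightarrow> y \<in> J \<rightarrow> E_set \<Longrightarrow> i \<in> J \<Longrightarrow> y i \<in> W \<Longrightarrow>
      \<forall>j\<in>J - {i}. snd (y j) \<le> ereal c \<Longrightarrow> dirac_sum E_borel J y \<in> U"
proof -
  have "dirac_sum E_borel {0::nat} (\<lambda>_. p) \<in> U"
    using assms(2,3) return_eq_dirac_sum[of "\<lambda>_. p" 0] by simp
  from vague_nbhd_dirac_sum[OF assms(1) _ _ this] assms(2)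
  obtain c and W :: "nat \<Rightarrow> ((real ^ 'd) \<times> ereal) set"
    where *: "open (W 0) \<and> p \<in> W 0" "\<forall>J y. perturbation {0} W c J y \<longrightarrow> dirac_sum E_borel J y \<in> U"
    by auto
  then have W: "open (W 0)" "p \<in> W 0" "\<And>J y. perturbation {0} W c J y \<Longrightarrow> dirac_sum E_borel J y \<in> U"
    by simp_all
  show ?thesis
    by (rule that[of "W 0" c], (rule W)+) (rule perturbation_single, auto)
qed

text \<open>
  A finite configuration depends continuously on the tuple of its points, so the preimage of a
  vaguely open set is open in a second countable product space, where the Borel
  sets are generated by the coordinates.
\<close>

lemma measurable_dirac_sum:
  fixes y :: "'a \<Rightarrow> nat \<Rightarrow> (real ^ 'd::finite) \<times> ereal"
  assumes "finite I"
    and [measurable]: "\<And>i. i \<in> I \<Longrightarrow> (\<lambda>w. y w i) \<in> borel_measurable M"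
    and E: "\<And>w i. w \<in> space M \<Longrightarrow> i \<in> I \<Longrightarrow> y w i \<in> E_set"
  shows "(\<lambda>w. dirac_sum E_borel I (y w)) \<in> measurable M vague_borel"
proof (rule measurable_vague_borelI)
  fix U :: "((real ^ 'd) \<times> ereal) measure set"
  assume U: "openin vague_topology U"
  define y' where "y' = (\<lambda>w i. if i \<in> I then y w i else (0, 0))"
  have "(\<lambda>w. y' w i) \<in> borel_measurable M" for i
    by (cases "i \<in> I") (auto simp: y'_def)
  then have y'[measurable]: "y' \<in> borel_measurable M"
    by (rule measurable_coordinatewise_then_product)
  define \<W> where "\<W> = {W. (\<forall>i. open (W i)) \<and> finite {i. W i \<noteq> UNIV} \<and>
    (\<forall>z\<in>I \<rightarrow> E_set. (\<forall>i\<in>I. z i \<in> W i) \<longrightarrow> dirac_sum E_borel I z \<in> U)}"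
  define O' where "O' = (\<Union>W\<in>\<W>. Pi\<^sub>E UNIV W)"
  have "open O'"
    unfolding O'_def by (intro open_UN ballI open_PiE) (auto simp: \<W>_def)
  have "{w \<in> space M. dirac_sum E_borel I (y w) \<in> U} = y' -` O' \<inter> space M"
  proof (intro equalityI subsetI; elim CollectE IntE conjE)
    fix w assume w: "w \<in> space M" "dirac_sum E_borel I (y w) \<in> U"
    have "y w \<in> I \<rightarrow> E_set" using E[OF w(1)] by auto
    from vague_nbhd_dirac_sum[OF U assms(1) this w(2)]
    obtain c W where W: "\<forall>i\<in>I. open (W i) \<and> y w i \<in> W i"
      and Wd: "\<And>J z. perturbation I W c J z \<Longrightarrow> dirac_sum E_borel J z \<in> U"
      by auto
    define W' where "W' = (\<lambda>i. if i \<in> I then W i else UNIV)"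
    have "W' \<in> \<W>"
      unfolding \<W>_def
    proof (intro CollectI conjI allI ballI impI)
      show "finite {i. W' i \<noteq> UNIV}"
        by (rule finite_subset[OF _ assms(1)]) (auto simp: W'_def)
      show "dirac_sum E_borel I z \<in> U" if "z \<in> I \<rightarrow> E_set" "\<forall>i\<in>I. z i \<in> W' i" for z
        by (rule Wd) (use that assms(1) in \<open>auto simp: W'_def perturbation_def intro!: exI[of _ id]\<close>)
    qed (auto simp: W'_def W)
    moreover have "y' w \<in> Pi\<^sub>E UNIV W'"
      using W by (auto simp: y'_def W'_def)
    ultimately show "w \<in> y' -` O' \<inter> space M"
      using w by (auto simp: O'_def)
  next
    fix w assume w: "w \<in> y' -` O'" "w \<in> space M"
    then obtain W where W: "W \<in> \<W>" "y' w \<in> Pi\<^sub>E UNIV W" by (auto simp: O'_def)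
    have "y w \<in> I \<rightarrow> E_set" "\<forall>i\<in>I. y w i \<in> W i"
    proof -
      show "y w \<in> I \<rightarrow> E_set" using E[OF w(2)] by auto
      show "\<forall>i\<in>I. y w i \<in> W i"
      proof
        fix i assume "i \<in> I"
        then have "y' w i = y w i" by (simp add: y'_def)
        moreover have "y' w i \<in> W i" using W(2) by auto
        ultimately show "y w i \<in> W i" by simp
      qed
    qed
    then show "w \<in> {w \<in> space M. dirac_sum E_borel I (y w) \<in> U}"
      using W(1) w(2) by (auto simp: \<W>_def)
  qed
  also have "\<dots> \<in> sets M"
    using \<open>open O'\<close> by measurable
  finally show "{w \<in> space M. dirac_sum E_borel I (y w) \<in> U} \<in> sets M" .
qed (use E assms(1) in \<open>auto intro!: dirac_sum_in_point_measures\<close>)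

lemma measurable_return_vague:
  assumes [measurable]: "p \<in> borel_measurable M"
    and E: "\<And>w. w \<in> space M \<Longrightarrow> p w \<in> E_set"
  shows "(\<lambda>w. return E_borel (p w)) \<in> measurable M vague_borel"
proof -
  have "(\<lambda>w. dirac_sum E_borel {0::nat} (\<lambda>_. p w)) \<in> measurable M vague_borel"
    using measurable_dirac_sum[of "{0}" "\<lambda>w _. p w" M] E by simp
  moreover have "return E_borel (p w) = dirac_sum E_borel {0::nat} (\<lambda>_. p w)" if "w \<in> space M" for w
    using return_eq_dirac_sum[of "\<lambda>_. p w" 0] E[OF that] by simp
  ultimately show ?thesis
    by (simp cong: measurable_cong)
qed

lemma C0_measurable: "g \<in> C0_functions \<Longrightarrow> g \<in> borel_measurable vague_borel"
proof (rule borel_measurableI)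
  fix S :: "real set" assume "open S" "g \<in> C0_functions"
  then have "openin vague_topology {\<mu> \<in> topspace vague_topology. g \<mu> \<in> S}"
    unfolding C0_functions_def by (auto intro: openin_continuous_map_preimage)
  moreover have "{\<mu> \<in> topspace vague_topology. g \<mu> \<in> S} = g -` S \<inter> space vague_borel"
    by (auto simp: topspace_vague_topology)
  ultimately show "g -` S \<inter> space vague_borel \<in> sets vague_borel"
    by (auto intro: open_in_vague_borel)
qed

lemma C0_vanishes_below:
  assumes "g \<in> C0_functions"
  obtains c :: real where "\<And>J y. finite (J :: nat set) \<Longrightarrow> y \<in> J \<rightarrow> E_set \<Longrightarrow>
    (\<And>j. j \<in> J \<Longrightarrow> snd (y j) \<le> ereal c) \<Longrightarrow> g (dirac_sum E_borel J y) = 0"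
proof -
  obtain U where U: "openin vague_topology U" "null_measure E_borel \<in> U" "\<And>\<mu>. \<mu> \<in> U \<Longrightarrow> g \<mu> = 0"
    using assms by (auto simp: C0_functions_def)
  obtain c where c: "\<And>J y. finite (J :: nat set) \<Longrightarrow> y \<in> J \<rightarrow> E_set \<Longrightarrow>
    \<forall>j\<in>J. snd (y j) \<le> ereal c \<Longrightarrow> dirac_sum E_borel J y \<in> U"
    using vague_nbhd_null[OF U(1,2)] by blast
  show ?thesis
    by (rule that[of c], rule U(3), rule c) auto
qed

text \<open>
  Each position \<open>p\<close> of the single point has a neighbourhood and a level that work there, by continuity
  of \<open>g\<close> at the Dirac mass in \<open>p\<close>. Finitely many of these neighbourhoods cover the compact
  set of positions with score in \<open>[c, \<infinity>]\<close>, and the lowest of their levels serves as \<open>c'\<close>.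
\<close>

lemma C0_single_point_approx:
  fixes g :: "((real ^ 'd::finite) \<times> ereal) measure \<Rightarrow> real"
  assumes g: "g \<in> C0_functions" and "\<epsilon> > 0"
  obtains c' :: real where "c' \<le> c"
    "\<And>J y i. finite (J :: nat set) \<Longrightarrow> y \<in> J \<rightarrow> E_set \<Longrightarrow> i \<in> J \<Longrightarrow> ereal c \<le> snd (y i) \<Longrightarrow>
      (\<And>j. j \<in> J - {i} \<Longrightarrow> snd (y j) \<le> ereal c') \<Longrightarrow>
      \<bar>g (dirac_sum E_borel J y) - g (return E_borel (y i))\<bar> < \<epsilon>"
proof -
  define K where "K = (unit_cube :: (real ^ 'd) set) \<times> {ereal c..}"
  have "compact K"
    unfolding K_def using closed_Int_compact[of "{ereal c..}" UNIV] compact_UNIV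
    by (intro compact_Times compact_unit_cube) auto
  have KE: "K \<subseteq> E_set" by (auto simp: K_def E_set_def)
  define Q where "Q = (\<lambda>c' W. open W \<and> (\<forall>J y i. finite (J :: nat set) \<longrightarrow> y \<in> J \<rightarrow> E_set \<longrightarrow>
      i \<in> J \<longrightarrow> y i \<in> W \<longrightarrow> (\<forall>j\<in>J - {i}. snd (y j) \<le> ereal c') \<longrightarrow>
      \<bar>g (dirac_sum E_borel J y) - g (return E_borel (y i))\<bar> < \<epsilon>))"
  have "\<exists>c' W. p \<in> W \<and> Q c' W" if "p \<in> K" for p
  proof -
    have p: "p \<in> E_set" using that KE by auto
    have ret: "return E_borel p = dirac_sum E_borel {0::nat} (\<lambda>_. p)"
      using return_eq_dirac_sum[of "\<lambda>_. p" 0] p by simp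
    define U where "U = {\<mu> \<in> topspace vague_topology. g \<mu> \<in> ball (g (return E_borel p)) (\<epsilon> / 2)}"
    have "openin vague_topology U"
      unfolding U_def using g by (intro openin_continuous_map_preimage[where Y = euclideanreal]) (auto simp: C0_functions_def)
    moreover have "return E_borel p \<in> U"
      using p \<open>\<epsilon> > 0\<close> unfolding U_def topspace_vague_topology
      by (auto simp: ret intro!: dirac_sum_in_point_measures)
    ultimately obtain c' W where W: "open W" "p \<in> W"
      and Wd: "\<And>J y i. finite (J :: nat set) \<Longrightarrow> y \<in> J \<rightarrow> E_set \<Longrightarrow> i \<in> J \<Longrightarrow> y i \<in> W \<Longrightarrow>
        \<forall>j\<in>J - {i}. snd (y j) \<le> ereal c' \<Longrightarrow> dirac_sum E_borel J y \<in> U"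
      using p by (elim vague_nbhd_single[of U p]) auto
    have "Q c' W"
      unfolding Q_def
    proof (intro conjI allI impI W)
      fix J :: "nat set" and y i
      assume A: "finite J" "y \<in> J \<rightarrow> E_set" "i \<in> J" "y i \<in> W" "\<forall>j\<in>J - {i}. snd (y j) \<le> ereal c'"
      have "dirac_sum E_borel J y \<in> U"
        by (rule Wd[OF A])
      moreover have "dirac_sum E_borel {i} y \<in> U"
        by (rule Wd[of "{i}" y i]) (use A in auto)
      moreover have "return E_borel (y i) = dirac_sum E_borel {i} y"
        using A by (intro return_eq_dirac_sum) auto
      ultimately show "\<bar>g (dirac_sum E_borel J y) - g (return E_borel (y i))\<bar> < \<epsilon>"
        by (auto simp: U_def dist_real_def abs_if split: if_splits)
    qed
    then show ?thesis using W(2) by auto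
  qed
  then have "\<forall>p\<in>K. \<exists>c' W. p \<in> W \<and> Q c' W" by blast
  then obtain C W where CW: "\<And>p. p \<in> K \<Longrightarrow> p \<in> W p" "\<And>p. p \<in> K \<Longrightarrow> Q (C p) (W p)"
    unfolding bchoice_iff by auto
  have "\<And>p. p \<in> K \<Longrightarrow> open (W p)" using CW(2) by (simp add: Q_def)
  obtain D where D: "D \<subseteq> K" "finite D" "K \<subseteq> (\<Union>p\<in>D. W p)"
    by (rule compactE_image[OF \<open>compact K\<close>, of K W]) (use CW(1) \<open>\<And>p. p \<in> K \<Longrightarrow> open (W p)\<close> in auto)
  define c' where "c' = Min (insert c (C ` D))"
  have c': "c' \<le> c" "\<And>p. p \<in> D \<Longrightarrow> c' \<le> C p"
    using D(2) by (auto simp: c'_def)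
  show ?thesis
  proof (rule that[OF c'(1)])
    fix J :: "nat set" and y :: "nat \<Rightarrow> (real ^ 'd) \<times> ereal" and i
    assume A: "finite J" "y \<in> J \<rightarrow> E_set" "i \<in> J" "ereal c \<le> snd (y i)"
      "\<And>j. j \<in> J - {i} \<Longrightarrow> snd (y j) \<le> ereal c'"
    have "y i \<in> K" using A by (auto simp: K_def E_set_def mem_Times_iff Pi_iff)
    then obtain p where p: "p \<in> D" "y i \<in> W p" using D by blast
    have "\<forall>j\<in>J - {i}. snd (y j) \<le> ereal (C p)"
      using A(5) c'(2)[OF p(1)] by (meson ereal_less_eq(3) order_trans)
    then show "\<bar>g (dirac_sum E_borel J y) - g (return E_borel (y i))\<bar> < \<epsilon>"
      using CW(2)[of p] p D(1) A unfolding Q_def by blast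
  qed
qed

lemma continuous_on_return:
  fixes g :: "((real ^ 'd::finite) \<times> ereal) measure \<Rightarrow> real"
  assumes "g \<in> C0_functions"
  shows "continuous_on E_set (\<lambda>p. g (return E_borel p))"
  unfolding continuous_on_topological
proof (intro ballI allI impI)
  fix p :: "(real ^ 'd) \<times> ereal" and B assume p: "p \<in> E_set" and B: "open B" "g (return E_borel p) \<in> B"
  define U where "U = {\<mu> \<in> topspace vague_topology. g \<mu> \<in> B}"
  have ret: "return E_borel q = dirac_sum E_borel {0::nat} (\<lambda>_. q)" if "q \<in> E_set" for q
    using return_eq_dirac_sum[of "\<lambda>_. q" 0] that by simp
  have "openin vague_topology U"
    unfolding U_def using assms B by (intro openin_continuous_map_preimage[where Y = euclideanreal]) (auto simp: C0_functions_def)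
  moreover have "return E_borel p \<in> U"
    using p B unfolding U_def topspace_vague_topology
    by (auto simp: ret intro!: dirac_sum_in_point_measures)
  ultimately obtain c' W where W: "open W" "p \<in> W"
    and Wd: "\<And>J y i. finite (J :: nat set) \<Longrightarrow> y \<in> J \<rightarrow> E_set \<Longrightarrow> i \<in> J \<Longrightarrow> y i \<in> W \<Longrightarrow>
      \<forall>j\<in>J - {i}. snd (y j) \<le> ereal c' \<Longrightarrow> dirac_sum E_borel J y \<in> U"
    using p by (elim vague_nbhd_single[of U p]) auto
  have "g (return E_borel q) \<in> B" if "q \<in> E_set" "q \<in> W" for q
  proof -
    have "dirac_sum E_borel {0::nat} (\<lambda>_. q) \<in> U"
      by (rule Wd[of "{0}" "\<lambda>_. q" 0]) (use that in auto)
    then show ?thesis by (auto simp: U_def ret[OF that(1)])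
  qed
  then show "\<exists>A. open A \<and> p \<in> A \<and> (\<forall>y\<in>E_set. y \<in> A \<longrightarrow> g (return E_borel y) \<in> B)"
    using W by blast
qed

section \<open>Step functions and reduction to single points\<close>

text \<open>
  The coordinate \<open>exp (- u)\<close> on \<open>(-\<infinity>, \<infinity>]\<close> and its inverse. It maps the top score \<open>\<infinity>\<close> to \<open>0\<close>.
\<close>

definition exp_neg :: "ereal \<Rightarrow> real" where
  "exp_neg u = (if u = \<infinity> then 0 else exp (- real_of_ereal u))"

definition neg_ln :: "real \<Rightarrow> ereal" where
  "neg_ln v = (if v = 0 then \<infinity> else ereal (- ln v))"

lemma exp_neg_ereal [simp]: "exp_neg (ereal u) = exp (- u)"
  by (simp add: exp_neg_def)

lemma exp_neg_nonneg: "0 \<le> exp_neg u"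
  by (simp add: exp_neg_def)

lemma measurable_exp_neg [measurable]: "exp_neg \<in> borel_measurable borel"
  unfolding exp_neg_def by measurable

lemma neg_ln_exp_neg: "-\<infinity> < u \<Longrightarrow> neg_ln (exp_neg u) = u"
  by (cases u) (auto simp: exp_neg_def neg_ln_def)

lemma exp_neg_less_iff: "-\<infinity> < u \<Longrightarrow> exp_neg u < exp (- s) \<longleftrightarrow> ereal s < u"
  by (cases u) (auto simp: exp_neg_def)

lemma neg_ln_gt_MInf: "0 \<le> v \<Longrightarrow> -\<infinity> < neg_ln v"
  by (simp add: neg_ln_def)

lemma measurable_neg_ln [measurable]: "neg_ln \<in> borel_measurable borel"
  unfolding neg_ln_def by measurable

lemma continuous_on_neg_ln: "continuous_on {0..} neg_ln"
  unfolding continuous_on_def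
proof
  fix v :: real assume v: "v \<in> {0..}"
  show "(neg_ln \<longlongrightarrow> neg_ln v) (at v within {0..})"
  proof (cases "v = 0")
    case True
    have "eventually (\<lambda>x. ereal r < neg_ln x) (at 0 within {0..})" for r
      unfolding eventually_at
    proof (intro exI[of _ "exp (- r)"] conjI ballI impI)
      fix x :: real assume x: "x \<in> {0..}" "x \<noteq> 0 \<and> dist x 0 < exp (- r)"
      then have "ln x < ln (exp (- r))" by (subst ln_less_cancel_iff) auto
      then show "ereal r < neg_ln x" using x by (simp add: neg_ln_def)
    qed simp
    then have "(neg_ln \<longlongrightarrow> \<infinity>) (at 0 within {0..})"
      by (simp add: tendsto_PInfty)
    then show ?thesis using True by (simp add: neg_ln_def)
  next
    case False
    then have "0 < v" using v by simp
    have "((\<lambda>x. ereal (- ln x)) \<longlongrightarrow> ereal (- ln v)) (at v within {0..})"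
      using \<open>0 < v\<close> by (intro tendsto_intros) auto
    moreover have "eventually (\<lambda>x. ereal (- ln x) = neg_ln x) (at v within {0..})"
      unfolding eventually_at
      by (intro exI[of _ v]) (use \<open>0 < v\<close> in \<open>auto simp: neg_ln_def dist_real_def\<close>)
    ultimately have "(neg_ln \<longlongrightarrow> ereal (- ln v)) (at v within {0..})"
      by (rule Lim_transform_eventually)
    then show ?thesis using False by (simp add: neg_ln_def)
  qed
qed

text \<open>
  Uniform continuity on the compact product gives one partition of \<open>[0, V)\<close> that serves for all \<open>x\<close>. The
  step function is written with differences of tail indicators, as only the
  tails \<open>v < t\<close> have computable expectations.
\<close>

lemma step_approximation:
  fixes H :: "'a::metric_space \<times> real \<Rightarrow> real"
  assumes "compact C" and cont: "continuous_on (C \<times> {0..V}) H" and "0 < V" "0 < \<epsilon>"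
  obtains N :: nat where "0 < N"
    "\<And>x v. x \<in> C \<Longrightarrow> 0 \<le> v \<Longrightarrow> v < V \<Longrightarrow>
      \<bar>H (x, v) - (\<Sum>j<N. H (x, real (Suc j) * V / real N) *
          (of_bool (v < real (Suc j) * V / real N) - of_bool (v < real j * V / real N)))\<bar> \<le> \<epsilon>"
proof -
  have "uniformly_continuous_on (C \<times> {0..V}) H"
    using assms(1) by (intro compact_uniformly_continuous cont compact_Times) auto
  then obtain \<delta> where \<delta>: "0 < \<delta>" "\<And>p q. p \<in> C \<times> {0..V} \<Longrightarrow> q \<in> C \<times> {0..V} \<Longrightarrow> dist q p < \<delta> \<Longrightarrow> dist (H q) (H p) < \<epsilon>"
    using \<open>0 < \<epsilon>\<close> unfolding uniformly_continuous_on_def by metis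
  obtain N :: nat where N: "V / \<delta> < real N" using reals_Archimedean2 by blast
  have "0 < V / \<delta>" using \<open>0 < V\<close> \<delta> by simp
  then have N0: "0 < real N" using N by simp
  have VN: "V / real N < \<delta>" using N N0 \<delta> by (simp add: field_simps)
  show ?thesis
  proof (rule that[of N])
    show "0 < N" using N0 by simp
    fix x v assume x: "x \<in> C" and v: "0 \<le> v" "v < V"
    \<comment> \<open>The cell of the partition that contains \<open>v\<close>.\<close>
    define j0 where "j0 = nat \<lfloor>v * real N / V\<rfloor>"
    have fl: "real j0 \<le> v * real N / V" "v * real N / V < real j0 + 1"
      using v N0 \<open>0 < V\<close> unfolding j0_def by (simp_all add: of_nat_nat floor_le_iff)
    have lt: "v < real m * V / real N \<longleftrightarrow> j0 < m" for m :: nat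
    proof -
      have "v < real m * V / real N \<longleftrightarrow> v * real N / V < real m"
        using N0 \<open>0 < V\<close> by (simp add: field_simps)
      also have "\<dots> \<longleftrightarrow> j0 < m" using fl by linarith
      finally show ?thesis .
    qed
    have "real j0 < real N"
      using fl(1) v N0 \<open>0 < V\<close> by (smt (verit) divide_less_eq mult.commute mult_less_cancel_left_pos)
    then have j0N: "j0 < N" by simp
    have "(\<Sum>j<N. H (x, real (Suc j) * V / real N) *
          (of_bool (v < real (Suc j) * V / real N) - of_bool (v < real j * V / real N))) =
        (\<Sum>j<N. if j = j0 then H (x, real (Suc j) * V / real N) else 0)"
      unfolding lt by (intro sum.cong) auto
    also have "\<dots> = H (x, real (Suc j0) * V / real N)"
      using j0N by (subst sum.delta) auto
    finally have eq: "(\<Sum>j<N. H (x, real (Suc j) * V / real N) *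
          (of_bool (v < real (Suc j) * V / real N) - of_bool (v < real j * V / real N))) =
        H (x, real (Suc j0) * V / real N)" .
    have "dist (H (x, v)) (H (x, real (Suc j0) * V / real N)) < \<epsilon>"
    proof (rule \<delta>(2))
      have "real (Suc j0) * V / real N \<le> V"
        using j0N N0 \<open>0 < V\<close> by (simp add: field_simps del: of_nat_Suc)
      then show "(x, real (Suc j0) * V / real N) \<in> C \<times> {0..V}"
        using x \<open>0 < V\<close> N0 by auto
      show "(x, v) \<in> C \<times> {0..V}" using x v by auto
      have "real j0 * V / real N \<le> v" "v < real (Suc j0) * V / real N"
        using lt[of j0] lt[of "Suc j0"] by auto
      moreover have "real (Suc j0) * V / real N - real j0 * V / real N = V / real N"
        by (simp add: distrib_right add_divide_distrib)
      ultimately show "dist (x, v) (x, real (Suc j0) * V / real N) < \<delta>"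
        using VN by (simp add: dist_Pair_Pair dist_real_def)
    qed
    then show "\<bar>H (x, v) - (\<Sum>j<N. H (x, real (Suc j) * V / real N) *
          (of_bool (v < real (Suc j) * V / real N) - of_bool (v < real j * V / real N)))\<bar> \<le> \<epsilon>"
      unfolding eq by (simp add: dist_real_def)
  qed
qed

text \<open>
  Under the product formula for the tails, the integral of \<open>G\<close> is determined, up to the error of
  the step approximation, by the numbers \<open>F j\<close> alone. The lemma is applied both to the sample and
  to the limit measure, where only these numbers differ.
\<close>

lemma integral_step_approximation:
  fixes \<Omega> :: "'w measure" and G :: "real ^ 'd::finite \<Rightarrow> real \<Rightarrow> real" and t :: "nat \<Rightarrow> real"
  assumes [measurable]: "X \<in> borel_measurable \<Omega>" "v \<in> borel_measurable \<Omega>"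
    and [measurable]: "(\<lambda>p. G (fst p) (snd p)) \<in> borel_measurable (borel \<Otimes>\<^sub>M borel)"
    and bdd: "\<And>x v. \<bar>G x v\<bar> \<le> B"
    and int: "integrable \<Omega> (\<lambda>w. of_bool (v w < V) :: real)"
    and v: "\<And>w. w \<in> space \<Omega> \<Longrightarrow> 0 \<le> v w"
    and t: "\<And>j. j \<le> N \<Longrightarrow> t j \<le> V" "t N = V"
    and step: "\<And>x v. 0 \<le> v \<Longrightarrow> v < V \<Longrightarrow>
      \<bar>G x v - (\<Sum>j<N. G x (t (Suc j)) * (of_bool (v < t (Suc j)) - of_bool (v < t j)))\<bar> \<le> \<epsilon>"
    and tensor: "\<And>\<phi> j. j \<le> N \<Longrightarrow> \<phi> \<in> borel_measurable borel \<Longrightarrow> (\<exists>B. \<forall>x. \<bar>\<phi> x\<bar> \<le> B) \<Longrightarrow>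
      (\<integral>w. \<phi> (X w) * of_bool (v w < t j) \<partial>\<Omega>) = (\<integral>x. \<phi> x \<partial>cube_law) * F j"
  shows "\<bar>(\<integral>w. G (X w) (v w) * of_bool (v w < V) \<partial>\<Omega>) -
           (\<Sum>j<N. (\<integral>x. G x (t (Suc j)) \<partial>cube_law) * (F (Suc j) - F j))\<bar> \<le> \<epsilon> * F N"
proof -
  interpret C: prob_space "cube_law :: (real ^ 'd) measure" by (rule prob_space_cube_law)
  have Gm: "(\<lambda>x. G x s) \<in> borel_measurable borel" for s
    using measurable_compose[OF measurable_Pair[OF measurable_ident_sets[OF refl] measurable_const[of s]] assms(3)] by simp
  have int_term: "integrable \<Omega> (\<lambda>w. G (X w) s * of_bool (v w < t j))" if "j \<le> N" for s j
  proof (rule Bochner_Integration.integrable_bound[OF integrable_mult_right[OF int, of B]])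
    show "(\<lambda>w. G (X w) s * of_bool (v w < t j)) \<in> borel_measurable \<Omega>"
      using measurable_compose[OF assms(1) Gm[of s]] by measurable
    show "AE w in \<Omega>. norm (G (X w) s * of_bool (v w < t j)) \<le> norm (B * of_bool (v w < V))"
      using t(1)[OF that] bdd[THEN order_trans, OF abs_ge_self] by (auto simp: abs_mult)
  qed
  have int_G: "integrable \<Omega> (\<lambda>w. G (X w) (v w) * of_bool (v w < V))"
  proof (rule Bochner_Integration.integrable_bound[OF integrable_mult_right[OF int, of B]])
    show "(\<lambda>w. G (X w) (v w) * of_bool (v w < V)) \<in> borel_measurable \<Omega>"
      using borel_measurable_times[OF measurable_compose[OF measurable_Pair[OF assms(1,2)] assms(3)]
        borel_measurable_integrable[OF int]] by simp
    show "AE w in \<Omega>. norm (G (X w) (v w) * of_bool (v w < V)) \<le> norm (B * of_bool (v w < V))"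
      using bdd[THEN order_trans, OF abs_ge_self] by (auto simp: abs_mult)
  qed
  define S where "S = (\<lambda>w. \<Sum>j<N. G (X w) (t (Suc j)) * of_bool (v w < t (Suc j)) - G (X w) (t (Suc j)) * of_bool (v w < t j))"
  have int_S: "integrable \<Omega> S"
    unfolding S_def by (intro Bochner_Integration.integrable_sum Bochner_Integration.integrable_diff int_term) auto
  have "(\<integral>w. S w \<partial>\<Omega>) = (\<Sum>j<N. (\<integral>x. G x (t (Suc j)) \<partial>cube_law) * F (Suc j) - (\<integral>x. G x (t (Suc j)) \<partial>cube_law) * F j)"
    unfolding S_def
  proof (subst Bochner_Integration.integral_sum)
    show "(\<Sum>j<N. \<integral>w. G (X w) (t (Suc j)) * of_bool (v w < t (Suc j)) - G (X w) (t (Suc j)) * of_bool (v w < t j) \<partial>\<Omega>) =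
      (\<Sum>j<N. (\<integral>x. G x (t (Suc j)) \<partial>cube_law) * F (Suc j) - (\<integral>x. G x (t (Suc j)) \<partial>cube_law) * F j)"
    proof (rule sum.cong[OF refl])
      fix j assume "j \<in> {..<N}"
      then have j: "Suc j \<le> N" "j \<le> N" by auto
      have bd: "\<exists>B. \<forall>x. \<bar>G x (t (Suc j))\<bar> \<le> B" using bdd by blast
      show "(\<integral>w. G (X w) (t (Suc j)) * of_bool (v w < t (Suc j)) - G (X w) (t (Suc j)) * of_bool (v w < t j) \<partial>\<Omega>) =
        (\<integral>x. G x (t (Suc j)) \<partial>cube_law) * F (Suc j) - (\<integral>x. G x (t (Suc j)) \<partial>cube_law) * F j"
        using tensor[OF j(1) Gm bd] tensor[OF j(2) Gm bd]
        by (subst Bochner_Integration.integral_diff[OF int_term[OF j(1)] int_term[OF j(2)]]) simp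
    qed
  qed (auto intro!: Bochner_Integration.integrable_diff int_term)
  then have intS: "(\<integral>w. S w \<partial>\<Omega>) = (\<Sum>j<N. (\<integral>x. G x (t (Suc j)) \<partial>cube_law) * (F (Suc j) - F j))"
    by (simp add: right_diff_distrib)
  have "\<bar>(\<integral>w. G (X w) (v w) * of_bool (v w < V) \<partial>\<Omega>) - (\<integral>w. S w \<partial>\<Omega>)\<bar> =
      \<bar>\<integral>w. G (X w) (v w) * of_bool (v w < V) - S w \<partial>\<Omega>\<bar>"
    by (subst Bochner_Integration.integral_diff[OF int_G int_S]) simp
  also have "\<dots> \<le> (\<integral>w. \<bar>G (X w) (v w) * of_bool (v w < V) - S w\<bar> \<partial>\<Omega>)"
    by (rule integral_abs_bound)
  also have "\<dots> \<le> (\<integral>w. \<epsilon> * of_bool (v w < V) \<partial>\<Omega>)"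
  proof (rule integral_mono)
    fix w assume w: "w \<in> space \<Omega>"
    show "\<bar>G (X w) (v w) * of_bool (v w < V) - S w\<bar> \<le> \<epsilon> * of_bool (v w < V)"
    proof (cases "v w < V")
      case True
      then show ?thesis using step[OF v[OF w] True, of "X w"] by (simp add: S_def right_diff_distrib)
    next
      case False
      have "\<not> v w < t j" if "j \<le> N" for j using t(1)[OF that] False by simp
      then have "S w = 0" unfolding S_def by (intro sum.neutral) auto
      then show ?thesis using False by simp
    qed
  qed (use int_G int_S int in auto)
  also have "\<dots> = \<epsilon> * (\<integral>w. (\<lambda>_. 1) (X w) * of_bool (v w < t N) \<partial>\<Omega>)"
    by (simp add: t(2))
  also have "\<dots> = \<epsilon> * F N"
    by (subst tensor) (use C.prob_space in \<open>auto intro!: exI[of _ 1]\<close>)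
  finally show ?thesis unfolding intS .
qed

lemma C0_bounded:
  assumes "g \<in> C0_functions"
  obtains B where "0 < B" "\<And>\<mu>. \<mu> \<in> point_measures \<Longrightarrow> \<bar>g \<mu>\<bar> \<le> B"
proof -
  have "bounded (g ` point_measures)" using assms by (simp add: C0_functions_def)
  then obtain B where "0 < B" "\<forall>x\<in>g ` point_measures. norm x \<le> B"
    by (auto simp: bounded_pos)
  then show ?thesis using that by auto
qed

lemma return_in_point_measures: "p \<in> E_set \<Longrightarrow> return E_borel p \<in> point_measures"
  using return_eq_dirac_sum[of "\<lambda>_. p" 0] dirac_sum_in_point_measures[of "{0}" "\<lambda>_. p"] by simp

text \<open>
  The left-hand side is \<open>0\<close> if all scores are at most \<open>c\<close>. If one score exceeds \<open>c\<close> and no other exceeds \<open>c'\<close>,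
  the single point approximation applies. If at least two scores exceed \<open>c'\<close>, the left-hand side is at most \<open>B\<close> times one plus the
  number of exceedances, and both are bounded by the number of ordered pairs of exceedances of \<open>c'\<close>.
\<close>

lemma functional_vs_single_points:
  fixes g :: "((real ^ 'd::finite) \<times> ereal) measure \<Rightarrow> real" and J :: "nat set"
  assumes J: "finite J" "y \<in> J \<rightarrow> E_set" and "c' \<le> c" "0 \<le> \<epsilon>"
    and B: "\<And>\<mu>. \<mu> \<in> point_measures \<Longrightarrow> \<bar>g \<mu>\<bar> \<le> B"
    and vanish: "\<And>J y. finite (J :: nat set) \<Longrightarrow> y \<in> J \<rightarrow> E_set \<Longrightarrow>
      (\<And>j. j \<in> J \<Longrightarrow> snd (y j) \<le> ereal c) \<Longrightarrow> g (dirac_sum E_borel J y) = 0"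
    and approx: "\<And>J y i. finite (J :: nat set) \<Longrightarrow> y \<in> J \<rightarrow> E_set \<Longrightarrow> i \<in> J \<Longrightarrow> ereal c \<le> snd (y i) \<Longrightarrow>
      (\<And>j. j \<in> J - {i} \<Longrightarrow> snd (y j) \<le> ereal c') \<Longrightarrow>
      \<bar>g (dirac_sum E_borel J y) - g (return E_borel (y i))\<bar> < \<epsilon>"
  shows "\<bar>g (dirac_sum E_borel J y) - (\<Sum>i\<in>J. g (return E_borel (y i)))\<bar> \<le>
    \<epsilon> * (\<Sum>i\<in>J. of_bool (ereal c < snd (y i))) +
    2 * B * (\<Sum>i\<in>J. \<Sum>j\<in>J - {i}. of_bool (ereal c' < snd (y i) \<and> ereal c' < snd (y j)))"
proof -
  define A where "A = {i \<in> J. ereal c' < snd (y i)}"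
  define Z where "Z = (\<Sum>i\<in>J. \<Sum>j\<in>J - {i}. of_bool (ereal c' < snd (y i) \<and> ereal c' < snd (y j)) :: real)"
  have A: "finite A" "A \<subseteq> J" using J by (auto simp: A_def)
  have B0: "0 \<le> B" using B[OF dirac_sum_in_point_measures[OF J]] by (meson abs_ge_zero order_trans)
  have Z0: "0 \<le> Z" unfolding Z_def by (intro sum_nonneg) auto
  have S0: "0 \<le> (\<Sum>i\<in>J. of_bool (ereal c < snd (y i)) :: real)" by (intro sum_nonneg) auto
  have cc: "ereal c' < u" if "ereal c < u" for u
    using that \<open>c' \<le> c\<close> by (meson ereal_less_eq(3) le_less_trans)
  have h0: "g (return E_borel (y i)) = 0" if "i \<in> J" "\<not> ereal c < snd (y i)" for i
  proof -
    have "return E_borel (y i) = dirac_sum E_borel {i} y"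
      using J that by (intro return_eq_dirac_sum) auto
    also have "g \<dots> = 0" by (rule vanish) (use J that in auto)
    finally show ?thesis .
  qed
  have hB: "\<bar>g (return E_borel (y i))\<bar> \<le> B" if "i \<in> J" for i
    using J that by (intro B return_in_point_measures) auto
  have sumA: "(\<Sum>i\<in>J. g (return E_borel (y i))) = (\<Sum>i\<in>A. g (return E_borel (y i)))"
    using J cc h0 by (intro sum.mono_neutral_right) (auto simp: A_def)
  show ?thesis
  proof (cases "\<exists>i\<in>A. \<exists>j\<in>A. i \<noteq> j")
    case True
    have "card A \<le> Z" "1 \<le> Z"
    proof -
      have partner: "\<exists>j\<in>A. i \<noteq> j" if "i \<in> A" for i
        using True that by metis
      have "real (card A) = (\<Sum>i\<in>A. 1)" by simp
      also have "\<dots> \<le> (\<Sum>i\<in>A. \<Sum>j\<in>J - {i}. of_bool (ereal c' < snd (y i) \<and> ereal c' < snd (y j)))"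
      proof (rule sum_mono)
        fix i assume i: "i \<in> A"
        obtain j where j: "j \<in> A" "i \<noteq> j" using partner[OF i] by blast
        have "1 = (of_bool (ereal c' < snd (y i) \<and> ereal c' < snd (y j)) :: real)"
          using i j by (simp add: A_def)
        also have "\<dots> \<le> (\<Sum>j\<in>J - {i}. of_bool (ereal c' < snd (y i) \<and> ereal c' < snd (y j)))"
          by (rule member_le_sum) (use J j A in auto)
        finally show "1 \<le> (\<Sum>j\<in>J - {i}. of_bool (ereal c' < snd (y i) \<and> ereal c' < snd (y j)) :: real)" .
      qed
      also have "\<dots> \<le> Z"
        unfolding Z_def using J A by (intro sum_mono2 sum_nonneg) auto
      finally show "card A \<le> Z" .
      moreover have "1 \<le> card A" using True A by (auto simp: Suc_le_eq card_gt_0_iff)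
      ultimately show "1 \<le> Z" by linarith
    qed
    have "\<bar>g (dirac_sum E_borel J y)\<bar> \<le> B * Z"
      using B[OF dirac_sum_in_point_measures[OF J]] mult_left_mono[OF \<open>1 \<le> Z\<close> B0] by simp
    moreover have "\<bar>\<Sum>i\<in>A. g (return E_borel (y i))\<bar> \<le> B * Z"
    proof -
      have "\<bar>\<Sum>i\<in>A. g (return E_borel (y i))\<bar> \<le> (\<Sum>i\<in>A. \<bar>g (return E_borel (y i))\<bar>)" by (rule sum_abs)
      also have "\<dots> \<le> (\<Sum>i\<in>A. B)" using hB A by (intro sum_mono) auto
      also have "\<dots> = B * real (card A)" by simp
      also have "\<dots> \<le> B * Z" using \<open>card A \<le> Z\<close> B0 by (intro mult_left_mono) auto
      finally show ?thesis .
    qed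
    ultimately have "\<bar>g (dirac_sum E_borel J y) - (\<Sum>i\<in>J. g (return E_borel (y i)))\<bar> \<le> 2 * B * Z"
      unfolding sumA by linarith
    then show ?thesis using S0 \<open>0 \<le> \<epsilon>\<close> unfolding Z_def by (simp add: add_increasing)
  next
    case False
    have main: "\<bar>g (dirac_sum E_borel J y) - (\<Sum>i\<in>J. g (return E_borel (y i)))\<bar> \<le>
      \<epsilon> * (\<Sum>i\<in>J. of_bool (ereal c < snd (y i)))"
    proof (cases "\<exists>i\<in>J. ereal c < snd (y i)")
      case True
      then obtain i where i: "i \<in> J" "ereal c < snd (y i)" by blast
      then have iA: "i \<in> A" using cc by (simp add: A_def)
      have Ai: "A = {i}" using False iA by auto
      have "\<bar>g (dirac_sum E_borel J y) - g (return E_borel (y i))\<bar> < \<epsilon>"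
      proof (rule approx[OF J i(1)])
        show "snd (y j) \<le> ereal c'" if "j \<in> J - {i}" for j
          using that Ai by (auto simp: A_def not_less[symmetric])
      qed (use i in auto)
      moreover have "1 \<le> (\<Sum>i\<in>J. of_bool (ereal c < snd (y i)) :: real)"
      proof -
        have "1 = (of_bool (ereal c < snd (y i)) :: real)" using i by simp
        also have "\<dots> \<le> (\<Sum>i\<in>J. of_bool (ereal c < snd (y i)))"
          by (rule member_le_sum) (use J i in auto)
        finally show ?thesis .
      qed
      then have "\<epsilon> * 1 \<le> \<epsilon> * (\<Sum>i\<in>J. of_bool (ereal c < snd (y i)))"
        using \<open>0 \<le> \<epsilon>\<close> by (rule mult_left_mono)
      ultimately show ?thesis unfolding sumA Ai by simp
    next
      case False
      have "g (dirac_sum E_borel J y) = 0"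
        by (rule vanish[OF J]) (use False in \<open>auto simp: not_less\<close>)
      moreover have "(\<Sum>i\<in>J. g (return E_borel (y i))) = 0"
        using h0 False by (intro sum.neutral) auto
      ultimately show ?thesis using S0 \<open>0 \<le> \<epsilon>\<close> by simp
    qed
    then show ?thesis using B0 Z0 unfolding Z_def by (simp add: add_increasing2)
  qed
qed

section \<open>The limit measure\<close>

definition exp_measure :: "real measure" where
  "exp_measure = density lborel (\<lambda>u. ennreal (exp (- u)))"

text \<open>
  The intensity \<open>e\<^sup>-\<^sup>u dx du\<close> in the definition of the limit, as a product measure on the whole space so
  that Fubini applies.
\<close>

definition limit_intensity :: "((real ^ 'd::finite) \<times> real) measure" where
  "limit_intensity = cube_law \<Otimes>\<^sub>M exp_measure"

lemma sets_exp_measure [simp, measurable_cong]: "sets exp_measure = sets borel"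
  and space_exp_measure [simp]: "space exp_measure = UNIV"
  by (simp_all add: exp_measure_def)

lemma emeasure_exp_measure_greaterThan: "emeasure exp_measure {s<..} = ennreal (exp (- s))"
proof -
  have "emeasure exp_measure {s<..} = (\<integral>\<^sup>+u. ennreal (exp (- u)) * indicator {s<..} u \<partial>lborel)"
    unfolding exp_measure_def by (rule emeasure_density) auto
  also have "\<dots> = (\<integral>\<^sup>+u. ennreal (exp (- u)) * indicator {s..} u \<partial>lborel)"
  proof (rule nn_integral_cong_AE)
    have "AE u in lborel. u \<notin> {s}" by (rule AE_not_in) (simp add: null_sets_def)
    then show "AE u in lborel. ennreal (exp (- u)) * indicator {s<..} u = ennreal (exp (- u)) * indicator {s..} u"
      by eventually_elim (auto simp: indicator_def)
  qed
  also have "\<dots> = ennreal (0 - (- exp (- s)))"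
  proof (rule nn_integral_FTC_atLeast)
    show "((\<lambda>u. - exp (- u)) has_real_derivative exp (- x)) (at x)" for x :: real
      by (auto intro!: derivative_eq_intros)
    have "((\<lambda>u::real. - exp (- u)) \<longlongrightarrow> - 0) at_top"
      by (intro tendsto_minus filterlim_compose[OF exp_at_bot filterlim_uminus_at_bot_at_top])
    then show "((\<lambda>u::real. - exp (- u)) \<longlongrightarrow> 0) at_top" by simp
  qed auto
  finally show ?thesis by simp
qed

lemma sigma_finite_exp_measure: "sigma_finite_measure exp_measure"
  unfolding exp_measure_def
  by (subst sigma_finite_measure.sigma_finite_iff_density_finite[OF lborel.sigma_finite_measure_axioms]) auto

text \<open>
  The limit law is defined by a density on the strip over the cube; extended to the whole space it is
  the product measure.
\<close>

lemma limit_intensity_eq_distr: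
  "limit_intensity =
     distr (density (restrict_space lborel (unit_cube \<times> UNIV)) (\<lambda>(x, u :: real). ennreal (exp (- u))))
       borel (\<lambda>p :: (real ^ 'd::finite) \<times> real. p)"
proof -
  let ?S = "(unit_cube :: (real ^ 'd) set) \<times> (UNIV :: real set)"
  let ?e = "\<lambda>(x :: real ^ 'd, u :: real). ennreal (exp (- u))"
  have S: "?S \<in> sets borel"
    unfolding borel_prod[symmetric] by (intro pair_measureI) (auto intro: sets_unit_cube)
  have e[measurable]: "?e \<in> borel_measurable borel"
    unfolding borel_prod[symmetric] by measurable
  have law: "cube_law = density lborel (indicator (unit_cube :: (real ^ 'd) set))"
    by (simp add: cube_law_def uniform_measure_def emeasure_unit_cube divide_ennreal_def)
  have "limit_intensity = density (lborel \<Otimes>\<^sub>M lborel) (\<lambda>(x :: real ^ 'd, u). indicator unit_cube x * ennreal (exp (- u)))"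
    unfolding limit_intensity_def law exp_measure_def
    by (rule pair_measure_density)
       (use sigma_finite_exp_measure in \<open>auto simp: exp_measure_def intro: lborel.sigma_finite_measure_axioms\<close>)
  also have "\<dots> = density lborel (\<lambda>(x :: real ^ 'd, u :: real). indicator unit_cube x * ennreal (exp (- u)))"
    by (simp add: lborel_prod)
  also have "\<dots> = distr (density (restrict_space lborel ?S) ?e) borel (\<lambda>p. p)"
  proof (rule measure_eqI)
    fix A assume "A \<in> sets (density lborel (\<lambda>(x :: real ^ 'd, u :: real). indicator unit_cube x * ennreal (exp (- u))))"
    then have A[measurable]: "A \<in> sets borel" by simp
    have m: "(\<lambda>p :: (real ^ 'd) \<times> real. p) \<in> measurable (restrict_space lborel ?S) borel"
      by (intro measurable_restrict_space1) simp
    have AS: "A \<inter> ?S \<in> sets (restrict_space lborel ?S)"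
      using S by (subst sets_restrict_space_iff) auto
    have "emeasure (distr (density (restrict_space lborel ?S) ?e) borel (\<lambda>p. p)) A =
        emeasure (density (restrict_space lborel ?S) ?e) (A \<inter> ?S)"
      using m by (subst emeasure_distr) (auto simp: space_restrict_space)
    also have "\<dots> = (\<integral>\<^sup>+p. ?e p * indicator (A \<inter> ?S) p \<partial>restrict_space lborel ?S)"
      using AS by (intro emeasure_density measurable_restrict_space1) auto
    also have "\<dots> = (\<integral>\<^sup>+p. ?e p * indicator (A \<inter> ?S) p * indicator ?S p \<partial>lborel)"
      using S by (intro nn_integral_restrict_space) auto
    also have "\<dots> = (\<integral>\<^sup>+p. (\<lambda>(x, u). indicator unit_cube x * ennreal (exp (- u))) p * indicator A p \<partial>lborel)"
      by (intro nn_integral_cong) (auto simp: indicator_def)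
    also have "\<dots> = emeasure (density lborel (\<lambda>(x :: real ^ 'd, u :: real). indicator unit_cube x * ennreal (exp (- u)))) A"
    proof (rule emeasure_density[symmetric])
      show "(\<lambda>(x :: real ^ 'd, u :: real). indicator unit_cube x * ennreal (exp (- u))) \<in> borel_measurable lborel"
      proof -
        have "(\<lambda>(x :: real ^ 'd, u :: real). indicator unit_cube x * ennreal (exp (- u))) \<in> borel_measurable (borel \<Otimes>\<^sub>M borel)"
          by measurable
        then show ?thesis unfolding borel_prod by simp
      qed
    qed (use A in simp)
    finally show "emeasure (density lborel (\<lambda>(x :: real ^ 'd, u :: real). indicator unit_cube x * ennreal (exp (- u)))) A =
      emeasure (distr (density (restrict_space lborel ?S) ?e) borel (\<lambda>p. p)) A" by simp
  qed simp
  finally show ?thesis .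
qed

lemma sets_limit_intensity [simp, measurable_cong]:
  "sets (limit_intensity :: ((real ^ 'd::finite) \<times> real) measure) = sets borel"
  by (simp add: limit_intensity_eq_distr)

text \<open>
  The measure \<open>e\<^sup>-\<^sup>u du\<close> of \<open>{u. exp (- u) < t}\<close> is \<open>t\<close>: in the coordinate \<open>exp (- u)\<close> it is
  Lebesgue measure.
\<close>

lemma integral_limit_intensity_tensor:
  fixes \<phi> :: "real ^ 'd::finite \<Rightarrow> real"
  assumes [measurable]: "\<phi> \<in> borel_measurable borel" and bdd: "\<And>x. \<bar>\<phi> x\<bar> \<le> B" and "0 \<le> t"
  shows "(\<integral>p. \<phi> (fst p) * of_bool (exp (- snd p) < t) \<partial>limit_intensity) = (\<integral>x. \<phi> x \<partial>cube_law) * t"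
proof -
  interpret C: prob_space "cube_law :: (real ^ 'd) measure" by (rule prob_space_cube_law)
  interpret E: sigma_finite_measure exp_measure by (rule sigma_finite_exp_measure)
  interpret P: pair_sigma_finite "cube_law :: (real ^ 'd) measure" exp_measure ..
  have em: "emeasure exp_measure {u. exp (- u) < t} = ennreal t"
  proof (cases "t = 0")
    case False
    have "exp (- u) < t \<longleftrightarrow> - ln t < u" for u
    proof -
      have "exp (- u) < t \<longleftrightarrow> exp (- u) < exp (ln t)" using False \<open>0 \<le> t\<close> by simp
      also have "\<dots> \<longleftrightarrow> - ln t < u" unfolding exp_less_cancel_iff by auto
      finally show ?thesis .
    qed
    then have "{u. exp (- u) < t} = {- ln t<..}" by auto
    then show ?thesis using emeasure_exp_measure_greaterThan[of "- ln t"] False \<open>0 \<le> t\<close> by simp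
  qed (auto simp: not_less)
  have ind_set: "{u. exp (- u) < t} \<in> sets exp_measure" by simp
  have int_ind: "integrable exp_measure (\<lambda>u. of_bool (exp (- u) < t) :: real)"
    and val: "(\<integral>u. of_bool (exp (- u) < t) \<partial>exp_measure) = t"
  proof -
    have eq: "(\<lambda>u. of_bool (exp (- u) < t) :: real) = indicator {u. exp (- u) < t}"
      by (auto simp: indicator_def)
    show "integrable exp_measure (\<lambda>u. of_bool (exp (- u) < t) :: real)"
      unfolding eq using ind_set em by (intro integrable_real_indicator) (auto simp: less_top[symmetric])
    show "(\<integral>u. of_bool (exp (- u) < t) \<partial>exp_measure) = t"
      unfolding eq using ind_set em \<open>0 \<le> t\<close> by (simp add: measure_def)
  qed
  have int: "integrable (cube_law \<Otimes>\<^sub>M exp_measure) (\<lambda>(x, u). \<phi> x * of_bool (exp (- u) < t))"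
  proof (rule P.Fubini_integrable)
    show "(\<lambda>(x, u). \<phi> x * of_bool (exp (- u) < t)) \<in> borel_measurable (cube_law \<Otimes>\<^sub>M exp_measure)"
      by measurable
    have n: "(\<integral>u. norm ((\<lambda>(x, u). \<phi> x * of_bool (exp (- u) < t)) (x, u)) \<partial>exp_measure) = \<bar>\<phi> x\<bar> * t" for x
      by (simp add: abs_mult val)
    show "integrable cube_law (\<lambda>x. \<integral>u. norm ((\<lambda>(x, u). \<phi> x * of_bool (exp (- u) < t)) (x, u)) \<partial>exp_measure)"
      unfolding n by (rule C.integrable_const_bound[where B = "B * t"])
        (use bdd \<open>0 \<le> t\<close> in \<open>auto simp: abs_mult intro!: mult_right_mono\<close>)
    show "AE x in cube_law. integrable exp_measure (\<lambda>u. (\<lambda>(x, u). \<phi> x * of_bool (exp (- u) < t)) (x, u))"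
      using int_ind by simp
  qed
  have "(\<integral>p. \<phi> (fst p) * of_bool (exp (- snd p) < t) \<partial>limit_intensity) =
      (\<integral>p. (\<lambda>(x, u). \<phi> x * of_bool (exp (- u) < t)) p \<partial>(cube_law \<Otimes>\<^sub>M exp_measure))"
    by (simp add: limit_intensity_def case_prod_unfold)
  also have "\<dots> = (\<integral>x. \<integral>u. \<phi> x * of_bool (exp (- u) < t) \<partial>exp_measure \<partial>cube_law)"
    using P.integral_fst'[OF int] by simp
  also have "\<dots> = (\<integral>x. \<phi> x \<partial>cube_law) * t"
    by (simp add: val)
  finally show ?thesis .
qed

lemma integrable_limit_intensity_tail:
  "integrable (limit_intensity :: ((real ^ 'd::finite) \<times> real) measure) (\<lambda>p. of_bool (exp (- snd p) < V) :: real)"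
  and emeasure_limit_intensity_tail:
  "emeasure (limit_intensity :: ((real ^ 'd::finite) \<times> real) measure) {p. s < snd p} = ennreal (exp (- s))"
proof -
  interpret C: prob_space "cube_law :: (real ^ 'd) measure" by (rule prob_space_cube_law)
  interpret E: sigma_finite_measure exp_measure by (rule sigma_finite_exp_measure)
  have tail: "emeasure (limit_intensity :: ((real ^ 'd) \<times> real) measure) {p. s < snd p} = ennreal (exp (- s))" for s
  proof -
    have "{p :: (real ^ 'd) \<times> real. s < snd p} = UNIV \<times> {s<..}" by auto
    then show ?thesis
      unfolding limit_intensity_def
      using E.emeasure_pair_measure_Times[of UNIV "cube_law :: (real ^ 'd) measure" "{s<..}"]
      by (simp add: emeasure_exp_measure_greaterThan C.emeasure_space_1[simplified])
  qed
  show "emeasure (limit_intensity :: ((real ^ 'd) \<times> real) measure) {p. s < snd p} = ennreal (exp (- s))"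
    by (rule tail)
  have meas: "{p :: (real ^ 'd) \<times> real. exp (- snd p) < V} \<in> sets borel"
    by (intro borel_open open_Collect_less continuous_intros)
  show "integrable (limit_intensity :: ((real ^ 'd) \<times> real) measure) (\<lambda>p. of_bool (exp (- snd p) < V) :: real)"
  proof (cases "0 < V")
    case True
    have iff: "exp (- u) < V \<longleftrightarrow> - ln V < u" for u
    proof -
      have "exp (- u) < V \<longleftrightarrow> exp (- u) < exp (ln V)" using True by simp
      also have "\<dots> \<longleftrightarrow> - ln V < u" unfolding exp_less_cancel_iff by auto
      finally show ?thesis .
    qed
    have "(\<lambda>p :: (real ^ 'd) \<times> real. of_bool (exp (- snd p) < V) :: real) = indicator {p. - ln V < snd p}"
      by (auto simp: indicator_def iff)
    moreover have "{p :: (real ^ 'd) \<times> real. - ln V < snd p} \<in> sets limit_intensity"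
      using meas by (simp add: iff)
    ultimately show ?thesis
      using tail[of "- ln V"] by (simp add: integrable_real_indicator less_top[symmetric])
  next
    case False
    then have "\<not> exp (- u) < V" for u by (meson exp_ge_zero le_less_trans)
    then show ?thesis by simp
  qed
qed

lemma scale_measure_eq_density: "scale_measure r M = density M (\<lambda>_. r)"
  by (rule measure_eqI) (auto simp: emeasure_density_const)

lemma integral_scale_measure:
  fixes f :: "'a \<Rightarrow> real"
  assumes "0 \<le> r" and f: "f \<in> borel_measurable M"
  shows "(\<integral>x. f x \<partial>scale_measure (ennreal r) M) = r * (\<integral>x. f x \<partial>M)"
  unfolding scale_measure_eq_density using assms
  by (subst integral_density) auto

lemma measurable_return_limit:
  "(\<lambda>(x :: real ^ 'd::finite, u). return E_borel (x, ereal u)) \<in>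
     measurable (density (restrict_space lborel (unit_cube \<times> UNIV)) (\<lambda>(x, u). ennreal (exp (- u)))) vague_borel"
proof -
  have [measurable]: "(\<lambda>p :: (real ^ 'd) \<times> real. (fst p, ereal (snd p))) \<in> borel_measurable borel"
    unfolding borel_prod[symmetric] by measurable
  have "(\<lambda>p :: (real ^ 'd) \<times> real. (fst p, ereal (snd p))) \<in> borel_measurable (restrict_space lborel (unit_cube \<times> UNIV))"
    by (rule measurable_restrict_space1) simp
  then have "(\<lambda>p :: (real ^ 'd) \<times> real. return E_borel (fst p, ereal (snd p))) \<in>
      measurable (density (restrict_space lborel (unit_cube \<times> UNIV)) (\<lambda>(x, u). ennreal (exp (- u)))) vague_borel"
    by (intro measurable_return_vague) (auto simp: space_restrict_space E_set_def)
  then show ?thesis by (simp add: case_prod_unfold)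
qed

lemma integral_xi_limit:
  fixes g :: "((real ^ 'd::finite) \<times> ereal) measure \<Rightarrow> real"
  assumes g: "g \<in> C0_functions"
    and F: "F \<in> borel_measurable borel"
    and eq: "\<And>x u. x \<in> unit_cube \<Longrightarrow> g (return E_borel (x, ereal u)) = F (x, u)"
  shows "(\<integral>\<mu>. g \<mu> \<partial>xi_limit k) = 1 / fact (k - 1) * (\<integral>p. F p \<partial>limit_intensity)"
proof -
  let ?N = "density (restrict_space lborel (unit_cube \<times> UNIV)) (\<lambda>(x :: real ^ 'd, u). ennreal (exp (- u)))"
  let ?r = "\<lambda>(x :: real ^ 'd, u). return E_borel (x, ereal u)"
  have "(\<integral>\<mu>. g \<mu> \<partial>xi_limit k) = 1 / fact (k - 1) * (\<integral>\<mu>. g \<mu> \<partial>distr ?N vague_borel ?r)"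
    unfolding xi_limit_def using C0_measurable[OF g] by (intro integral_scale_measure) auto
  also have "(\<integral>\<mu>. g \<mu> \<partial>distr ?N vague_borel ?r) = (\<integral>p. g (?r p) \<partial>?N)"
    by (rule integral_distr[OF measurable_return_limit C0_measurable[OF g]])
  also have "\<dots> = (\<integral>p. F p \<partial>?N)"
    by (rule Bochner_Integration.integral_cong) (auto simp: space_restrict_space eq)
  also have "\<dots> = (\<integral>p. F p \<partial>limit_intensity)"
    unfolding limit_intensity_eq_distr
    by (rule integral_distr[symmetric, OF _ F]) (simp add: measurable_restrict_space1)
  finally show ?thesis .
qed

lemma mball_null_contains:
  fixes \<rho> :: "((real ^ 'd::finite) \<times> ereal) measure \<Rightarrow> ((real ^ 'd) \<times> ereal) measure \<Rightarrow> real"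
  assumes \<rho>: "vague_metric \<rho>" and "0 < r"
  shows "openin vague_topology (Metric_space.mball point_measures \<rho> (null_measure E_borel) r)"
    and "null_measure E_borel \<in> Metric_space.mball point_measures \<rho> (null_measure E_borel) r"
proof -
  interpret Metric_space point_measures \<rho>
    using \<rho> by (simp add: vague_metric_def)
  have "null_measure E_borel \<in> (point_measures :: ((real ^ 'd) \<times> ereal) measure set)"
    unfolding null_measure_eq_dirac_sum[of undefined] by (rule dirac_sum_in_point_measures) auto
  then show "null_measure E_borel \<in> mball (null_measure E_borel) r"
    using \<open>0 < r\<close> by simp
  show "openin vague_topology (mball (null_measure E_borel) r)"
    using \<rho> openin_mball by (simp add: vague_metric_def)
qed

text \<open>
  The complement of a ball around the null measure only contains Dirac masses with score above
  some level, and there the intensity is finite.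
\<close>

lemma xi_limit_in_M0:
  fixes \<rho> :: "((real ^ 'd::finite) \<times> ereal) measure \<Rightarrow> ((real ^ 'd) \<times> ereal) measure \<Rightarrow> real"
  assumes \<rho>: "vague_metric \<rho>"
  shows "xi_limit k \<in> M0_measures \<rho>"
  unfolding M0_measures_def
proof (intro CollectI conjI allI impI)
  show "sets (xi_limit k :: ((real ^ 'd) \<times> ereal) measure measure) = sets vague_borel"
    by (simp add: xi_limit_def)
  fix r :: real assume "0 < r"
  note ball = mball_null_contains[OF \<rho> this]
  let ?N = "density (restrict_space lborel (unit_cube \<times> UNIV)) (\<lambda>(x :: real ^ 'd, u). ennreal (exp (- u)))"
  let ?r = "\<lambda>(x :: real ^ 'd, u). return E_borel (x, ereal u)"
  let ?B = "Metric_space.mball point_measures \<rho> (null_measure E_borel) r"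
  obtain c where c: "\<And>J y. finite (J :: nat set) \<Longrightarrow> y \<in> J \<rightarrow> E_set \<Longrightarrow>
    \<forall>j\<in>J. snd (y j) \<le> ereal c \<Longrightarrow> dirac_sum E_borel J y \<in> ?B"
    using vague_nbhd_null[OF ball] by blast
  have B: "point_measures - ?B \<in> sets vague_borel"
    using sets.compl_sets[OF open_in_vague_borel[OF ball(1)]] by simp
  have low: "?r p \<in> ?B" if "fst p \<in> unit_cube" "snd p \<le> c" for p
    using that c[of "{0}" "\<lambda>_. (fst p, ereal (snd p))"] return_eq_dirac_sum[of "\<lambda>_. (fst p, ereal (snd p))" 0]
    by (simp add: case_prod_unfold E_set_def)
  have tail: "{p :: (real ^ 'd) \<times> real. c < snd p} \<in> sets borel"
    by (intro borel_open open_Collect_less continuous_intros)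
  have "emeasure (distr ?N vague_borel ?r) (point_measures - ?B) = emeasure ?N (?r -` (point_measures - ?B) \<inter> space ?N)"
    by (rule emeasure_distr[OF measurable_return_limit B])
  also have "\<dots> \<le> emeasure ?N ({p. c < snd p} \<inter> space ?N)"
  proof (rule emeasure_mono)
    show "?r -` (point_measures - ?B) \<inter> space ?N \<subseteq> {p. c < snd p} \<inter> space ?N"
      using low by (fastforce simp: space_restrict_space not_le[symmetric])
    show "{p. c < snd p} \<inter> space ?N \<in> sets ?N"
      using tail by (auto simp: space_restrict_space sets_restrict_space)
  qed
  also have "\<dots> = emeasure (limit_intensity :: ((real ^ 'd) \<times> real) measure) {p. c < snd p}"
    unfolding limit_intensity_eq_distr using tail
    by (subst emeasure_distr) (auto simp: measurable_restrict_space1)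
  also have "\<dots> = ennreal (exp (- c))" by (rule emeasure_limit_intensity_tail)
  finally have "emeasure (distr ?N vague_borel ?r) (point_measures - ?B) < \<top>"
    by (simp add: le_less_trans)
  then show "emeasure (xi_limit k) (point_measures - ?B) < \<infinity>"
    by (simp add: xi_limit_def ennreal_mult_less_top)
qed

section \<open>The sample of the theorem\<close>

lemma borel_measurable_ereal_power:
  fixes f :: "'a \<Rightarrow> ereal"
  assumes [measurable]: "f \<in> borel_measurable M"
  shows "(\<lambda>x. f x ^ n) \<in> borel_measurable M"
  by (induction n) simp_all

locale knn_sample = prob_space M + threshold_sequence a b k
  for M :: "'w measure" and X :: "nat \<Rightarrow> 'w \<Rightarrow> real ^ 'd::finite" and a b :: "nat \<Rightarrow> real" and k :: nat +
  assumes indep: "indep_vars (\<lambda>_. borel) X {1..}"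
    and uniform: "\<And>i. i \<ge> 1 \<Longrightarrow> distr M borel (X i) = uniform_measure lborel unit_cube"
    and in_cube: "\<And>i w. i \<ge> 1 \<Longrightarrow> w \<in> space M \<Longrightarrow> X i w \<in> unit_cube"
begin

definition score :: "nat \<Rightarrow> nat \<Rightarrow> 'w \<Rightarrow> ereal" where
  "score n i w = ereal (real n * unit_ball_volume TYPE('d)) *
     sample_knn k {1..n} (X i w) (\<lambda>j. X j w) ^ CARD('d) - ereal (a n)"

lemma X_measurable: "1 \<le> i \<Longrightarrow> X i \<in> borel_measurable M"
  using indep by (auto simp: indep_vars_def)

lemma score_measurable: "i \<in> {1..n} \<Longrightarrow> score n i \<in> borel_measurable M"
proof -
  assume i: "i \<in> {1..n}"
  have "(\<lambda>w. sample_knn k {1..n} (X i w) (\<lambda>j. X j w)) \<in> borel_measurable M"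
    using i by (intro measurable_sample_knn X_measurable) auto
  from borel_measurable_ereal_power[OF this, of "CARD('d)"] show ?thesis
    unfolding score_def by simp
qed

lemma score_gt_MInf: "1 \<le> n \<Longrightarrow> -\<infinity> < score n i w"
proof -
  let ?R = "sample_knn k {1..n} (X i w) (\<lambda>j. X j w)"
  have "0 \<le> ereal (real n * unit_ball_volume TYPE('d)) * ?R ^ CARD('d)"
    using unit_ball_volume_pos[where 'd = 'd] by (simp add: sample_knn_nonneg)
  then have "0 - ereal (a n) \<le> score n i w"
    unfolding score_def by (intro ereal_minus_mono) auto
  then show ?thesis by (rule less_le_trans[rotated]) simp
qed

lemma point_in_E: "i \<in> {1..n} \<Longrightarrow> w \<in> space M \<Longrightarrow> (X i w, score n i w) \<in> E_set"
  using in_cube[of i w] score_gt_MInf[of n i w] by (simp add: E_set_def)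

lemma L_process_eq:
  assumes "k < n" "w \<in> space M"
  shows "L_process k a (\<lambda>i. X i w) n = dirac_sum E_borel {1..n} (\<lambda>i. (X i w, score n i w))"
proof -
  have "knn_radius k (X i w) (binomial_process (\<lambda>i. X i w) n) = sample_knn k {1..n} (X i w) (\<lambda>j. X j w)" for i
    using in_cube assms(2) by (intro knn_radius_binomial_process) auto
  then show ?thesis
    using assms(1) by (simp add: L_process_def score_def unit_ball_volume_def)
qed

text \<open>
  Without measurability the image measure in the theorem would be a junk value.
\<close>

lemma L_process_measurable: "(\<lambda>w. L_process k a (\<lambda>i. X i w) n) \<in> measurable M vague_borel"
proof (cases "k < n")
  case True
  have "(\<lambda>w. dirac_sum E_borel {1..n} ((\<lambda>w i. (X i w, score n i w)) w)) \<in> measurable M vague_borel"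
  proof (rule measurable_dirac_sum)
    show "(\<lambda>w. (X i w, score n i w)) \<in> borel_measurable M" if "i \<in> {1..n}" for i
      using that X_measurable[of i] score_measurable[OF that] by (intro borel_measurable_Pair) auto
  qed (use point_in_E in auto)
  then show ?thesis
    by (rule measurable_cong[THEN iffD1, rotated]) (simp add: L_process_eq[OF True])
next
  case False
  have "null_measure E_borel \<in> (point_measures :: ((real ^ 'd) \<times> ereal) measure set)"
    unfolding null_measure_eq_dirac_sum[of undefined] by (rule dirac_sum_in_point_measures) auto
  then show ?thesis using False by (simp add: L_process_def)
qed

lemma sample_law_borel:
  assumes "1 \<le> n"
  shows "distr M (\<Pi>\<^sub>M i\<in>{1..n}. borel) (\<lambda>w. \<lambda>i\<in>{1..n}. X i w) = cube_product {1..n}"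
proof -
  have "indep_vars (\<lambda>_. borel) X {1..n}"
    by (rule indep_vars_subset[OF indep]) auto
  then have "distr M (\<Pi>\<^sub>M i\<in>{1..n}. borel) (\<lambda>w. \<lambda>i\<in>{1..n}. X i w) = (\<Pi>\<^sub>M i\<in>{1..n}. distr M borel (X i))"
    using assms X_measurable by (subst (asm) indep_vars_iff_distr_eq_PiM') auto
  also have "\<dots> = cube_product {1..n}"
    by (rule PiM_cong) (auto simp: uniform cube_law_def)
  finally show ?thesis .
qed

lemma sample_measurable: "(\<lambda>w. \<lambda>i\<in>{1..n}. X i w) \<in> measurable M (cube_product {1..n})"
proof -
  have "(\<lambda>w. \<lambda>i\<in>{1..n}. X i w) \<in> measurable M (\<Pi>\<^sub>M i\<in>{1..n}. borel)"
    using X_measurable by (intro measurable_restrict) auto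
  also have "measurable M (\<Pi>\<^sub>M i\<in>{1..n}. borel) = measurable M (cube_product {1..n})"
    by (intro measurable_cong_sets sets_PiM_cong) auto
  finally show ?thesis .
qed

lemma sample_law:
  assumes "1 \<le> n"
  shows "distr M (cube_product {1..n}) (\<lambda>w. \<lambda>i\<in>{1..n}. X i w) = cube_product {1..n}"
proof -
  have "distr M (cube_product {1..n}) (\<lambda>w. \<lambda>i\<in>{1..n}. X i w) =
      distr M (\<Pi>\<^sub>M i\<in>{1..n}. borel) (\<lambda>w. \<lambda>i\<in>{1..n}. X i w)"
    by (intro distr_cong sets_PiM_cong) auto
  then show ?thesis using sample_law_borel[OF assms] by simp
qed

lemma nbr_count_restrict:
  "nbr_count {1..n} ((\<lambda>i\<in>{1..n}. y i) l) (\<lambda>i\<in>{1..n}. y i) r = nbr_count {1..n} (y l) y r" if "l \<in> {1..n}"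
  using that unfolding nbr_count_def by (intro arg_cong[where f = card]) auto

text \<open>
  The ball volume \<open>(a n + s) / n\<close> tends to \<open>0\<close>, hence is eventually that of a ball small enough to be
  embedded in the torus.
\<close>

lemma radius_exists:
  "eventually (\<lambda>n. \<exists>r. 0 < r \<and> r < 1 / 4 \<and> unit_ball_volume TYPE('d) * r ^ CARD('d) = (a n + s) / real n) sequentially"
proof -
  have \<theta>: "0 < unit_ball_volume TYPE('d)" by (rule unit_ball_volume_pos)
  have "eventually (\<lambda>n. (a n + s) / real n < unit_ball_volume TYPE('d) * (1 / 4) ^ CARD('d)) sequentially"
    using shift_over_n[of s] by (rule order_tendstoD) (use \<theta> in simp)
  moreover have "eventually (\<lambda>n. 1 - s \<le> a n) sequentially"
    using a_at_top by (simp add: filterlim_at_top)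
  ultimately show ?thesis
    using eventually_gt_at_top[of 0]
  proof eventually_elim
    case (elim n)
    define q where "q = (a n + s) / real n / unit_ball_volume TYPE('d)"
    have q: "0 < q" using elim \<theta> by (simp add: q_def)
    define r where "r = root CARD('d) q"
    have r: "0 < r" "r ^ CARD('d) = q" using q by (simp_all add: r_def)
    have "unit_ball_volume TYPE('d) * q = (a n + s) / real n" using \<theta> by (simp add: q_def)
    then have "unit_ball_volume TYPE('d) * q < unit_ball_volume TYPE('d) * (1 / 4) ^ CARD('d)"
      using elim(1) by simp
    then have "r ^ CARD('d) < (1 / 4) ^ CARD('d)" using \<theta> r(2) by simp
    then have "r < 1 / 4" by (rule power_less_imp_less_base) simp
    then show ?case using r \<theta> by (intro exI[of _ r]) (simp add: q_def)
  qed
qed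

lemma score_greater_iff_count:
  assumes "1 \<le> n" "0 < r" "unit_ball_volume TYPE('d) * r ^ CARD('d) = (a n + s) / real n"
  shows "ereal s < score n i w \<longleftrightarrow> nbr_count {1..n} (X i w) (\<lambda>j. X j w) r < k"
proof -
  have "ereal s < score n i w \<longleftrightarrow> ereal r < sample_knn k {1..n} (X i w) (\<lambda>j. X j w)"
    unfolding score_def
  proof (rule score_greater_iff)
    show "real n * unit_ball_volume TYPE('d) * r ^ CARD('d) = a n + s"
      using assms by (simp add: mult.assoc)
  qed (use assms unit_ball_volume_pos[where 'd = 'd] in \<open>auto simp: sample_knn_nonneg\<close>)
  then show ?thesis using less_sample_knn_iff[of "{1..n}" r k] assms(2) by simp
qed

lemma one_point_tail:
  "eventually (\<lambda>n. \<forall>i\<in>{1..n}. \<forall>\<phi> B. \<phi> \<in> borel_measurable borel \<longrightarrow> (\<forall>x. \<bar>\<phi> x\<bar> \<le> B) \<longrightarrow>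
     (\<integral>w. \<phi> (X i w) * of_bool (ereal s < score n i w) \<partial>M) =
     (\<integral>x. \<phi> x \<partial>cube_law) * binom_lower (n - 1) ((a n + s) / real n) k) sequentially"
  using radius_exists[of s] eventually_ge_at_top[of 1]
proof eventually_elim
  case (elim n)
  then obtain r where r: "0 < r" "r < 1 / 4" "unit_ball_volume TYPE('d) * r ^ CARD('d) = (a n + s) / real n"
    by blast
  let ?I = "{1..n}"
  let ?X = "\<lambda>w. \<lambda>i\<in>?I. X i w"
  show ?case
  proof (intro ballI allI impI)
    fix i and \<phi> :: "real ^ 'd \<Rightarrow> real" and B :: real assume i: "i \<in> ?I" and \<phi>: "\<phi> \<in> borel_measurable borel" "\<forall>x. \<bar>\<phi> x\<bar> \<le> B"
    let ?f = "\<lambda>y. \<phi> (y i) * indicator {y. nbr_count ?I (y i) y r < k} y"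
    have f: "?f \<in> borel_measurable (cube_product ?I)"
    proof -
      have [measurable]: "(\<lambda>y. y i) \<in> borel_measurable (cube_product ?I)"
        by (rule measurable_cube_product_component[OF i])
      have [measurable]: "(\<lambda>y. nbr_count ?I (y i) y r) \<in> measurable (cube_product ?I) (count_space UNIV)"
        using i by (intro measurable_nbr_count measurable_cube_product_component) auto
      note [measurable] = \<phi>(1)
      have "?f = (\<lambda>y. \<phi> (y i) * (if nbr_count ?I (y i) y r < k then 1 else 0))" by auto
      also have "\<dots> \<in> borel_measurable (cube_product ?I)" by measurable
      finally show ?thesis .
    qed
    have "(\<integral>w. \<phi> (X i w) * of_bool (ereal s < score n i w) \<partial>M) = (\<integral>w. ?f (?X w) \<partial>M)"
    proof (rule Bochner_Integration.integral_cong[OF refl])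
      fix w
      show "\<phi> (X i w) * of_bool (ereal s < score n i w) = ?f (?X w)"
        unfolding score_greater_iff_count[OF elim(2) r(1,3)]
        using nbr_count_restrict[OF i, of "\<lambda>i. X i w" r] i by (simp add: indicator_def)
    qed
    also have "\<dots> = (\<integral>y. ?f y \<partial>distr M (cube_product ?I) ?X)"
      by (rule integral_distr[symmetric, OF sample_measurable f])
    also have "\<dots> = (\<integral>y. ?f y \<partial>cube_product ?I)"
      unfolding sample_law[OF elim(2)] ..
    also have "\<dots> = (\<integral>x. \<phi> x \<partial>cube_law) * binom_lower (card ?I - 1) (unit_ball_volume TYPE('d) * r ^ CARD('d)) k"
      by (rule integral_one_point) (use i r \<phi> in auto)
    finally show "(\<integral>w. \<phi> (X i w) * of_bool (ereal s < score n i w) \<partial>M) =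
      (\<integral>x. \<phi> x \<partial>cube_law) * binom_lower (n - 1) ((a n + s) / real n) k"
      by (simp add: r(3))
  qed
qed

text \<open>
  Given \<open>\<eta>\<close>, the radius factor \<open>\<epsilon>\<close> is chosen so small that the contribution of the close pairs, the only
  one whose bound is not \<open>o(b n)\<close> for fixed \<open>\<epsilon>\<close>, stays below \<open>\<eta> b n\<close>.
\<close>

lemma pairs_asymp:
  "(\<lambda>n. (\<Sum>i\<in>{1..n}. \<Sum>j\<in>{1..n} - {i}. prob {w \<in> space M. ereal s < score n i w \<and> ereal s < score n j w}) / b n) \<longlonglongrightarrow> 0"
  (is "(\<lambda>n. ?S n / b n) \<longlonglongrightarrow> 0")
proof (rule LIMSEQ_I)
  fix \<eta> :: real assume "0 < \<eta>"
  define K where "K = real (k - 1) * exp (- s)"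
  have K: "0 \<le> K" by (simp add: K_def)
  obtain \<epsilon> :: real where \<epsilon>: "0 < \<epsilon>" "\<epsilon> \<le> 1" "\<epsilon> ^ CARD('d) * K < \<eta>"
  proof -
    define \<epsilon> where "\<epsilon> = min 1 (\<eta> / (K + 1))"
    have e: "0 < \<epsilon>" "\<epsilon> \<le> 1" "\<epsilon> \<le> \<eta> / (K + 1)" using \<open>0 < \<eta>\<close> K by (auto simp: \<epsilon>_def)
    have "\<epsilon> ^ CARD('d) \<le> \<epsilon> ^ 1" using e by (intro power_decreasing) auto
    then have "\<epsilon> ^ CARD('d) * K \<le> \<eta> / (K + 1) * K" using e K by (intro mult_right_mono) auto
    also have "\<dots> < \<eta>" using \<open>0 < \<eta>\<close> K by (simp add: field_simps)
    finally show ?thesis using that e by blast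
  qed
  define \<delta> where "\<delta> = (\<epsilon> / 4) ^ CARD('d)"
  have \<delta>: "0 < \<delta>" using \<epsilon> by (simp add: \<delta>_def)
  define D :: real where "D = 2 ^ CARD('d)"
  have "0 \<le> \<epsilon> ^ CARD('d)" "0 \<le> D" using \<epsilon> by (auto simp: D_def)
  note asymp = pair_bound_asymp[OF \<delta> this, of s]
  from asymp(2) obtain U where U: "U \<longlonglongrightarrow> \<epsilon> ^ CARD('d) * K"
    and Ub: "eventually (\<lambda>n. (real n)\<^sup>2 * (\<epsilon> ^ CARD('d) * ((a n + s) / real n) * binom_lower (n - 2) ((a n + s) / real n) (k - 1)
      + D * ((a n + s) / real n) * middle_bound s \<delta> n
      + binom_lower (n - 2) (2 * ((a n + s) / real n)) (2 * k - 1)) \<le> U n * b n) sequentially"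
    unfolding K_def by blast
  have "eventually (\<lambda>n. U n < \<eta>) sequentially" using U \<epsilon>(3) by (rule order_tendstoD)
  then have "eventually (\<lambda>n. norm (?S n / b n - 0) < \<eta>) sequentially"
    using Ub asymp(1) radius_exists[of s] eventually_ge_at_top[of 2] eventually_b_pos
  proof eventually_elim
    case (elim n)
    then obtain r where r: "0 < r" "r < 1 / 4" "unit_ball_volume TYPE('d) * r ^ CARD('d) = (a n + s) / real n"
      by blast
    have n1: "1 \<le> n" using elim by simp
    let ?I = "{1..n}"
    let ?X = "\<lambda>w. \<lambda>i\<in>?I. X i w"
    define T where "T = \<epsilon> ^ CARD('d) * ((a n + s) / real n) * binom_lower (n - 2) ((a n + s) / real n) (k - 1)
      + D * ((a n + s) / real n) * middle_bound s \<delta> n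
      + binom_lower (n - 2) (2 * ((a n + s) / real n)) (2 * k - 1)"
    have P: "prob {w \<in> space M. ereal s < score n i w \<and> ereal s < score n j w} \<le> T"
      if ij: "i \<in> ?I" "j \<in> ?I" "i \<noteq> j" for i j
    proof -
      define A where "A = {y \<in> space (cube_product ?I :: (nat \<Rightarrow> real ^ 'd) measure). nbr_count ?I (y i) y r < k \<and> nbr_count ?I (y j) y r < k}"
      have A: "A \<in> sets (cube_product ?I)"
      proof -
        have [measurable]: "(\<lambda>y. nbr_count ?I (y i) y r) \<in> measurable (cube_product ?I) (count_space UNIV)"
          "(\<lambda>y. nbr_count ?I (y j) y r) \<in> measurable (cube_product ?I) (count_space UNIV)"
          using ij by (auto intro!: measurable_nbr_count measurable_cube_product_component)
        show ?thesis unfolding A_def by measurable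
      qed
      have "{w \<in> space M. ereal s < score n i w \<and> ereal s < score n j w} = ?X -` A \<inter> space M"
      proof -
        have eq: "nbr_count ?I (X l w) (?X w) r = nbr_count ?I (X l w) (\<lambda>j. X j w) r" if "l \<in> ?I" for l w
          using nbr_count_restrict[OF that, of "\<lambda>j. X j w" r] that by simp
        have "?X w \<in> space (cube_product ?I :: (nat \<Rightarrow> real ^ 'd) measure)" for w
          by (simp add: space_PiM)
        then show ?thesis
          unfolding score_greater_iff_count[OF n1 r(1,3)] A_def
          using eq[OF ij(1)] eq[OF ij(2)] ij by (auto simp del: restrict_PiE_iff)
      qed
      then have "prob {w \<in> space M. ereal s < score n i w \<and> ereal s < score n j w} =
          measure (distr M (cube_product ?I) ?X) A"
        using A sample_measurable[of n] by (simp add: measure_distr)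
      also have "\<dots> = measure (cube_product ?I) A"
        unfolding sample_law[OF n1] ..
      also have "\<dots> \<le> \<epsilon> ^ CARD('d) * (unit_ball_volume TYPE('d) * r ^ CARD('d)) *
          binom_lower (card ?I - 2) (unit_ball_volume TYPE('d) * r ^ CARD('d)) (k - 1)
        + 2 ^ CARD('d) * (unit_ball_volume TYPE('d) * r ^ CARD('d)) * middle_bound s \<delta> n
        + binom_lower (card ?I - 2) (2 * (unit_ball_volume TYPE('d) * r ^ CARD('d))) (2 * k - 1)"
        unfolding A_def
      proof (rule measure_two_points_le)
        show "binom_lower (card ?I - 2) q (2 * k - 1) \<le> middle_bound s \<delta> n"
          if "(1 + (\<epsilon> / 4) ^ CARD('d)) * (unit_ball_volume TYPE('d) * r ^ CARD('d)) \<le> q"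
            "q \<le> 2 * (unit_ball_volume TYPE('d) * r ^ CARD('d))" for q
          using elim(3) that unfolding r(3) \<delta>_def[symmetric] by simp
      qed (use ij k \<epsilon> r in auto)
      also have "\<dots> = T" unfolding r(3) by (simp add: T_def D_def)
      finally show ?thesis .
    qed
    have T0: "0 \<le> T"
      using order_trans[OF measure_nonneg P[of 1 2]] elim by simp
    have "?S n \<le> (\<Sum>i\<in>?I. \<Sum>j\<in>?I - {i}. T)" by (intro sum_mono P) auto
    also have "\<dots> = real n * (real (n - 1) * T)" using n1 by (simp add: of_nat_diff)
    also have "\<dots> \<le> real n * (real n * T)"
      using T0 by (intro mult_left_mono mult_right_mono) auto
    also have "\<dots> = (real n)\<^sup>2 * T" by (simp add: power2_eq_square)
    also have "\<dots> \<le> U n * b n" using elim(2) by (simp add: T_def)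
    finally have "?S n / b n \<le> U n" using elim by (simp add: divide_le_eq)
    moreover have "0 \<le> ?S n / b n" using elim by (intro divide_nonneg_nonneg sum_nonneg) auto
    ultimately show ?case using elim(1) by simp
  qed
  then show "\<exists>no. \<forall>n\<ge>no. norm (?S n / b n - 0) < \<eta>"
    unfolding eventually_sequentially .
qed

lemma intensity_tail_asymp:
  "(\<lambda>n. real n * binom_lower (n - 1) ((a n - ln t) / real n) k / b n) \<longlonglongrightarrow> t / fact (k - 1)" if "0 < t" for t
  using one_point_asymp[of "- ln t"] that by simp

text \<open>
  Convergence of the intensity measures, tested against the function that \<open>g\<close> induces on single points.
  In the coordinate \<open>exp (- u)\<close> this function is continuous on a compact set and vanishes beyond
  it, so that the step approximation compares both sides.
\<close>

lemma single_point_functional_asymp: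
  fixes g :: "((real ^ 'd) \<times> ereal) measure \<Rightarrow> real"
  assumes g: "g \<in> C0_functions"
    and vanish: "\<And>J y. finite (J :: nat set) \<Longrightarrow> y \<in> J \<rightarrow> E_set \<Longrightarrow>
      (\<And>j. j \<in> J \<Longrightarrow> snd (y j) \<le> ereal c) \<Longrightarrow> g (dirac_sum E_borel J y) = 0"
  shows "(\<lambda>n. (\<Sum>i\<in>{1..n}. \<integral>w. g (return E_borel (X i w, score n i w)) \<partial>M) / b n)
           \<longlonglongrightarrow> (\<integral>\<mu>. g \<mu> \<partial>xi_limit k)"
proof -
  define V where "V = exp (- c)"
  have V: "0 < V" by (simp add: V_def)
  obtain B where B: "0 < B" "\<And>\<mu>. \<mu> \<in> point_measures \<Longrightarrow> \<bar>g \<mu>\<bar> \<le> B"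
    using C0_bounded[OF g] by blast
  have h0: "g (return E_borel p) = 0" if "p \<in> E_set" "snd p \<le> ereal c" for p
    using vanish[of "{0}" "\<lambda>_. p"] return_eq_dirac_sum[of "\<lambda>_. p" 0] that by simp
  let ?S = "(unit_cube :: (real ^ 'd) set) \<times> {0 :: real..}"
  define G where "G = (\<lambda>x v. indicator ?S (x, v) * g (return E_borel (x, neg_ln v)))"
  have SE: "(fst p, neg_ln (snd p)) \<in> E_set" if "p \<in> ?S" for p
    using that neg_ln_gt_MInf[of "snd p"] by (auto simp: E_set_def)
  have Gm: "(\<lambda>p. G (fst p) (snd p)) \<in> borel_measurable (borel \<Otimes>\<^sub>M borel)"
  proof -
    have S: "?S \<in> sets (borel \<Otimes>\<^sub>M borel)"
      by (intro pair_measureI) (auto intro: sets_unit_cube)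
    have "(\<lambda>p :: (real ^ 'd) \<times> real. (fst p, neg_ln (snd p))) \<in> borel_measurable (restrict_space (borel \<Otimes>\<^sub>M borel) ?S)"
      by (intro measurable_restrict_space1 borel_measurable_Pair measurable_compose[OF measurable_snd measurable_neg_ln]) auto
    then have "(\<lambda>p. return E_borel (fst p, neg_ln (snd p))) \<in>
        measurable (restrict_space (borel \<Otimes>\<^sub>M borel) ?S) vague_borel"
      by (rule measurable_return_vague) (use SE in \<open>auto simp: space_restrict_space\<close>)
    from measurable_compose[OF this C0_measurable[OF g]]
    have "(\<lambda>p. g (return E_borel (fst p, neg_ln (snd p)))) \<in> borel_measurable (restrict_space (borel \<Otimes>\<^sub>M borel) ?S)" .
    then have "(\<lambda>p. indicator ?S p *\<^sub>R g (return E_borel (fst p, neg_ln (snd p)))) \<in> borel_measurable (borel \<Otimes>\<^sub>M borel)"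
      using S by (subst (asm) borel_measurable_restrict_space_iff) (auto simp: space_pair_measure)
    then show ?thesis by (simp add: G_def)
  qed
  have Gb: "\<bar>G x v\<bar> \<le> B" for x v
  proof (cases "(x, v) \<in> ?S")
    case True
    then show ?thesis using B(2)[OF return_in_point_measures[OF SE[OF True]]] by (simp add: G_def)
  qed (use B(1) in \<open>simp add: G_def\<close>)
  have Gcont: "continuous_on (unit_cube \<times> {0..V}) (\<lambda>p. G (fst p) (snd p))"
  proof -
    have "continuous_on (unit_cube \<times> {0..V}) (\<lambda>p :: (real ^ 'd) \<times> real. g (return E_borel (fst p, neg_ln (snd p))))"
    proof (rule continuous_on_compose2[OF continuous_on_return[OF g]])
      show "continuous_on (unit_cube \<times> {0..V}) (\<lambda>p :: (real ^ 'd) \<times> real. (fst p, neg_ln (snd p)))"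
        by (intro continuous_intros continuous_on_compose2[OF continuous_on_neg_ln]) auto
      show "(\<lambda>p :: (real ^ 'd) \<times> real. (fst p, neg_ln (snd p))) ` (unit_cube \<times> {0..V}) \<subseteq> E_set"
        using SE by auto
    qed
    then show ?thesis
      by (rule continuous_on_cong[THEN iffD1, OF refl, rotated]) (auto simp: G_def)
  qed
  have point_eq: "g (return E_borel (x, u)) = G x (exp_neg u) * of_bool (exp_neg u < V)"
    if "(x, u) \<in> E_set" for x u
  proof -
    have u: "-\<infinity> < u" "x \<in> unit_cube" using that by (auto simp: E_set_def)
    show ?thesis
    proof (cases "exp_neg u < V")
      case True
      then show ?thesis using u neg_ln_exp_neg[OF u(1)] exp_neg_nonneg[of u] by (simp add: G_def)
    next
      case False
      then have "u \<le> ereal c" using exp_neg_less_iff[OF u(1), of c] by (simp add: V_def not_less)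
      then show ?thesis using h0[OF that] False by simp
    qed
  qed
  define F' where "F' = (\<lambda>p :: (real ^ 'd) \<times> real. G (fst p) (exp (- snd p)) * of_bool (exp (- snd p) < V))"
  have ind_m: "(\<lambda>p :: (real ^ 'd) \<times> real. of_bool (exp (- snd p) < V) :: real) \<in> borel_measurable borel"
    using borel_measurable_integrable[OF integrable_limit_intensity_tail[where 'd = 'd, of V]]
    by (simp cong: measurable_cong_sets)
  have F'm: "F' \<in> borel_measurable borel"
  proof -
    have "(\<lambda>p :: (real ^ 'd) \<times> real. (fst p, exp (- snd p))) \<in> measurable borel (borel \<Otimes>\<^sub>M borel)"
      unfolding borel_prod by (intro borel_measurable_continuous_onI continuous_intros)
    from measurable_compose[OF this Gm] show ?thesis
      unfolding F'_def using ind_m by (intro borel_measurable_times) auto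
  qed
  have xi: "(\<integral>\<mu>. g \<mu> \<partial>xi_limit k) = 1 / fact (k - 1) * (\<integral>p. F' p \<partial>limit_intensity)"
    by (rule integral_xi_limit[OF g F'm]) (use point_eq in \<open>auto simp: F'_def E_set_def\<close>)
  define Q where "Q = (\<lambda>n. (\<Sum>i\<in>{1..n}. \<integral>w. g (return E_borel (X i w, score n i w)) \<partial>M) / b n)"
  define \<xi>g where "\<xi>g = (\<integral>\<mu>. g \<mu> \<partial>xi_limit k)"
  have "Q \<longlonglongrightarrow> \<xi>g"
  proof (rule LIMSEQ_I)
    fix \<eta> :: real assume "0 < \<eta>"
    \<comment> \<open>Three errors of size \<open>\<eta> / 4\<close>: the step approximation of the sample, whose normalized mass below \<open>V\<close> is eventually less than \<open>V + 1\<close>, that of the limit, and the convergence of the tails.\<close>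
    define \<epsilon> where "\<epsilon> = \<eta> / (4 * (V + 1))"
    have \<epsilon>: "0 < \<epsilon>" "\<epsilon> * (V + 1) = \<eta> / 4" using \<open>0 < \<eta>\<close> V by (auto simp: \<epsilon>_def field_simps)
    obtain N where N: "0 < N" and step0: "\<And>x v. x \<in> unit_cube \<Longrightarrow> 0 \<le> v \<Longrightarrow> v < V \<Longrightarrow>
      \<bar>(\<lambda>p. G (fst p) (snd p)) (x, v) - (\<Sum>j<N. (\<lambda>p. G (fst p) (snd p)) (x, real (Suc j) * V / real N) *
          (of_bool (v < real (Suc j) * V / real N) - of_bool (v < real j * V / real N)))\<bar> \<le> \<epsilon>"
      using step_approximation[OF compact_unit_cube Gcont V \<epsilon>(1)] by blast
    define t where "t = (\<lambda>j. real j * V / real N)"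
    have step: "\<bar>G x v - (\<Sum>j<N. G x (t (Suc j)) * (of_bool (v < t (Suc j)) - of_bool (v < t j)))\<bar> \<le> \<epsilon>"
      if "0 \<le> v" "v < V" for x v
    proof (cases "x \<in> unit_cube")
      case True
      then show ?thesis using step0[OF True that] unfolding t_def by simp
    next
      case False
      then have "G x s = 0" for s by (simp add: G_def)
      then show ?thesis using \<epsilon> by simp
    qed
    have t: "t N = V" "t 0 = 0" "\<And>j. 0 \<le> t j" "\<And>j. 0 < j \<Longrightarrow> 0 < t j" using N V by (simp_all add: t_def)
    have tle: "t j \<le> V" if "j \<le> N" for j using that N V by (simp add: t_def divide_le_eq mult.commute)
    define m where "m = (\<lambda>j. \<integral>x. G x (t (Suc j)) \<partial>cube_law)"
    \<comment> \<open>The tail below \<open>t 0 = 0\<close> is empty; it does not correspond to a finite score level.\<close>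
    define F where "F = (\<lambda>n j. if j = 0 then 0 else binom_lower (n - 1) ((a n - ln (t j)) / real n) k)"
    define \<Phi> where "\<Phi> = (\<lambda>n j. real n * F n j / b n)"
    have \<Phi>_lim: "(\<lambda>n. \<Phi> n j) \<longlonglongrightarrow> t j / fact (k - 1)" for j
      using intensity_tail_asymp[of "t j"] t(2) t(4)[of j] by (cases "j = 0") (simp_all add: \<Phi>_def F_def)
    have lim_approx: "\<bar>(\<integral>p. F' p \<partial>limit_intensity) - (\<Sum>j<N. m j * (t (Suc j) - t j))\<bar> \<le> \<epsilon> * t N"
      unfolding F'_def m_def
    proof (rule integral_step_approximation)
      show "(\<integral>p. \<phi> (fst p) * of_bool (exp (- snd p) < t j) \<partial>limit_intensity) = (\<integral>x. \<phi> x \<partial>cube_law) * t j"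
        if "\<phi> \<in> borel_measurable borel" "\<exists>B. \<forall>x. \<bar>\<phi> x\<bar> \<le> B" for \<phi> :: "real ^ 'd \<Rightarrow> real" and j
      proof -
        obtain B' where "\<And>x. \<bar>\<phi> x\<bar> \<le> B'" using \<open>\<exists>B. \<forall>x. \<bar>\<phi> x\<bar> \<le> B\<close> by blast
        then show ?thesis by (rule integral_limit_intensity_tensor[OF that(1) _ t(3)])
      qed
      show "(\<lambda>p. exp (- snd p)) \<in> borel_measurable (limit_intensity :: ((real ^ 'd) \<times> real) measure)"
        "fst \<in> borel_measurable (limit_intensity :: ((real ^ 'd) \<times> real) measure)"
        by (simp_all add: borel_measurable_continuous_onI continuous_intros cong: measurable_cong_sets)
    qed (use step t tle Gm Gb integrable_limit_intensity_tail in auto)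
    define \<Sigma>n where "\<Sigma>n = (\<lambda>n. \<Sum>j<N. m j * (\<Phi> n (Suc j) - \<Phi> n j))"
    define \<Sigma> where "\<Sigma> = (\<Sum>j<N. m j * (t (Suc j) / fact (k - 1) - t j / fact (k - 1)))"
    have "\<Sigma>n \<longlonglongrightarrow> \<Sigma>"
      unfolding \<Sigma>n_def \<Sigma>_def by (intro tendsto_intros \<Phi>_lim)
    then have ev1: "eventually (\<lambda>n. \<bar>\<Sigma>n n - \<Sigma>\<bar> < \<eta> / 4) sequentially"
      using \<open>0 < \<eta>\<close> by (auto simp: tendsto_iff dist_real_def dest!: spec[of _ "\<eta> / 4"])
    have f1: "1 \<le> (fact (k - 1) :: real)" by simp
    have lim_diff: "\<bar>\<xi>g - \<Sigma>\<bar> \<le> \<eta> / 4"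
    proof -
      have "\<Sigma> = 1 / fact (k - 1) * (\<Sum>j<N. m j * (t (Suc j) - t j))"
        unfolding \<Sigma>_def by (simp add: sum_distrib_left diff_divide_distrib[symmetric])
      then have "\<bar>\<xi>g - \<Sigma>\<bar> = 1 / fact (k - 1) * \<bar>(\<integral>p. F' p \<partial>limit_intensity) - (\<Sum>j<N. m j * (t (Suc j) - t j))\<bar>"
        unfolding \<xi>g_def xi by (simp flip: diff_divide_distrib)
      also have "\<dots> \<le> 1 * (\<epsilon> * t N)"
        using f1 lim_approx by (intro mult_mono) auto
      also have "\<dots> \<le> \<epsilon> * (V + 1)" using \<epsilon>(1) t(1) by simp
      finally show ?thesis using \<epsilon>(2) by simp
    qed
    have ev2: "eventually (\<lambda>n. \<bar>Q n - \<Sigma>n n\<bar> \<le> \<epsilon> * \<Phi> n N) sequentially"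
    proof -
      have "eventually (\<lambda>n. \<forall>j\<in>{1..N}. \<forall>i\<in>{1..n}. \<forall>\<phi> B. \<phi> \<in> borel_measurable borel \<longrightarrow> (\<forall>x. \<bar>\<phi> x\<bar> \<le> B) \<longrightarrow>
         (\<integral>w. \<phi> (X i w) * of_bool (ereal (- ln (t j)) < score n i w) \<partial>M) =
         (\<integral>x. \<phi> x \<partial>cube_law) * binom_lower (n - 1) ((a n + - ln (t j)) / real n) k) sequentially"
        by (intro eventually_ball_finite ballI one_point_tail) auto
      then show ?thesis
        using eventually_ge_at_top[of 1] eventually_b_pos
      proof eventually_elim
        case (elim n)
        have tail_eq: "exp_neg (score n i w) < t j \<longleftrightarrow> 0 < j \<and> ereal (- ln (t j)) < score n i w" for i w j
        proof (cases "j = 0")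
          case True
          then show ?thesis using exp_neg_nonneg[of "score n i w"] t(2) by (simp add: not_less)
        next
          case False
          then show ?thesis
            using exp_neg_less_iff[OF score_gt_MInf[OF elim(2)], of i w "- ln (t j)"] t(4)[of j] by simp
        qed
        have approx: "\<bar>(\<integral>w. g (return E_borel (X i w, score n i w)) \<partial>M) - (\<Sum>j<N. m j * (F n (Suc j) - F n j))\<bar> \<le> \<epsilon> * F n N"
          if i: "i \<in> {1..n}" for i
        proof -
          have vm: "(\<lambda>w. exp_neg (score n i w)) \<in> borel_measurable M"
            by (rule measurable_compose[OF score_measurable[OF i] measurable_exp_neg])
          have "(\<integral>w. g (return E_borel (X i w, score n i w)) \<partial>M) =
              (\<integral>w. G (X i w) (exp_neg (score n i w)) * of_bool (exp_neg (score n i w) < V) \<partial>M)"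
            by (intro Bochner_Integration.integral_cong refl point_eq point_in_E[OF i])
          moreover have "\<bar>\<dots> - (\<Sum>j<N. (\<integral>x. G x (t (Suc j)) \<partial>cube_law) * (F n (Suc j) - F n j))\<bar> \<le> \<epsilon> * F n N"
          proof (rule integral_step_approximation)
            show "(\<integral>w. \<phi> (X i w) * of_bool (exp_neg (score n i w) < t j) \<partial>M) = (\<integral>x. \<phi> x \<partial>cube_law) * F n j"
              if j: "j \<le> N" and \<phi>: "\<phi> \<in> borel_measurable borel" "\<exists>B. \<forall>x. \<bar>\<phi> x\<bar> \<le> B" for \<phi> j
            proof (cases "j = 0")
              case True
              then show ?thesis by (simp add: tail_eq F_def)
            next
              case False
              then have "j \<in> {1..N}" using j by auto
              obtain B' where "\<forall>x. \<bar>\<phi> x\<bar> \<le> B'" using \<phi>(2) by blast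
              from elim(1)[rule_format, OF \<open>j \<in> {1..N}\<close> i \<phi>(1) this[rule_format]] show ?thesis
                using False by (simp add: tail_eq F_def)
            qed
            show "integrable M (\<lambda>w. of_bool (exp_neg (score n i w) < V) :: real)"
            proof (rule integrable_const_bound[where B = 1])
              have "(\<lambda>w. indicator {..<V} (exp_neg (score n i w)) :: real) \<in> borel_measurable M"
                by (rule measurable_compose[OF vm]) simp
              then show "(\<lambda>w. of_bool (exp_neg (score n i w) < V) :: real) \<in> borel_measurable M"
                by (simp add: indicator_def)
            qed simp
            show "X i \<in> borel_measurable M" using i by (intro X_measurable) auto
          qed (use vm Gm Gb step t tle exp_neg_nonneg in auto)
          ultimately show ?thesis by (simp add: m_def)
        qed
        have \<Sigma>n_eq: "\<Sigma>n n = (\<Sum>i\<in>{1..n}. \<Sum>j<N. m j * (F n (Suc j) - F n j)) / b n"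
        proof -
          have "\<Sigma>n n = (\<Sum>j<N. real n / b n * (m j * (F n (Suc j) - F n j)))"
            unfolding \<Sigma>n_def \<Phi>_def by (intro sum.cong) (auto simp: right_diff_distrib diff_divide_distrib mult_ac)
          also have "\<dots> = real n / b n * (\<Sum>j<N. m j * (F n (Suc j) - F n j))"
            by (simp only: sum_distrib_left)
          finally show ?thesis by simp
        qed
        have "\<bar>Q n - \<Sigma>n n\<bar> = \<bar>\<Sum>i\<in>{1..n}. (\<integral>w. g (return E_borel (X i w, score n i w)) \<partial>M) -
            (\<Sum>j<N. m j * (F n (Suc j) - F n j))\<bar> / b n"
          unfolding Q_def \<Sigma>n_eq diff_divide_distrib[symmetric] sum_subtractf[symmetric]
          using elim(3) by (simp only: abs_divide abs_of_pos)
        also have "\<dots> \<le> (\<Sum>i\<in>{1..n}. \<epsilon> * F n N) / b n"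
          using elim(3) by (intro divide_right_mono order_trans[OF sum_abs] sum_mono approx) auto
        also have "\<dots> = \<epsilon> * \<Phi> n N" by (simp add: \<Phi>_def)
        finally show ?case .
      qed
    qed
    have ev3: "eventually (\<lambda>n. \<Phi> n N < V + 1) sequentially"
    proof (rule order_tendstoD(2)[OF \<Phi>_lim])
      have "V / fact (k - 1) \<le> V / 1" using V f1 by (intro divide_left_mono) auto
      then show "t N / fact (k - 1) < V + 1" using t(1) by simp
    qed
    have "eventually (\<lambda>n. norm (Q n - \<xi>g) < \<eta>) sequentially"
      using ev1 ev2 ev3
    proof eventually_elim
      case (elim n)
      then have "\<epsilon> * \<Phi> n N \<le> \<epsilon> * (V + 1)" using \<epsilon>(1) by (intro mult_left_mono) auto
      then show ?case using elim lim_diff \<epsilon>(2) \<open>0 < \<eta>\<close> unfolding real_norm_def by linarith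
    qed
    then show "\<exists>no. \<forall>n\<ge>no. norm (Q n - \<xi>g) < \<eta>"
      unfolding eventually_sequentially .
  qed
  then show ?thesis unfolding Q_def \<xi>g_def .
qed

text \<open>
  The difference to the sum over single points is at most \<open>\<epsilon>\<close> times the expected number of exceedances,
  which is of order \<open>b n\<close>, plus a multiple of the expected number of pairs of exceedances,
  which is of smaller order.
\<close>

lemma functional_asymp:
  fixes g :: "((real ^ 'd) \<times> ereal) measure \<Rightarrow> real"
  assumes g: "g \<in> C0_functions"
  shows "(\<lambda>n. (\<integral>w. g (L_process k a (\<lambda>i. X i w) n) \<partial>M) / b n) \<longlonglongrightarrow> (\<integral>\<mu>. g \<mu> \<partial>xi_limit k)"
proof -
  obtain c where vanish: "\<And>J y. finite (J :: nat set) \<Longrightarrow> y \<in> J \<rightarrow> E_set \<Longrightarrow>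
    (\<And>j. j \<in> J \<Longrightarrow> snd (y j) \<le> ereal c) \<Longrightarrow> g (dirac_sum E_borel J y) = 0"
    using C0_vanishes_below[OF g] by blast
  obtain B where B: "0 < B" "\<And>\<mu>. \<mu> \<in> point_measures \<Longrightarrow> \<bar>g \<mu>\<bar> \<le> B"
    using C0_bounded[OF g] by blast
  define Q where "Q = (\<lambda>n. (\<Sum>i\<in>{1..n}. \<integral>w. g (return E_borel (X i w, score n i w)) \<partial>M) / b n)"
  have Q: "Q \<longlonglongrightarrow> (\<integral>\<mu>. g \<mu> \<partial>xi_limit k)"
    unfolding Q_def by (rule single_point_functional_asymp[OF g vanish])
  define P where "P = (\<lambda>n. (\<integral>w. g (L_process k a (\<lambda>i. X i w) n) \<partial>M) / b n)"
  have "(\<lambda>n. P n - Q n) \<longlonglongrightarrow> 0"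
  proof (rule LIMSEQ_I)
    fix \<eta> :: real assume "0 < \<eta>"
    define K where "K = exp (- c) / fact (k - 1)"
    have K: "0 < K" by (simp add: K_def)
    define \<epsilon> where "\<epsilon> = \<eta> / (2 * (K + 1))"
    have \<epsilon>: "0 < \<epsilon>" "\<epsilon> * (K + 1) = \<eta> / 2" using \<open>0 < \<eta>\<close> K by (auto simp: \<epsilon>_def field_simps)
    obtain c' where c': "c' \<le> c" and approx: "\<And>J y i. finite (J :: nat set) \<Longrightarrow> y \<in> J \<rightarrow> E_set \<Longrightarrow> i \<in> J \<Longrightarrow> ereal c \<le> snd (y i) \<Longrightarrow>
      (\<And>j. j \<in> J - {i} \<Longrightarrow> snd (y j) \<le> ereal c') \<Longrightarrow>
      \<bar>g (dirac_sum E_borel J y) - g (return E_borel (y i))\<bar> < \<epsilon>"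
      using C0_single_point_approx[OF g \<epsilon>(1), of c] by blast
    define Z where "Z = (\<lambda>n. (\<Sum>i\<in>{1..n}. \<Sum>j\<in>{1..n} - {i}. prob {w \<in> space M. ereal c' < score n i w \<and> ereal c' < score n j w}) / b n)"
    have Z: "Z \<longlonglongrightarrow> 0" unfolding Z_def by (rule pairs_asymp)
    define T where "T = (\<lambda>n. real n * binom_lower (n - 1) ((a n + c) / real n) k / b n)"
    have T: "T \<longlonglongrightarrow> K" unfolding T_def K_def by (rule one_point_asymp)
    have "(\<lambda>n. \<epsilon> * T n + 2 * B * Z n) \<longlonglongrightarrow> \<epsilon> * K + 2 * B * 0"
      by (intro tendsto_intros T Z)
    then have "eventually (\<lambda>n. \<epsilon> * T n + 2 * B * Z n < \<eta>) sequentially"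
    proof (rule order_tendstoD)
      have "\<epsilon> * K \<le> \<epsilon> * (K + 1)" using \<epsilon>(1) by simp
      then show "\<epsilon> * K + 2 * B * 0 < \<eta>" using \<epsilon>(2) \<open>0 < \<eta>\<close> by linarith
    qed
    moreover have "eventually (\<lambda>n. \<bar>P n - Q n\<bar> \<le> \<epsilon> * T n + 2 * B * Z n) sequentially"
      using one_point_tail[of c] eventually_gt_at_top[of k] eventually_b_pos
    proof eventually_elim
      case (elim n)
      let ?I = "{1..n}"
      let ?y = "\<lambda>w i. (X i w, score n i w)"
      have yE: "?y w \<in> ?I \<rightarrow> E_set" if "w \<in> space M" for w
        using point_in_E that by auto
      have single_m: "(\<lambda>w. g (return E_borel (?y w i))) \<in> borel_measurable M" if i: "i \<in> ?I" for i
      proof -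
        have "?y w i \<in> E_set" if "w \<in> space M" for w using point_in_E[OF i that] .
        moreover have "(\<lambda>w. ?y w i) \<in> borel_measurable M"
          using i X_measurable[of i] score_measurable[OF i] by (intro borel_measurable_Pair) auto
        ultimately have "(\<lambda>w. return E_borel (?y w i)) \<in> measurable M vague_borel"
          by (intro measurable_return_vague)
        from measurable_compose[OF this C0_measurable[OF g]] show ?thesis .
      qed
      have int_single: "integrable M (\<lambda>w. g (return E_borel (?y w i)))" if i: "i \<in> ?I" for i
      proof (rule integrable_const_bound[where B = B])
        show "AE w in M. norm (g (return E_borel (?y w i))) \<le> B"
          using B(2)[OF return_in_point_measures[OF point_in_E[OF i]]] by simp
      qed (rule single_m[OF i])
      have int_L: "integrable M (\<lambda>w. g (L_process k a (\<lambda>i. X i w) n))"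
      proof (rule integrable_const_bound[where B = B])
        show "AE w in M. norm (g (L_process k a (\<lambda>i. X i w) n)) \<le> B"
          using B(2) measurable_space[OF L_process_measurable] by simp
        show "(\<lambda>w. g (L_process k a (\<lambda>i. X i w) n)) \<in> borel_measurable M"
          by (rule measurable_compose[OF L_process_measurable C0_measurable[OF g]])
      qed
      have tail_set: "{w \<in> space M. ereal s < score n i w} \<in> events" if "i \<in> ?I" for i s
        using borel_measurable_less[OF borel_measurable_const score_measurable[OF that]] .
      have ob1: "integrable M (\<lambda>w. of_bool (ereal c < score n i w) :: real)" if i: "i \<in> ?I" for i
      proof -
        have "integrable M (indicator {w \<in> space M. ereal c < score n i w} :: 'w \<Rightarrow> real)"
          using tail_set[OF i] by (intro integrable_real_indicator) (auto simp: less_top[symmetric])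
        then show ?thesis
          by (rule Bochner_Integration.integrable_cong[THEN iffD1, OF refl, rotated]) (auto simp: indicator_def)
      qed
      have ob2: "integrable M (\<lambda>w. of_bool (ereal c' < score n i w \<and> ereal c' < score n j w) :: real)" (is ?int)
        and ob2': "(\<integral>w. of_bool (ereal c' < score n i w \<and> ereal c' < score n j w) \<partial>M) =
          prob {w \<in> space M. ereal c' < score n i w \<and> ereal c' < score n j w}" (is ?val)
        if i: "i \<in> ?I" and j: "j \<in> ?I" for i j
      proof -
        let ?A = "{w \<in> space M. ereal c' < score n i w \<and> ereal c' < score n j w}"
        have A: "?A \<in> events"
          using sets.Int[OF tail_set[OF i] tail_set[OF j], of c' c'] by (simp add: Int_def conj_ac)
        have "integrable M (indicator ?A :: 'w \<Rightarrow> real)"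
          using A by (intro integrable_real_indicator) (auto simp: less_top[symmetric])
        then show ?int
          by (rule Bochner_Integration.integrable_cong[THEN iffD1, OF refl, rotated]) (auto simp: indicator_def)
        have "(\<integral>w. of_bool (ereal c' < score n i w \<and> ereal c' < score n j w) \<partial>M) = (\<integral>w. indicator ?A w \<partial>M :: real)"
          by (rule Bochner_Integration.integral_cong[OF refl]) (auto simp: indicator_def)
        then show ?val using A by simp
      qed
      define A where "A = (\<lambda>w. \<epsilon> * (\<Sum>i\<in>?I. of_bool (ereal c < score n i w)))"
      define P2 where "P2 = (\<lambda>w. 2 * B * (\<Sum>i\<in>?I. \<Sum>j\<in>?I - {i}. of_bool (ereal c' < score n i w \<and> ereal c' < score n j w)))"
      have ob2_inner: "integrable M (\<lambda>w. \<Sum>j\<in>?I - {i}. of_bool (ereal c' < score n i w \<and> ereal c' < score n j w) :: real)"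
        if "i \<in> ?I" for i
        by (rule Bochner_Integration.integrable_sum, rule ob2[OF that]) simp
      have int_A: "integrable M A" and int_P2: "integrable M P2"
        unfolding A_def P2_def
        by (intro integrable_mult_right Bochner_Integration.integrable_sum ob1 ob2_inner; assumption)+
      have int_S: "integrable M (\<lambda>w. \<Sum>i\<in>?I. g (return E_borel (?y w i)))"
        by (rule Bochner_Integration.integrable_sum) (rule int_single)
      have "\<bar>(\<integral>w. g (L_process k a (\<lambda>i. X i w) n) \<partial>M) - (\<Sum>i\<in>?I. \<integral>w. g (return E_borel (?y w i)) \<partial>M)\<bar> =
          \<bar>\<integral>w. g (L_process k a (\<lambda>i. X i w) n) - (\<Sum>i\<in>?I. g (return E_borel (?y w i))) \<partial>M\<bar>"
      proof -
        have "(\<integral>w. (\<Sum>i\<in>?I. g (return E_borel (?y w i))) \<partial>M) = (\<Sum>i\<in>?I. \<integral>w. g (return E_borel (?y w i)) \<partial>M)"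
          by (rule Bochner_Integration.integral_sum) (rule int_single)
        then show ?thesis
          unfolding Bochner_Integration.integral_diff[OF int_L int_S] by simp
      qed
      also have "\<dots> \<le> (\<integral>w. \<bar>g (L_process k a (\<lambda>i. X i w) n) - (\<Sum>i\<in>?I. g (return E_borel (?y w i)))\<bar> \<partial>M)"
        by (rule integral_abs_bound)
      also have "\<dots> \<le> (\<integral>w. A w + P2 w \<partial>M)"
      proof (rule integral_mono[OF integrable_abs[OF Bochner_Integration.integrable_diff[OF int_L int_S]]
            Bochner_Integration.integrable_add[OF int_A int_P2]])
        fix w assume w: "w \<in> space M"
        have "\<bar>g (dirac_sum E_borel ?I (?y w)) - (\<Sum>i\<in>?I. g (return E_borel (?y w i)))\<bar> \<le>
          \<epsilon> * (\<Sum>i\<in>?I. of_bool (ereal c < snd (?y w i))) +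
          2 * B * (\<Sum>i\<in>?I. \<Sum>j\<in>?I - {i}. of_bool (ereal c' < snd (?y w i) \<and> ereal c' < snd (?y w j)))"
          by (rule functional_vs_single_points[OF finite_atLeastAtMost yE[OF w] c' less_imp_le[OF \<epsilon>(1)] B(2)])
            (assumption, fact vanish, fact approx)
        then show "\<bar>g (L_process k a (\<lambda>i. X i w) n) - (\<Sum>i\<in>?I. g (return E_borel (?y w i)))\<bar> \<le> A w + P2 w"
          unfolding L_process_eq[OF elim(2) w] A_def P2_def snd_conv .
      qed
      also have "\<dots> = (\<integral>w. A w \<partial>M) + (\<integral>w. P2 w \<partial>M)"
        by (rule Bochner_Integration.integral_add[OF int_A int_P2])
      also have "(\<integral>w. A w \<partial>M) = \<epsilon> * (\<Sum>i\<in>?I. \<integral>w. of_bool (ereal c < score n i w) \<partial>M)"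
      proof -
        have "(\<integral>w. (\<Sum>i\<in>?I. of_bool (ereal c < score n i w) :: real) \<partial>M) =
            (\<Sum>i\<in>?I. \<integral>w. of_bool (ereal c < score n i w) \<partial>M)"
          by (rule Bochner_Integration.integral_sum) (rule ob1)
        then show ?thesis unfolding A_def integral_mult_right_zero by simp
      qed
      also have "(\<integral>w. P2 w \<partial>M) =
          2 * B * (\<Sum>i\<in>?I. \<Sum>j\<in>?I - {i}. \<integral>w. of_bool (ereal c' < score n i w \<and> ereal c' < score n j w) \<partial>M)"
      proof -
        have "(\<integral>w. (\<Sum>i\<in>?I. \<Sum>j\<in>?I - {i}. of_bool (ereal c' < score n i w \<and> ereal c' < score n j w)) \<partial>M) =
            (\<Sum>i\<in>?I. \<integral>w. (\<Sum>j\<in>?I - {i}. of_bool (ereal c' < score n i w \<and> ereal c' < score n j w) :: real) \<partial>M)"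
          by (rule Bochner_Integration.integral_sum) (rule ob2_inner)
        also have "\<dots> = (\<Sum>i\<in>?I. \<Sum>j\<in>?I - {i}. \<integral>w. of_bool (ereal c' < score n i w \<and> ereal c' < score n j w) \<partial>M)"
        proof (rule sum.cong[OF refl])
          fix i assume "i \<in> ?I"
          then show "(\<integral>w. (\<Sum>j\<in>?I - {i}. of_bool (ereal c' < score n i w \<and> ereal c' < score n j w) :: real) \<partial>M) =
            (\<Sum>j\<in>?I - {i}. \<integral>w. of_bool (ereal c' < score n i w \<and> ereal c' < score n j w) \<partial>M)"
            by (intro Bochner_Integration.integral_sum ob2) simp_all
        qed
        finally show ?thesis
          unfolding P2_def integral_mult_right_zero by simp
      qed
      also have "\<epsilon> * (\<Sum>i\<in>?I. \<integral>w. of_bool (ereal c < score n i w) \<partial>M) +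
          2 * B * (\<Sum>i\<in>?I. \<Sum>j\<in>?I - {i}. \<integral>w. of_bool (ereal c' < score n i w \<and> ereal c' < score n j w) \<partial>M) =
          \<epsilon> * (\<Sum>i\<in>?I. binom_lower (n - 1) ((a n + c) / real n) k) +
          2 * B * (\<Sum>i\<in>?I. \<Sum>j\<in>?I - {i}. prob {w \<in> space M. ereal c' < score n i w \<and> ereal c' < score n j w})"
      proof -
        have tail: "(\<integral>w. of_bool (ereal c < score n i w) \<partial>M) = binom_lower (n - 1) ((a n + c) / real n) k" if i: "i \<in> ?I" for i
        proof -
          have "prob_space (cube_law :: (real ^ 'd) measure)" by (rule prob_space_cube_law)
          then have "measure (cube_law :: (real ^ 'd) measure) UNIV = 1"
            using prob_space.prob_space by fastforce
          then show ?thesis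
            using elim(1)[rule_format, OF i, of "\<lambda>_. 1" 1] by simp
        qed
        have "(\<Sum>i\<in>?I. \<integral>w. of_bool (ereal c < score n i w) \<partial>M) =
            (\<Sum>i\<in>?I. binom_lower (n - 1) ((a n + c) / real n) k)"
          by (rule sum.cong[OF refl]) (rule tail)
        moreover have "(\<Sum>i\<in>?I. \<Sum>j\<in>?I - {i}. \<integral>w. of_bool (ereal c' < score n i w \<and> ereal c' < score n j w) \<partial>M) =
            (\<Sum>i\<in>?I. \<Sum>j\<in>?I - {i}. prob {w \<in> space M. ereal c' < score n i w \<and> ereal c' < score n j w})"
          by (intro sum.cong refl ob2') simp_all
        ultimately show ?thesis by (simp only:)
      qed
      finally have "\<bar>P n - Q n\<bar> \<le> (\<epsilon> * (\<Sum>i\<in>?I. binom_lower (n - 1) ((a n + c) / real n) k) +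
          2 * B * (\<Sum>i\<in>?I. \<Sum>j\<in>?I - {i}. prob {w \<in> space M. ereal c' < score n i w \<and> ereal c' < score n j w})) / b n"
        unfolding P_def Q_def diff_divide_distrib[symmetric] abs_divide
        using elim(3) by (simp add: divide_right_mono)
      also have "\<dots> = \<epsilon> * T n + 2 * B * Z n"
        by (simp add: T_def Z_def add_divide_distrib)
      finally show ?case .
    qed
    ultimately have "eventually (\<lambda>n. norm (P n - Q n - 0) < \<eta>) sequentially"
      by eventually_elim simp
    then show "\<exists>no. \<forall>n\<ge>no. norm (P n - Q n - 0) < \<eta>"
      unfolding eventually_sequentially .
  qed
  from tendsto_add[OF this Q] show ?thesis by (simp add: P_def)
qed

lemma scaled_law_in_M0:
  fixes \<rho> :: "((real ^ 'd) \<times> ereal) measure \<Rightarrow> ((real ^ 'd) \<times> ereal) measure \<Rightarrow> real"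
  shows "scale_measure (ennreal q) (distr M vague_borel (\<lambda>w. L_process k a (\<lambda>i. X i w) n)) \<in> M0_measures \<rho>"
proof -
  let ?D = "distr M vague_borel (\<lambda>w. L_process k a (\<lambda>i. X i w) n)"
  interpret D: prob_space ?D
    by (rule prob_space_distr[OF L_process_measurable])
  have "emeasure (scale_measure (ennreal q) ?D) A < \<infinity>" for A
  proof -
    have "emeasure ?D A < \<top>" by (simp add: less_top[symmetric])
    then show ?thesis by (simp add: ennreal_mult_less_top)
  qed
  then show ?thesis by (simp add: M0_measures_def)
qed

end

theorem corollary3p2:
  fixes M :: "'w measure"
    and X :: "nat \<Rightarrow> 'w \<Rightarrow> real ^ 'd::finite"
    and a b :: "nat \<Rightarrow> real"
    and k :: nat
    and \<rho> :: "((real ^ 'd) \<times> ereal) measure \<Rightarrow> ((real ^ 'd) \<times> ereal) measure \<Rightarrow> real"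
  assumes "k \<ge> 1"
    and "vague_metric \<rho>"
    and "prob_space M"
    and "prob_space.indep_vars M (\<lambda>_. borel) X {1..}"
    and "\<And>i. i \<ge> 1 \<Longrightarrow> distr M borel (X i) = uniform_measure lborel unit_cube"
    and "\<And>i w. i \<ge> 1 \<Longrightarrow> w \<in> space M \<Longrightarrow> X i w \<in> unit_cube"
    and "filterlim (\<lambda>n. a n - ln (real n) - (real k - 1) * ln (ln (real n))) at_top sequentially"
    and "a \<in> o(\<lambda>n. real n powr (1 / 3))"
    and "\<And>n. b n = real n * a n ^ (k - 1) * exp (- a n)"
  shows "M0_converges \<rho>
           (\<lambda>n. scale_measure (ennreal (1 / b n))
                  (distr M vague_borel (\<lambda>w. L_process k a (\<lambda>i. X i w) n)))
           (xi_limit k)"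
proof -
  interpret prob_space M by fact
  interpret knn_sample M X a b k
    by unfold_locales (use assms in auto)
  have "(\<lambda>n. \<integral>\<mu>. g \<mu> \<partial>scale_measure (ennreal (1 / b n)) (distr M vague_borel (\<lambda>w. L_process k a (\<lambda>i. X i w) n)))
      \<longlonglongrightarrow> (\<integral>\<mu>. g \<mu> \<partial>xi_limit k)" if g: "g \<in> C0_functions" for g
  proof (rule Lim_transform_eventually[OF functional_asymp[OF g]])
    show "eventually (\<lambda>n. (\<integral>w. g (L_process k a (\<lambda>i. X i w) n) \<partial>M) / b n =
        (\<integral>\<mu>. g \<mu> \<partial>scale_measure (ennreal (1 / b n)) (distr M vague_borel (\<lambda>w. L_process k a (\<lambda>i. X i w) n)))) sequentially"
      using eventually_b_pos
    proof eventually_elim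
      case (elim n)
      have "g \<in> borel_measurable (distr M vague_borel (\<lambda>w. L_process k a (\<lambda>i. X i w) n))"
        using C0_measurable[OF g] by simp
      then show ?case
        using elim integral_distr[OF L_process_measurable C0_measurable[OF g]]
        by (subst integral_scale_measure) auto
    qed
  qed
  then show ?thesis
    unfolding M0_converges_def using scaled_law_in_M0 xi_limit_in_M0[OF assms(2)] by blast
qed

end
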